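(* Let $\Sigma=\{0,1\}$. For each $t,c,a\in\{\mathrm{Y},\mathrm{N},\ast\}$, there exists an $(\mathrm{N},t,c,a)$-OWF if and only if $\mathrm{P}\neq\mathrm{NP}$.
   Context: All functions considered are partial functions $\sigma:\Sigma^*\times\Sigma^*\to\Sigma^*$ (possibly undefined on some pairs), with $\Sigma=\{0,1\}$. $\langle\cdot,\cdot\rangle$ is a standard pairing function: a total, polynomial-time computable bijection $\Sigma^*\times\Sigma^*\to\Sigma^*$ with polynomial-time computable inverses, nondecreasing in each argument. FP is the class of (total or partial) polynomial-time computable functions. - $\sigma$ is honest if there is a polynomial $p$ such that every $z\in\mathrm{image}(\sigma)$ has some $(x,y)\in\mathrm{domain}(\sigma)$ with $\sigma(x,y)=z$ and $|x|+|y|\le p(|z|)$. - $\sigma$ is noninvertible if there is no $f\in\mathrm{FP}$ with $\sigma(f(z))=z$ for all $z\in\mathrm{image}(\sigma)$. - $\sigma$ is a one-way function if it is polynomial-time computable, honest and noninvertible. - $\sigma$ is total if it is defined on every pair, and nontotal otherwise. - Let $\Gamma=\Sigma^*\cup\{\bot\}$ and $\hat\sigma(x,y)=\sigma(x,y)$ if $x\ne\bot$, $y\ne\bot$ and $(x,y)\in\mathrm{domain}(\sigma)$, with $\hat\sigma(x,y)=\bot$ otherwise. $\sigma$ is associative if $\hat\sigma(\hat\sigma(x,y),z)=\hat\sigma(x,\hat\sigma(y,z))$ for all $x,y,z\in\Sigma^*$. It is commutative if $\hat\sigma(x,y)=\hat\sigma(y,x)$ for all $x,y\in\Sigma^*$.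 - $\sigma$ is s-honest if there is a polynomial $p$ such that (a) whenever $\sigma(x,y)=z$ for some $y$, there is $\hat y$ with $\sigma(x,\hat y)=z$ and $|\hat y|\le p(|x|+|z|)$; and (b) whenever $\sigma(x,y)=z$ for some $x$, there is $\hat x$ with $\sigma(\hat x,y)=z$ and $|\hat x|\le p(|y|+|z|)$. - $\sigma$ is invertible with respect to the first argument if there is $g_1\in\mathrm{FP}$ such that for all $z\in\mathrm{image}(\sigma)$ and all $(x,y)\in\mathrm{domain}(\sigma)$ with $\sigma(x,y)=z$, we have $\sigma(x,g_1(\langle x,z\rangle))=z$. It is invertible with respect to the second argument if there is $g_2\in\mathrm{FP}$ with $\sigma(g_2(\langle y,z\rangle),y)=z$ for all such $z,x,y$. - $\sigma$ is strongly noninvertible if it is invertible with respect to neither argument. - $\sigma$ is strong if it is polynomial-time computable, s-honest and strongly noninvertible. - For $s,t,c,a\in\{\mathrm{Y},\mathrm{N},\ast\}$, $\sigma$ is an $(s,t,c,a)$-OWF if $\sigma$ is a one-way function and all of the following hold: if $s=\mathrm{Y}$ then $\sigma$ is strong, and if $s=\mathrm{N}$ it is not strong; if $t=\mathrm{Y}$ it is total, and if $t=\mathrm{N}$ it is nontotal; if $c=\mathrm{Y}$ it is commutative, and if $c=\mathrm{N}$ it is not commutative; if $a=\mathrm{Y}$ it is associative, and if $a=\mathrm{N}$ it is not associative. The value $\ast$ imposes no condition. *)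

theory Defs
  imports Main "HOL-Computational_Algebra.Polynomial"
begin

type_synonym bits = "bool list"

subsection \<open>Deterministic multi-tape Turing machines\<close>

text \<open>
  States and tape symbols are initial segments of the natural numbers. Symbol 0 is the blank,
  symbols 1 and 2 are the input/output symbols for the bits 0 and 1. Tapes are two-way infinite.
\<close>

datatype move = Move_Left | Stay | Move_Right

fun offset :: "move \<Rightarrow> int" where
  "offset Move_Left = -1"
| "offset Stay = 0"
| "offset Move_Right = 1"

record tm =
  num_tapes :: nat
  num_states :: nat
  num_symbols :: nat
  start_state :: nat
  accept_state :: nat
  reject_state :: nat
  transition :: "nat \<Rightarrow> nat list \<Rightarrow> nat \<times> (nat \<times> move) list"

definition halting :: "tm \<Rightarrow> nat \<Rightarrow> bool" where
  "halting M q \<longleftrightarrow> q = accept_state M \<or> q = reject_state M"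

text \<open>
  Only the values of the transition function on non-halting states below \<open>num_states\<close> and
  on \<open>num_tapes\<close> many symbols below \<open>num_symbols\<close> matter, so that a well-formed
  machine is a finite object.
\<close>

definition wf_tm :: "tm \<Rightarrow> bool" where
  "wf_tm M \<longleftrightarrow>
     1 \<le> num_tapes M \<and> 3 \<le> num_symbols M \<and>
     start_state M < num_states M \<and> accept_state M < num_states M \<and>
     reject_state M < num_states M \<and> accept_state M \<noteq> reject_state M \<and>
     (\<forall>q rs. q < num_states M \<longrightarrow> \<not> halting M q \<longrightarrow>
        length rs = num_tapes M \<longrightarrow> (\<forall>r\<in>set rs. r < num_symbols M) \<longrightarrow>
        fst (transition M q rs) < num_states M \<and>
        length (snd (transition M q rs)) = num_tapes M \<and>
        (\<forall>(a, m)\<in>set (snd (transition M q rs)). a < num_symbols M))"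

text \<open>A tape is its contents together with the head position.\<close>

type_synonym tape = "(int \<Rightarrow> nat) \<times> int"
type_synonym config = "nat \<times> tape list"

fun read_tape :: "tape \<Rightarrow> nat" where
  "read_tape (c, h) = c h"

fun act :: "nat \<times> move \<Rightarrow> tape \<Rightarrow> tape" where
  "act (a, m) (c, h) = (c(h := a), h + offset m)"

definition step :: "tm \<Rightarrow> config \<Rightarrow> config" where
  "step M = (\<lambda>(q, ts).
     if halting M q then (q, ts)
     else let (q', as) = transition M q (map read_tape ts) in (q', map2 act as ts))"

definition contents_of :: "bits \<Rightarrow> int \<Rightarrow> nat" where
  "contents_of w = (\<lambda>i. if 0 \<le> i \<and> i < int (length w)
                        then (if w ! nat i then 2 else 1) else 0)"

definition initial :: "tm \<Rightarrow> bits list \<Rightarrow> config" where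
  "initial M ws =
     (start_state M,
      map (\<lambda>i. (contents_of (if i < length ws then ws ! i else []), 0)) [0..<num_tapes M])"

definition run :: "tm \<Rightarrow> bits list \<Rightarrow> nat \<Rightarrow> config" where
  "run M ws t = (step M ^^ t) (initial M ws)"

definition total_length :: "bits list \<Rightarrow> nat" where
  "total_length ws = sum_list (map length ws)"


subsection \<open>Polynomial time\<close>

text \<open>
  Halting configurations are fixed points of \<^const>\<open>step\<close>, so being in a halting state after
  exactly \<open>t\<close> steps means having halted within \<open>t\<close> steps. A partial function is computed
  by accepting, with the value as the only contents of the last tape, where it is defined, and
  by rejecting elsewhere. The machine has to be clocked on all inputs, also outside the domain.
\<close>

definition ptime_computable :: "nat \<Rightarrow> (bits list \<Rightarrow> bits option) \<Rightarrow> bool" where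
  "ptime_computable n f \<longleftrightarrow>
     (\<exists>M (p :: nat poly). wf_tm M \<and> n \<le> num_tapes M \<and>
        (\<forall>ws. length ws = n \<longrightarrow>
           (let (q, ts) = run M ws (poly p (total_length ws)) in
              case f ws of
                None \<Rightarrow> q = reject_state M
              | Some w \<Rightarrow> q = accept_state M \<and> fst (last ts) = contents_of w)))"

definition ptime_decidable :: "nat \<Rightarrow> (bits list \<Rightarrow> bool) \<Rightarrow> bool" where
  "ptime_decidable n A \<longleftrightarrow>
     (\<exists>M (p :: nat poly). wf_tm M \<and> n \<le> num_tapes M \<and>
        (\<forall>ws. length ws = n \<longrightarrow>
           fst (run M ws (poly p (total_length ws))) =
             (if A ws then accept_state M else reject_state M)))"

definition FP1 :: "(bits \<rightharpoonup> bits) \<Rightarrow> bool" where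
  "FP1 f \<longleftrightarrow> ptime_computable 1 (\<lambda>ws. f (ws ! 0))"

definition FP2 :: "(bits \<times> bits \<rightharpoonup> bits) \<Rightarrow> bool" where
  "FP2 f \<longleftrightarrow> ptime_computable 2 (\<lambda>ws. f (ws ! 0, ws ! 1))"

definition class_P :: "bits set set" where
  "class_P = {L. ptime_decidable 1 (\<lambda>ws. ws ! 0 \<in> L)}"

text \<open>NP is defined by polynomial-time verifiers with certificates of polynomial length.\<close>

definition class_NP :: "bits set set" where
  "class_NP =
     {L. \<exists>V (p :: nat poly). ptime_decidable 2 (\<lambda>ws. V (ws ! 0) (ws ! 1)) \<and>
           (\<forall>x. x \<in> L \<longleftrightarrow> (\<exists>u. length u \<le> poly p (length x) \<and> V x u))}"


subsection \<open>Pairing functions\<close>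

text \<open>The standard order on strings: by length, and lexicographically for equal lengths.\<close>

definition bits_le :: "bits \<Rightarrow> bits \<Rightarrow> bool" where
  "bits_le x y \<longleftrightarrow> x = y \<or> (x, y) \<in> lenlex {(False, True)}"

definition standard_pairing :: "(bits \<times> bits \<Rightarrow> bits) \<Rightarrow> bool" where
  "standard_pairing pair \<longleftrightarrow>
     bij pair \<and>
     FP2 (\<lambda>xy. Some (pair xy)) \<and>
     FP1 (\<lambda>w. Some (fst (inv pair w))) \<and>
     FP1 (\<lambda>w. Some (snd (inv pair w))) \<and>
     (\<forall>x x' y. bits_le x x' \<longrightarrow> bits_le (pair (x, y)) (pair (x', y))) \<and>
     (\<forall>x y y'. bits_le y y' \<longrightarrow> bits_le (pair (x, y)) (pair (x, y')))"


subsection \<open>One-way functions\<close>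

definition honest :: "(bits \<times> bits \<rightharpoonup> bits) \<Rightarrow> bool" where
  "honest \<sigma> \<longleftrightarrow>
     (\<exists>p :: nat poly. \<forall>z \<in> ran \<sigma>. \<exists>x y.
        \<sigma> (x, y) = Some z \<and> length x + length y \<le> poly p (length z))"

text \<open>
  An inverter outputs a pair of strings, which is represented by a single string by means of
  the pairing function.
\<close>

definition noninvertible :: "(bits \<times> bits \<Rightarrow> bits) \<Rightarrow> (bits \<times> bits \<rightharpoonup> bits) \<Rightarrow> bool" where
  "noninvertible pair \<sigma> \<longleftrightarrow>
     \<not> (\<exists>f :: bits \<rightharpoonup> bits \<times> bits.
           FP1 (\<lambda>z. map_option pair (f z)) \<and> (\<forall>z \<in> ran \<sigma>. (\<sigma> \<circ>\<^sub>m f) z = Some z))"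

definition one_way :: "(bits \<times> bits \<Rightarrow> bits) \<Rightarrow> (bits \<times> bits \<rightharpoonup> bits) \<Rightarrow> bool" where
  "one_way pair \<sigma> \<longleftrightarrow> FP2 \<sigma> \<and> honest \<sigma> \<and> noninvertible pair \<sigma>"

definition total_function :: "(bits \<times> bits \<rightharpoonup> bits) \<Rightarrow> bool" where
  "total_function \<sigma> \<longleftrightarrow> dom \<sigma> = UNIV"

text \<open>In the extension of \<open>\<sigma>\<close> to \<open>\<Gamma>\<close>, the value \<^const>\<open>None\<close> plays the role of bottom.\<close>

fun extension :: "(bits \<times> bits \<rightharpoonup> bits) \<Rightarrow> bits option \<Rightarrow> bits option \<Rightarrow> bits option" where
  "extension \<sigma> (Some x) (Some y) = \<sigma> (x, y)"
| "extension \<sigma> _ _ = None"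

definition associative :: "(bits \<times> bits \<rightharpoonup> bits) \<Rightarrow> bool" where
  "associative \<sigma> \<longleftrightarrow>
     (\<forall>x y z. extension \<sigma> (extension \<sigma> (Some x) (Some y)) (Some z) =
              extension \<sigma> (Some x) (extension \<sigma> (Some y) (Some z)))"

definition commutative :: "(bits \<times> bits \<rightharpoonup> bits) \<Rightarrow> bool" where
  "commutative \<sigma> \<longleftrightarrow>
     (\<forall>x y. extension \<sigma> (Some x) (Some y) = extension \<sigma> (Some y) (Some x))"

definition s_honest :: "(bits \<times> bits \<rightharpoonup> bits) \<Rightarrow> bool" where
  "s_honest \<sigma> \<longleftrightarrow>
     (\<exists>p :: nat poly.
        (\<forall>x z. (\<exists>y. \<sigma> (x, y) = Some z) \<longrightarrow>
           (\<exists>y'. \<sigma> (x, y') = Some z \<and> length y' \<le> poly p (length x + length z))) \<and>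
        (\<forall>y z. (\<exists>x. \<sigma> (x, y) = Some z) \<longrightarrow>
           (\<exists>x'. \<sigma> (x', y) = Some z \<and> length x' \<le> poly p (length y + length z))))"

definition invertible_fst :: "(bits \<times> bits \<Rightarrow> bits) \<Rightarrow> (bits \<times> bits \<rightharpoonup> bits) \<Rightarrow> bool" where
  "invertible_fst pair \<sigma> \<longleftrightarrow>
     (\<exists>g. FP1 g \<and> (\<forall>x y z. \<sigma> (x, y) = Some z \<longrightarrow>
        (\<exists>w. g (pair (x, z)) = Some w \<and> \<sigma> (x, w) = Some z)))"

definition invertible_snd :: "(bits \<times> bits \<Rightarrow> bits) \<Rightarrow> (bits \<times> bits \<rightharpoonup> bits) \<Rightarrow> bool" where
  "invertible_snd pair \<sigma> \<longleftrightarrow>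
     (\<exists>g. FP1 g \<and> (\<forall>x y z. \<sigma> (x, y) = Some z \<longrightarrow>
        (\<exists>w. g (pair (y, z)) = Some w \<and> \<sigma> (w, y) = Some z)))"

definition strongly_noninvertible ::
    "(bits \<times> bits \<Rightarrow> bits) \<Rightarrow> (bits \<times> bits \<rightharpoonup> bits) \<Rightarrow> bool" where
  "strongly_noninvertible pair \<sigma> \<longleftrightarrow> \<not> invertible_fst pair \<sigma> \<and> \<not> invertible_snd pair \<sigma>"

definition strong :: "(bits \<times> bits \<Rightarrow> bits) \<Rightarrow> (bits \<times> bits \<rightharpoonup> bits) \<Rightarrow> bool" where
  "strong pair \<sigma> \<longleftrightarrow> FP2 \<sigma> \<and> s_honest \<sigma> \<and> strongly_noninvertible pair \<sigma>"

datatype requirement = Y | N | Star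

fun meets :: "requirement \<Rightarrow> bool \<Rightarrow> bool" where
  "meets Y b \<longleftrightarrow> b"
| "meets N b \<longleftrightarrow> \<not> b"
| "meets Star b \<longleftrightarrow> True"

definition OWF ::
    "(bits \<times> bits \<Rightarrow> bits) \<Rightarrow> requirement \<Rightarrow> requirement \<Rightarrow> requirement \<Rightarrow> requirement \<Rightarrow>
     (bits \<times> bits \<rightharpoonup> bits) \<Rightarrow> bool" where
  "OWF pair s t c a \<sigma> \<longleftrightarrow>
     one_way pair \<sigma> \<and> meets s (strong pair \<sigma>) \<and> meets t (total_function \<sigma>) \<and>
     meets c (commutative \<sigma>) \<and> meets a (associative \<sigma>)"

end

theory Submission
  imports Defs
begin

text \<open>
  Machines are written as programs of a small language whose data are the tapes and which can call
  given machines as subroutines; a Turing machine executes a program with the list of commands that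
  remain to be executed as its state.

  If P = NP, a polynomially honest function is inverted by extending a prefix of a preimage bit by
  bit, asking in each step an NP question about the existence of a short completion.

  If P differs from NP, let V be a verifier for a language L in NP outside P. Multiply strings by
  \<open>\<langle>x, u\<rangle> \<cdot> \<langle>x, u\<rangle> = x\<close> if V accepts u as a witness for x, and let all other products be the
  same constant, or undefined. Inverting this multiplication produces witnesses. Every triple
  product is trivial, so it is associative and commutative, and a product can be divided by its
  first factor because the second one is the same string, so it is not strong. Changing a few
  products of strings that encode neither witnesses nor instances destroys commutativity or
  associativity.
\<close>

section \<open>A small tape language and its compilation to Turing machines\<close>

text \<open>The obstacle on the machine side is the subroutine call. A called machine may leave
  symbols with gaps of blanks anywhere on its tapes, so its garbage could not be located and erased
  before the next call; replacing the blanks that it writes by a fresh symbol removes the gaps. On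
  the algebraic side, a product of witness codes is an instance code. Witness codes start with
  \<open>True\<close> and instance codes with \<open>False # False\<close>, so a product is never a
  factor of another nontrivial product; this makes triple products trivial. Commutativity holds
  because only squares are nontrivial. Strings that start with a single \<open>False\<close> are
  left over for the perturbations. The verifier is made to reject long certificates, which gives
  honesty. An inverter need not be trusted: the first component of its answer is checked to be a
  witness code for the instance at hand, and this check decides \<open>L\<close>. To refute strength
  it is enough to divide by one factor, since strong noninvertibility forbids inversion with respect
  to either argument.\<close>

type_synonym tapes = "nat \<Rightarrow> tape"

text \<open>
  \<open>Sim M b fl q\<close> runs \<open>M\<close> from state \<open>q\<close> on the tapes from \<open>b\<close> on and writes its verdict to tape \<open>fl\<close>. It
  writes the fresh symbol \<open>num_symbols M\<close> in place of blanks and reads it as a blank.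
\<close>

datatype com =
    Act nat "nat option" move
  | Seq com com
  | Cond nat "nat \<Rightarrow> bool" com com
  | While nat "nat \<Rightarrow> bool" com
  | Sim tm nat nat nat

definition mark :: "tm \<Rightarrow> nat \<Rightarrow> nat" where
  "mark M a = (if a = 0 then num_symbols M else a)"

text \<open>Every symbol outside the alphabet of \<open>M\<close> counts as a blank, not only the
  mark, so the transition function is always asked about legal symbols, whatever the tapes
  hold.\<close>

definition unmark :: "tm \<Rightarrow> nat \<Rightarrow> nat" where
  "unmark M a = (if a < num_symbols M then a else 0)"

text \<open>The list is a stack of pending commands. A step sees only the symbols under the heads. A
  tape that is left alone rewrites the symbol read and stays, because a machine step acts on all
  tapes at once.\<close>

fun cnext :: "com list \<Rightarrow> (nat \<Rightarrow> nat) \<Rightarrow> com list \<times> (nat \<Rightarrow> nat \<times> move)" where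
  "cnext [] r = ([], \<lambda>j. (r j, Stay))"
| "cnext (Act i a m # K) r =
     (K, \<lambda>j. if j = i then (case a of None \<Rightarrow> r i | Some x \<Rightarrow> x, m) else (r j, Stay))"
| "cnext (Seq c d # K) r = (c # d # K, \<lambda>j. (r j, Stay))"
| "cnext (Cond i P c d # K) r = ((if P (r i) then c else d) # K, \<lambda>j. (r j, Stay))"
| "cnext (While i P c # K) r =
     (if P (r i) then c # While i P c # K else K, \<lambda>j. (r j, Stay))"
| "cnext (Sim M b fl q # K) r =
     (if halting M q
      then (K, \<lambda>j. (if j = fl then if q = accept_state M then 2 else 1 else r j, Stay))
      else let (q', as) = transition M q (map (\<lambda>i. unmark M (r (b + i))) [0..<num_tapes M])
           in (Sim M b fl q' # K,
               \<lambda>j. if b \<le> j \<and> j < b + num_tapes M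
                   then (mark M (fst (as ! (j - b))), snd (as ! (j - b))) else (r j, Stay)))"

definition cstep :: "com list \<times> tapes \<Rightarrow> com list \<times> tapes" where
  "cstep = (\<lambda>(K, s). let (K', a) = cnext K (\<lambda>j. read_tape (s j)) in (K', \<lambda>j. act (a j) (s j)))"

text \<open>Quantifying over the pending commands \<open>K\<close> makes a run usable in every
  context, and the exact number of steps lets consecutive runs be added.\<close>

definition exec :: "com \<Rightarrow> tapes \<Rightarrow> nat \<Rightarrow> tapes \<Rightarrow> bool" where
  "exec c s t s' \<longleftrightarrow> (\<forall>K. (cstep ^^ t) (c # K, s) = (K, s'))"

lemma act_read_Stay [simp]: "act (read_tape T, Stay) T = T"
  by (cases T) auto

lemma cstep_simps [simp]:
  "cstep ([], s) = ([], s)"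
  "cstep (Act i a m # K, s) =
     (K, s(i := act (case a of None \<Rightarrow> read_tape (s i) | Some x \<Rightarrow> x, m) (s i)))"
  "cstep (Seq c d # K, s) = (c # d # K, s)"
  "cstep (Cond i P c d # K, s) = ((if P (read_tape (s i)) then c else d) # K, s)"
  "cstep (While i P c # K, s) =
     (if P (read_tape (s i)) then c # While i P c # K else K, s)"
  "halting M q \<Longrightarrow> cstep (Sim M b fl q # K, s) =
     (K, s(fl := act (if q = accept_state M then 2 else 1, Stay) (s fl)))"
  by (auto simp: cstep_def fun_eq_iff)

lemma cstep_Sim:
  assumes "\<not> halting M q"
    and "transition M q (map (\<lambda>i. unmark M (read_tape (s (b + i)))) [0..<num_tapes M]) = (q', as)"
  shows "cstep (Sim M b fl q # K, s) =
    (Sim M b fl q' # K,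
     \<lambda>j. if b \<le> j \<and> j < b + num_tapes M
         then act (mark M (fst (as ! (j - b))), snd (as ! (j - b))) (s j) else s j)"
  using assms by (auto simp: cstep_def fun_eq_iff)

lemma exec_Act:
  "exec (Act i a m) s 1 (s(i := act (case a of None \<Rightarrow> read_tape (s i) | Some x \<Rightarrow> x, m) (s i)))"
  by (simp add: exec_def del: One_nat_def) simp

lemma funpow_apply_add: "(f ^^ (m + n)) x = (f ^^ n) ((f ^^ m) x)"
  by (metis add.commute comp_apply funpow_add)

lemma exec_Seq:
  assumes "exec c s t s'" "exec d s' t' s''"
  shows "exec (Seq c d) s (1 + t + t') s''"
  unfolding exec_def funpow_apply_add using assms by (simp add: exec_def)

lemma exec_Cond:
  assumes "exec (if P (read_tape (s i)) then c else d) s t s'"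
  shows "exec (Cond i P c d) s (1 + t) s'"
  unfolding exec_def funpow_apply_add using assms by (simp add: exec_def)

lemma exec_While_False:
  assumes "\<not> P (read_tape (s i))"
  shows "exec (While i P c) s 1 s"
  using assms by (simp add: exec_def)

lemma exec_While_True:
  assumes "P (read_tape (s i))" "exec c s t s'" "exec (While i P c) s' t' s''"
  shows "exec (While i P c) s (1 + t + t') s''"
  unfolding exec_def funpow_apply_add using assms by (simp add: exec_def)

section \<open>Resources of a program and finiteness of its control\<close>

fun tape_bound :: "com \<Rightarrow> nat" where
  "tape_bound (Act i a m) = Suc i"
| "tape_bound (Seq c d) = max (tape_bound c) (tape_bound d)"
| "tape_bound (Cond i P c d) = max (Suc i) (max (tape_bound c) (tape_bound d))"
| "tape_bound (While i P c) = max (Suc i) (tape_bound c)"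
| "tape_bound (Sim M b fl q) = max (Suc fl) (b + num_tapes M)"

fun symbol_bound :: "com \<Rightarrow> nat" where
  "symbol_bound (Act i a m) = (case a of None \<Rightarrow> 0 | Some x \<Rightarrow> Suc x)"
| "symbol_bound (Seq c d) = max (symbol_bound c) (symbol_bound d)"
| "symbol_bound (Cond i P c d) = max (symbol_bound c) (symbol_bound d)"
| "symbol_bound (While i P c) = symbol_bound c"
| "symbol_bound (Sim M b fl q) = max 3 (Suc (num_symbols M))"

fun ok :: "com \<Rightarrow> bool" where
  "ok (Act i a m) \<longleftrightarrow> True"
| "ok (Seq c d) \<longleftrightarrow> ok c \<and> ok d"
| "ok (Cond i P c d) \<longleftrightarrow> ok c \<and> ok d"
| "ok (While i P c) \<longleftrightarrow> ok c"
| "ok (Sim M b fl q) \<longleftrightarrow> wf_tm M \<and> q < num_states M"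

lemma wf_tm_unmark:
  assumes "wf_tm M" "q < num_states M" "\<not> halting M q"
    and "transition M q (map (\<lambda>i. unmark M (r i)) [0..<num_tapes M]) = (q', as)"
  shows "q' < num_states M" "length as = num_tapes M" "i < length as \<Longrightarrow> fst (as ! i) < num_symbols M"
proof -
  have "\<forall>x\<in>set (map (\<lambda>i. unmark M (r i)) [0..<num_tapes M]). x < num_symbols M"
    using assms(1) by (auto simp: unmark_def wf_tm_def)
  with assms have *: "q' < num_states M \<and> length as = num_tapes M \<and>
      (\<forall>(a, m)\<in>set as. a < num_symbols M)"
    unfolding wf_tm_def by (metis (no_types, lifting) fst_conv snd_conv length_map length_upt minus_nat.diff_0)
  then show "q' < num_states M" "length as = num_tapes M" by auto
  show "i < length as \<Longrightarrow> fst (as ! i) < num_symbols M"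
    using * nth_mem[of i as] by (cases "as ! i") force
qed

text \<open>The stacks that can occur while \<open>c\<close> runs on top of \<open>K\<close>; they
  become the states of the compiled machine. They are finitely many although loops push themselves
  again: the body always runs on top of the same stack \<open>While i P c # K\<close>, and a
  simulation varies only the state of its machine.\<close>

fun conts :: "com \<Rightarrow> com list \<Rightarrow> com list set" where
  "conts (Act i a m) K = {Act i a m # K}"
| "conts (Seq c d) K = {Seq c d # K} \<union> conts c (d # K) \<union> conts d K"
| "conts (Cond i P c d) K = {Cond i P c d # K} \<union> conts c K \<union> conts d K"
| "conts (While i P c) K = {While i P c # K} \<union> conts c (While i P c # K)"
| "conts (Sim M b fl q) K = (\<lambda>q'. Sim M b fl q' # K) ` {..<num_states M}"

lemma finite_conts: "finite (conts c K)"
  by (induction c arbitrary: K) auto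

lemma conts_self: "ok c \<Longrightarrow> c # K \<in> conts c K"
  by (cases c) auto

lemma conts_closed:
  "ok c \<Longrightarrow> L \<in> conts c K \<Longrightarrow> fst (cnext L r) \<in> insert K (conts c K)"
proof (induction c arbitrary: K)
  case (Seq c d)
  from Seq.prems consider "L = Seq c d # K" | "L \<in> conts c (d # K)" | "L \<in> conts d K" by auto
  then show ?case
    using Seq.IH(1)[of "d # K"] Seq.IH(2)[of K] Seq.prems(1) conts_self[of c "d # K"] conts_self[of d K]
    by cases auto
next
  case (Cond i P c d)
  from Cond.prems consider "L = Cond i P c d # K" | "L \<in> conts c K" | "L \<in> conts d K" by auto
  then show ?case
    using Cond.IH(1)[of K] Cond.IH(2)[of K] Cond.prems(1) conts_self[of c K] conts_self[of d K]
    by cases auto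
next
  case (While i P c)
  from While.prems consider "L = While i P c # K" | "L \<in> conts c (While i P c # K)" by auto
  then show ?case
    using While.IH[of "While i P c # K"] While.prems(1) conts_self[of c "While i P c # K"]
    by cases auto
next
  case (Sim M b fl q)
  then obtain q1 where q1: "L = Sim M b fl q1 # K" "q1 < num_states M" "wf_tm M" by auto
  obtain q' as where t: "transition M q1 (map (\<lambda>i. unmark M (r (b + i))) [0..<num_tapes M]) = (q', as)"
    by fastforce
  show ?case
    using q1 t wf_tm_unmark(1)[OF q1(3,2) _ t] by (cases "halting M q1") auto
qed auto

lemma conts_head:
  assumes "ok c" "L \<in> conts c K"
  shows "\<exists>d L'. L = d # L' \<and> ok d \<and> tape_bound d \<le> tape_bound c \<and> symbol_bound d \<le> symbol_bound c"
  using assms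
proof (induction c arbitrary: K)
  case (Seq c d)
  from Seq.prems consider "L = Seq c d # K" | "L \<in> conts c (d # K)" | "L \<in> conts d K" by auto
  then show ?case
    using Seq.IH(1)[of "d # K"] Seq.IH(2)[of K] Seq.prems(1)
    by cases (auto simp: le_max_iff_disj)
next
  case (Cond i P c d)
  from Cond.prems consider "L = Cond i P c d # K" | "L \<in> conts c K" | "L \<in> conts d K" by auto
  then show ?case
    using Cond.IH(1)[of K] Cond.IH(2)[of K] Cond.prems(1)
    by cases (auto simp: le_max_iff_disj)
next
  case (While i P c)
  from While.prems consider "L = While i P c # K" | "L \<in> conts c (While i P c # K)" by auto
  then show ?case
    using While.IH[of "While i P c # K"] While.prems(1)
    by cases (auto simp: le_max_iff_disj)
qed auto

text \<open>A machine with \<open>k\<close> tapes supplies only \<open>k\<close> symbols; a command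
  within this tape bound does not notice the others.\<close>

lemma cnext_cong:
  assumes "tape_bound d \<le> k" "\<And>j. j < k \<Longrightarrow> r j = r' j"
  shows "fst (cnext (d # L) r) = fst (cnext (d # L) r') \<and>
    (\<forall>j<k. snd (cnext (d # L) r) j = snd (cnext (d # L) r') j)"
proof (cases d)
  case (Sim M b fl q)
  have "map (\<lambda>i. unmark M (r (b + i))) [0..<num_tapes M] =
      map (\<lambda>i. unmark M (r' (b + i))) [0..<num_tapes M]"
    (is "?l = ?l'") using assms Sim by auto
  moreover have "fl < k" using assms Sim by simp
  ultimately show ?thesis using Sim assms(2) by (cases "halting M q") (simp_all only: cnext.simps split_def Let_def if_True if_False, auto)
qed (use assms in \<open>auto split: option.split\<close>)

lemma cnext_symbol:
  assumes "ok d" "symbol_bound d \<le> G" "3 \<le> G" "r j < G"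
  shows "fst (snd (cnext (d # L) r) j) < G"
proof (cases d)
  case (Sim M b fl q)
  have M: "wf_tm M" "q < num_states M" "3 \<le> G" "num_symbols M < G" using assms Sim by auto
  obtain q' as where t: "transition M q (map (\<lambda>i. unmark M (r (b + i))) [0..<num_tapes M]) = (q', as)"
    by fastforce
  have "mark M (fst (as ! (j - b))) < G" if "b \<le> j" "j < b + num_tapes M" "\<not> halting M q"
    using wf_tm_unmark(2)[OF M(1,2) that(3) t] wf_tm_unmark(3)[OF M(1,2) that(3) t, of "j - b"] that(1,2) M(4)
    by (simp add: mark_def less_diff_conv2)
  then show ?thesis using Sim M(3) t assms(4) by (cases "halting M q") auto
qed (use assms in \<open>auto split: option.splits\<close>)

lemma cstep_frame:
  assumes "\<forall>d\<in>set K. tape_bound d \<le> k" "cstep (K, s) = (K', s')"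
  shows "(\<forall>d\<in>set K'. tape_bound d \<le> k) \<and> (\<forall>j\<ge>k. s' j = s j)"
proof (cases K)
  case (Cons d L)
  then show ?thesis using assms
    by (cases d) (auto simp: cstep_def split_def Let_def split: if_splits)
qed (use assms in auto)

text \<open>This keeps a tape beyond the reach of a program blank with its head at 0, so that it can
  serve as the output tape.\<close>

lemma exec_frame:
  assumes "exec c s t s'" "tape_bound c \<le> j"
  shows "s' j = s j"
proof -
  have "(cstep ^^ t) (K, s) = (K', s') \<Longrightarrow> \<forall>d\<in>set K. tape_bound d \<le> j \<Longrightarrow>
      (\<forall>d\<in>set K'. tape_bound d \<le> j) \<and> s' j = s j" for t K K' s'
  proof (induction t arbitrary: K' s')
    case (Suc t)
    obtain K1 s1 where "(cstep ^^ t) (K, s) = (K1, s1)" by fastforce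
    with Suc cstep_frame[of K1 j s1 K' s'] show ?case by auto
  qed auto
  from this[of t "[c]" "[]" s'] assms show ?thesis by (simp add: exec_def)
qed

section \<open>The machine that executes a program\<close>

lemma step_halting: "halting M (fst C) \<Longrightarrow> step M C = C"
  by (cases C) (simp add: step_def)

lemma funpow_step_halting: "halting M (fst C) \<Longrightarrow> (step M ^^ t) C = C"
  by (induction t) (auto simp: step_halting)

lemma run_halted:
  assumes "halting M (fst (run M ws t))" "t \<le> t'"
  shows "run M ws t' = run M ws t"
proof -
  obtain d where "t' = t + d" using assms(2) le_Suc_ex by blast
  then show ?thesis using assms(1) by (simp add: run_def funpow_apply_add funpow_step_halting)
qed

definition input_tapes :: "bits list \<Rightarrow> tapes" where
  "input_tapes ws = (\<lambda>i. (contents_of (if i < length ws then ws ! i else []), 0))"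

text \<open>The symbol 2 on tape \<open>fl\<close> stands for acceptance. The inequality
  \<open>t < t'\<close> is strict because one more step turns this symbol into a halting
  state.\<close>

theorem compile:
  assumes "ok c" "tape_bound c \<le> k" "fl < k"
  obtains M where "wf_tm M" "num_tapes M = k"
    "\<And>ws t t' s'. exec c (input_tapes ws) t s' \<Longrightarrow> t < t' \<Longrightarrow>
       run M ws t' = (if read_tape (s' fl) = 2 then accept_state M else reject_state M, map s' [0..<k])"
proof -
  define Q where "Q = insert [] (conts c [])"
  have "finite Q" by (simp add: Q_def finite_conts)
  then obtain h where h: "bij_betw h Q {0..<card Q}" using ex_bij_betw_finite_nat by blast
  define n where "n = card Q"
  define g where "g = inv_into Q h"
  have gh: "g (h L) = L" if "L \<in> Q" for L
    using h that by (simp add: g_def bij_betw_def)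
  have hQ: "h L < n" if "L \<in> Q" for L
    using h that by (auto simp: n_def bij_betw_def)
  have gQ: "g q \<in> Q" if "q < n" for q
    using h that unfolding g_def n_def bij_betw_def
    by (metis atLeastLessThan_iff inv_into_into le0)
  have hd_Q: "\<exists>d L'. L = d # L' \<and> ok d \<and> tape_bound d \<le> k \<and> symbol_bound d \<le> symbol_bound c"
    if "L \<in> Q" "L \<noteq> []" for L
    using conts_head[OF assms(1), of L "[]"] that assms(2) by (fastforce simp: Q_def)
  have next_Q: "fst (cnext L r) \<in> Q" if "L \<in> Q" for L r
    using conts_closed[OF assms(1), of L "[]"] that by (auto simp: Q_def)
  have cQ: "[c] \<in> Q" using conts_self[OF assms(1)] by (simp add: Q_def)
  \<comment> \<open>The states below \<open>n\<close> number the stacks; \<open>n\<close> and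
    \<open>Suc n\<close> are the halting states. The state of the empty stack does not halt: it
    tests tape \<open>fl\<close> and moves to one of these two.\<close>
  define M where "M = \<lparr>num_tapes = k, num_states = n + 2, num_symbols = max 3 (symbol_bound c),
      start_state = h [c], accept_state = n, reject_state = Suc n,
      transition = (\<lambda>q rs. if g q = [] then (if rs ! fl = 2 then n else Suc n, map (\<lambda>r. (r, Stay)) rs)
         else (h (fst (cnext (g q) (\<lambda>j. rs ! j))), map (snd (cnext (g q) (\<lambda>j. rs ! j))) [0..<k]))\<rparr>"
  have Msimps: "num_tapes M = k" "num_states M = n + 2" "num_symbols M = max 3 (symbol_bound c)"
    "start_state M = h [c]" "accept_state M = n" "reject_state M = Suc n"
    by (simp_all add: M_def)
  have tr: "transition M q rs = (if g q = [] then (if rs ! fl = 2 then n else Suc n, map (\<lambda>r. (r, Stay)) rs)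
         else (h (fst (cnext (g q) (\<lambda>j. rs ! j))), map (snd (cnext (g q) (\<lambda>j. rs ! j))) [0..<k]))" for q rs
    by (simp add: M_def)
  have halt: "halting M q \<longleftrightarrow> q = n \<or> q = Suc n" for q by (simp add: halting_def Msimps)
  have "wf_tm M"
    unfolding wf_tm_def
  proof (intro conjI allI impI)
    show "start_state M < num_states M" using hQ[OF cQ] by (simp add: Msimps)
    fix q rs
    assume q: "q < num_states M" "\<not> halting M q" and rs: "length rs = num_tapes M" "\<forall>r\<in>set rs. r < num_symbols M"
    then have "q < n" by (auto simp: halt Msimps)
    note gQ = gQ[OF this]
    show "fst (transition M q rs) < num_states M"
      using hQ[OF next_Q[OF gQ]] by (auto simp: tr Msimps less_SucI)
    show "length (snd (transition M q rs)) = num_tapes M"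
      using rs by (simp add: tr Msimps)
    show "\<forall>(a, m)\<in>set (snd (transition M q rs)). a < num_symbols M"
    proof (cases "g q = []")
      case False
      then obtain d L' where d: "g q = d # L'" "ok d" "symbol_bound d \<le> symbol_bound c"
        using hd_Q[OF gQ] by blast
      have "fst (snd (cnext (g q) (\<lambda>j. rs ! j)) j) < num_symbols M" if "j < k" for j
        unfolding d(1) by (rule cnext_symbol) (use d rs that in \<open>auto simp: Msimps le_max_iff_disj\<close>)
      then show ?thesis using False by (auto simp: tr) (metis fst_conv)
    qed (use rs in \<open>auto simp: tr\<close>)
  qed (use assms(3) in \<open>auto simp: Msimps\<close>)
  moreover have sim: "step M (h L, map s [0..<k]) = (h L', map s' [0..<k])"
    if L: "L \<in> Q" "L \<noteq> []" "cstep (L, s) = (L', s')" for L s L' s'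
  proof -
    obtain d L1 where d: "L = d # L1" "tape_bound d \<le> k" using hd_Q L(1,2) by blast
    have nh: "\<not> halting M (h L)" using hQ[OF L(1)] by (simp add: halt)
    let ?r = "\<lambda>j. map read_tape (map s [0..<k]) ! j" and ?r' = "\<lambda>j. read_tape (s j)"
    have r: "?r j = ?r' j" if "j < k" for j using that by simp
    have f: "fst (cnext L ?r) = fst (cnext L ?r')"
      unfolding d(1) using cnext_cong[OF d(2), of ?r ?r' L1] r by blast
    have g: "snd (cnext L ?r) j = snd (cnext L ?r') j" if "j < k" for j
      unfolding d(1) using cnext_cong[OF d(2), of ?r ?r' L1] r that by blast
    have L': "L' = fst (cnext L ?r')" "s' = (\<lambda>j. act (snd (cnext L ?r') j) (s j))"
      using L(3) by (auto simp: cstep_def split_def Let_def)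
    have "step M (h L, map s [0..<k]) =
      (h (fst (cnext L ?r)), map2 act (map (snd (cnext L ?r)) [0..<k]) (map s [0..<k]))"
      using nh L gh by (simp add: step_def tr)
    also have "map2 act (map (snd (cnext L ?r)) [0..<k]) (map s [0..<k]) = map s' [0..<k]"
      using g by (intro nth_equalityI) (auto simp: L')
    finally show ?thesis by (simp only: f L'(1))
  qed
  \<comment> \<open>Only some \<open>t' \<le> t\<close> can be claimed: \<open>cstep\<close> idles
    on the empty stack, whereas the machine leaves the state \<open>h []\<close>.\<close>
  have sims: "\<exists>t'\<le>t. (step M ^^ t') (h L, map s [0..<k]) = (h [], map s' [0..<k])"
    if "L \<in> Q" "(cstep ^^ t) (L, s) = ([], s')" for L s t s'
    using that
  proof (induction t arbitrary: L s)
    case (Suc t)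
    obtain L1 s1 where 1: "cstep (L, s) = (L1, s1)" by fastforce
    show ?case
    proof (cases "L = []")
      case True
      then have "(cstep ^^ t) (L, s) = ([], s')" using Suc.prems(2) by (simp add: funpow_swap1)
      then show ?thesis using Suc.IH Suc.prems(1) le_SucI by blast
    next
      case False
      have "L1 \<in> Q" using next_Q[OF Suc.prems(1)] 1 by (auto simp: cstep_def split_def Let_def)
      moreover have "(cstep ^^ t) (L1, s1) = ([], s')"
        using Suc.prems(2) 1 by (simp add: funpow_swap1)
      ultimately obtain t' where "t' \<le> t" "(step M ^^ t') (h L1, map s1 [0..<k]) = (h [], map s' [0..<k])"
        using Suc.IH by blast
      then show ?thesis
        using sim[OF Suc.prems(1) False 1] by (intro exI[of _ "Suc t'"]) (simp add: funpow_swap1)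
    qed
  qed (auto intro: exI[of _ 0])
  have "run M ws t' = (if read_tape (s' fl) = 2 then accept_state M else reject_state M, map s' [0..<k])"
    if "exec c (input_tapes ws) t s'" "t < t'" for ws t t' s'
  proof -
    have "initial M ws = (h [c], map (input_tapes ws) [0..<k])"
      by (simp add: initial_def Msimps input_tapes_def)
    moreover have "(cstep ^^ t) ([c], input_tapes ws) = ([], s')"
      using that(1) by (simp add: exec_def)
    ultimately obtain t0 where t0: "t0 \<le> t" "run M ws t0 = (h [], map s' [0..<k])"
      using sims[OF cQ] by (metis run_def)
    have "[] \<in> Q" by (simp add: Q_def)
    then have nh: "\<not> halting M (h [])" and g: "g (h []) = []" using hQ[of "[]"] gh[of "[]"] by (auto simp: halt)
    have "run M ws (Suc t0) = step M (run M ws t0)" by (simp add: run_def)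
    also have "\<dots> = (if read_tape (s' fl) = 2 then n else Suc n,
        map2 act (map (\<lambda>r. (r, Stay)) (map read_tape (map s' [0..<k]))) (map s' [0..<k]))"
      using nh g assms(3) by (simp add: t0 step_def tr del: map_map)
    also have "map2 act (map (\<lambda>r. (r, Stay)) (map read_tape (map s' [0..<k]))) (map s' [0..<k]) = map s' [0..<k]"
      by (rule nth_equalityI) auto
    finally have *: "run M ws (Suc t0) = (if read_tape (s' fl) = 2 then n else Suc n, map s' [0..<k])" .
    then have "run M ws t' = run M ws (Suc t0)"
      using t0(1) that(2) by (intro run_halted) (auto simp: halt)
    with * show ?thesis by (simp add: Msimps)
  qed
  ultimately show thesis using that[of M] by (simp add: Msimps)
qed

section \<open>Registers\<close>

text \<open>The word starts under the head, at an arbitrary absolute position \<open>h\<close>. So a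
  tape is a stack that grows to the left, and as \<open>regs\<close> forgets \<open>h\<close>, no
  head ever has to be rewound.\<close>

definition tape_of :: "bits \<Rightarrow> int \<Rightarrow> tape" where
  "tape_of w h = (\<lambda>j. contents_of w (j - h), h)"

definition regs :: "(nat \<Rightarrow> bits) \<Rightarrow> tapes \<Rightarrow> bool" where
  "regs v s \<longleftrightarrow> (\<forall>i. \<exists>h. s i = tape_of (v i) h)"

definition does :: "com \<Rightarrow> (nat \<Rightarrow> bits) \<Rightarrow> nat \<Rightarrow> (nat \<Rightarrow> bits) \<Rightarrow> bool" where
  "does c v T v' \<longleftrightarrow> (\<forall>s. regs v s \<longrightarrow> (\<exists>t s'. exec c s t s' \<and> t \<le> T \<and> regs v' s'))"

lemma contents_of_Nil [simp]: "contents_of [] = (\<lambda>_. 0)"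
  by (auto simp: contents_of_def)

lemma contents_of_neg: "j < 0 \<Longrightarrow> contents_of w j = 0"
  by (auto simp: contents_of_def)

lemma contents_of_Cons:
  "contents_of (b # w) j = (if j = 0 then (if b then 2 else 1) else contents_of w (j - 1))"
proof (cases "j \<ge> 1")
  case True
  then have "nat j = Suc (nat (j - 1))" by simp
  with True show ?thesis by (simp add: contents_of_def)
qed (auto simp: contents_of_def)

fun top_symbol :: "bits \<Rightarrow> nat" where
  "top_symbol [] = 0"
| "top_symbol (b # w) = (if b then 2 else 1)"

lemma read_tape_of [simp]: "read_tape (tape_of w h) = top_symbol w"
  by (cases w) (auto simp: tape_of_def contents_of_def)

lemma top_symbol_eq_0 [simp]: "top_symbol w = 0 \<longleftrightarrow> w = []"
  by (cases w) auto

lemma top_symbol_eq_2: "top_symbol w = 2 \<longleftrightarrow> (\<exists>w'. w = True # w')"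
  by (cases w) auto

lemma regs_top_symbol: "regs v s \<Longrightarrow> read_tape (s i) = top_symbol (v i)"
  unfolding regs_def by (metis read_tape_of)

lemma regs_upd: "regs v s \<Longrightarrow> regs (v(i := w)) (s(i := tape_of w h))"
  unfolding regs_def by auto

lemma does_mono: "does c v T v' \<Longrightarrow> T \<le> T' \<Longrightarrow> does c v T' v'"
  unfolding does_def by (meson le_trans)

lemma does_cong: "does c v T v' \<Longrightarrow> v' = v'' \<Longrightarrow> T \<le> T' \<Longrightarrow> does c v T' v''"
  using does_mono by blast

lemma does_Seq: "does c v T v' \<Longrightarrow> does d v' T' v'' \<Longrightarrow> does (Seq c d) v (1 + T + T') v''"
  unfolding does_def by (meson exec_Seq add_mono le_refl)

lemma does_Cond: "does (if P (top_symbol (v i)) then c else d) v T v' \<Longrightarrow> does (Cond i P c d) v (1 + T) v'"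
  unfolding does_def by (metis exec_Cond regs_top_symbol add_le_mono le_refl)

lemma does_While_False: "\<not> P (top_symbol (v i)) \<Longrightarrow> does (While i P c) v 1 v"
  unfolding does_def by (metis exec_While_False regs_top_symbol le_refl)

lemma does_While_True:
  "P (top_symbol (v i)) \<Longrightarrow> does c v T v' \<Longrightarrow> does (While i P c) v' T' v'' \<Longrightarrow>
   does (While i P c) v (1 + T + T') v''"
  unfolding does_def by (metis exec_While_True regs_top_symbol add_le_mono le_refl)

section \<open>Stack operations on registers\<close>

definition skip :: com where "skip = Act 0 None Stay"
text \<open>An \<open>Act\<close> writes before it moves, so the head first steps left while
  restoring the symbol that it leaves.\<close>

definition push :: "nat \<Rightarrow> bool \<Rightarrow> com" where
  "push i b = Seq (Act i None Move_Left) (Act i (Some (if b then 2 else 1)) Stay)"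
definition pop :: "nat \<Rightarrow> com" where "pop i = Act i (Some 0) Move_Right"
definition clear :: "nat \<Rightarrow> com" where "clear i = While i (\<lambda>x. x \<noteq> 0) (pop i)"
definition set_flag :: "nat \<Rightarrow> com" where "set_flag i = Seq (clear i) (push i True)"

lemma ok_macros [simp]: "ok skip" "ok (push i b)" "ok (pop i)" "ok (clear i)" "ok (set_flag i)"
  by (simp_all add: skip_def push_def pop_def clear_def set_flag_def)

lemma exec_skip: "exec skip s 1 s"
  using exec_Act[of 0 None Stay s] by (simp add: skip_def)

lemma exec_push:
  assumes "s i = tape_of w h"
  shows "exec (push i b) s 3 (s(i := tape_of (b # w) (h - 1)))"
proof -
  have "exec (push i b) s (1 + 1 + 1) (s(i := tape_of (b # w) (h - 1)))"
    unfolding push_def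
  proof (rule exec_Seq[OF exec_Act])
    let ?s = "s(i := (fst (s i), h - 1))"
    have 1: "s(i := act (case None of None \<Rightarrow> read_tape (s i) | Some x \<Rightarrow> x, Move_Left) (s i)) = ?s"
      by (simp add: assms tape_of_def fun_eq_iff)
    have "(\<lambda>j. contents_of w (j - h))(h - 1 := if b then 2 else 1) = (\<lambda>j. contents_of (b # w) (j - (h - 1)))"
      by (auto simp: contents_of_Cons fun_eq_iff algebra_simps)
    then have "?s(i := act (case Some (if b then 2 else 1) of None \<Rightarrow> read_tape (?s i) | Some x \<Rightarrow> x, Stay) (?s i))
        = s(i := tape_of (b # w) (h - 1))"
      using assms by (auto simp: tape_of_def)
    with exec_Act[of i "Some (if b then 2 else 1)" Stay ?s]
    show "exec (Act i (Some (if b then 2 else 1)) Stay)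
     (s(i := act (case None of None \<Rightarrow> read_tape (s i) | Some x \<Rightarrow> x, Move_Left) (s i))) 1
     (s(i := tape_of (b # w) (h - 1)))"
      unfolding 1 by simp
  qed
  then show ?thesis by (simp add: numeral_3_eq_3)
qed

lemma exec_pop:
  assumes "s i = tape_of w h"
  shows "exec (pop i) s 1 (s(i := tape_of (tl w) (h + 1)))"
proof -
  have "(\<lambda>j. contents_of w (j - h))(h := 0) = (\<lambda>j. contents_of (tl w) (j - (h + 1)))"
    by (cases w) (auto simp: contents_of_Cons fun_eq_iff algebra_simps contents_of_neg)
  then show ?thesis
    using exec_Act[of i "Some 0" Move_Right s] assms by (simp add: pop_def tape_of_def)
qed

lemma does_skip: "does skip v 1 v"
  unfolding does_def using exec_skip by blast

lemma does_push: "does (push i b) v 3 (v(i := b # v i))"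
  unfolding does_def
proof (intro allI impI)
  fix s assume s: "regs v s"
  then obtain h where "s i = tape_of (v i) h" by (auto simp: regs_def)
  from exec_push[of s i, OF this, of b] regs_upd[OF s]
  show "\<exists>t s'. exec (push i b) s t s' \<and> t \<le> 3 \<and> regs (v(i := b # v i)) s'" by blast
qed

lemma does_pop: "does (pop i) v 1 (v(i := tl (v i)))"
  unfolding does_def
proof (intro allI impI)
  fix s assume s: "regs v s"
  then obtain h where "s i = tape_of (v i) h" by (auto simp: regs_def)
  from exec_pop[of s i, OF this] regs_upd[OF s]
  show "\<exists>t s'. exec (pop i) s t s' \<and> t \<le> 1 \<and> regs (v(i := tl (v i))) s'" by blast
qed

lemma exec_clear:
  assumes "s i = tape_of w h"
  shows "\<exists>h'. exec (clear i) s (2 * length w + 1) (s(i := tape_of [] h'))"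
  using assms
proof (induction w arbitrary: s h)
  case Nil
  then have "s(i := tape_of [] h) = s" by auto
  moreover have "exec (clear i) s 1 s"
    unfolding clear_def by (rule exec_While_False) (use Nil in simp)
  ultimately show ?case by (intro exI[of _ h]) (simp del: fun_upd_apply)
next
  case (Cons b w)
  let ?s = "s(i := tape_of w (h + 1))"
  have 1: "exec (pop i) s 1 ?s" using exec_pop[of s i, OF Cons.prems] by simp
  obtain h' where 2: "exec (clear i) ?s (2 * length w + 1) (?s(i := tape_of [] h'))"
    using Cons.IH[of ?s "h + 1"] by (metis fun_upd_same)
  have "read_tape (s i) \<noteq> 0" by (simp add: Cons.prems)
  from exec_While_True[where P = "\<lambda>x. x \<noteq> 0", OF this 1 2[unfolded clear_def]]
  show ?case by (intro exI[of _ h']) (simp add: clear_def del: fun_upd_apply)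
qed

lemma does_clear: "does (clear i) v (2 * length (v i) + 1) (v(i := []))"
  unfolding does_def
proof (intro allI impI)
  fix s assume s: "regs v s"
  then obtain h where "s i = tape_of (v i) h" by (auto simp: regs_def)
  from exec_clear[of s i, OF this] regs_upd[OF s]
  show "\<exists>t s'. exec (clear i) s t s' \<and> t \<le> 2 * length (v i) + 1 \<and> regs (v(i := [])) s'" by blast
qed

lemma does_set_flag: "does (set_flag i) v (2 * length (v i) + 5) (v(i := [True]))"
  unfolding set_flag_def
  by (rule does_cong[OF does_Seq[OF does_clear does_push]]) auto

fun pushes :: "bool \<Rightarrow> nat list \<Rightarrow> com" where
  "pushes b [] = skip"
| "pushes b (j # js) = Seq (push j b) (pushes b js)"

lemma ok_pushes [simp]: "ok (pushes b js)"
  by (induction js) auto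

lemma does_pushes:
  "distinct js \<Longrightarrow>
   does (pushes b js) v (4 * length js + 1) (\<lambda>j. if j \<in> set js then b # v j else v j)"
proof (induction js arbitrary: v)
  case Nil
  then show ?case using does_skip by simp
next
  case (Cons j js)
  have "does (pushes b js) (v(j := b # v j)) (4 * length js + 1)
      (\<lambda>i. if i \<in> set js then b # (v(j := b # v j)) i else (v(j := b # v j)) i)"
    using Cons by simp
  then show ?case unfolding pushes.simps
    by (rule does_cong[OF does_Seq[OF does_push]]) (use Cons.prems in \<open>auto simp: fun_eq_iff\<close>)
qed

definition transfer :: "nat \<Rightarrow> nat list \<Rightarrow> com" where
  "transfer i js =
     While i (\<lambda>x. x \<noteq> 0) (Seq (Cond i (\<lambda>x. x = 2) (pushes True js) (pushes False js)) (pop i))"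

lemma ok_transfer [simp]: "ok (transfer i js)"
  by (simp add: transfer_def)

lemma does_transfer:
  assumes "distinct js" "i \<notin> set js"
  shows "does (transfer i js) v ((4 * length js + 5) * length (v i) + 1)
     (\<lambda>j. if j = i then [] else if j \<in> set js then rev (v i) @ v j else v j)"
  unfolding transfer_def
proof (induction "v i" arbitrary: v)
  case Nil
  have *: "(\<lambda>j. if j = i then [] else if j \<in> set js then rev (v i) @ v j else v j) = v"
    by (rule ext) (simp add: Nil[symmetric])
  show ?case unfolding * by (rule does_mono[OF does_While_False]) (use Nil in auto)
next
  case (Cons b w)
  let ?v = "(\<lambda>j. if j \<in> set js then b # v j else v j)"
  have vi: "v i = b # w" using Cons.hyps(2) by simp
  have "does (if top_symbol (v i) = 2 then pushes True js else pushes False js) v (4 * length js + 1) ?v"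
    using does_pushes[OF assms(1), of b v] vi by auto
  from does_Seq[OF does_Cond[where P = "\<lambda>x. x = 2", OF this] does_pop[of i]]
  have 1: "does (Seq (Cond i (\<lambda>x. x = 2) (pushes True js) (pushes False js)) (pop i)) v
      (4 * length js + 4) (?v(i := w))"
    by (rule does_cong) (use assms(2) vi in \<open>auto simp: fun_eq_iff\<close>)
  have "w = (?v(i := w)) i" by simp
  have eq: "(\<lambda>j. if j = i then [] else if j \<in> set js then rev w @ (?v(i := w)) j else (?v(i := w)) j) =
      (\<lambda>j. if j = i then [] else if j \<in> set js then rev (v i) @ v j else v j)"
    unfolding vi by (rule ext) simp
  have "top_symbol (v i) \<noteq> 0" by (simp add: vi)
  from does_While_True[where P = "\<lambda>x. x \<noteq> 0", OF this 1 Cons.hyps(1)[of "?v(i := w)", OF \<open>w = (?v(i := w)) i\<close>]]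
  show ?case
    by (rule does_cong) (simp_all only: fun_upd_same eq, simp add: vi)
qed

text \<open>A transfer reverses the word, and two reversals restore the order. The second transfer
  refills \<open>i\<close> along with \<open>j\<close>, so the source survives. The cost of 22 per
  symbol is 9 + 13, for one and for two targets.\<close>

definition prepend :: "nat \<Rightarrow> nat \<Rightarrow> nat \<Rightarrow> com" where
  "prepend tmp i j = Seq (transfer i [tmp]) (transfer tmp [i, j])"

lemma ok_prepend [simp]: "ok (prepend tmp i j)"
  by (simp add: prepend_def)

lemma does_prepend:
  assumes "i \<noteq> j" "tmp \<noteq> i" "tmp \<noteq> j" "v tmp = []"
  shows "does (prepend tmp i j) v (22 * length (v i) + 3) (v(j := v i @ v j))"
  unfolding prepend_def
  by (rule does_cong[OF does_Seq[OF does_transfer does_transfer]])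
     (use assms in \<open>auto simp: fun_eq_iff algebra_simps\<close>)

fun copies :: "nat \<Rightarrow> nat list \<Rightarrow> nat \<Rightarrow> com" where
  "copies tmp [] b = skip"
| "copies tmp (i # is) b = Seq (prepend tmp i b) (copies tmp is (Suc b))"

lemma ok_copies [simp]: "ok (copies tmp is b)"
  by (induction "is" arbitrary: b) auto

lemma does_copies:
  assumes "tmp < b" "\<forall>i\<in>set is. i < tmp" "v tmp = []" "\<forall>i\<ge>b. v i = []"
  shows "does (copies tmp is b) v (22 * sum_list (map (\<lambda>i. length (v i)) is) + 4 * length is + 1)
    (\<lambda>j. if b \<le> j \<and> j < b + length is then v (is ! (j - b)) else v j)"
  using assms
proof (induction "is" arbitrary: b v)
  case Nil
  have "(\<lambda>j. if b \<le> j \<and> j < b + length [] then v ([] ! (j - b)) else v j) = v" by (auto simp: fun_eq_iff)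
  then show ?case using does_skip[of v] by simp
next
  case (Cons i "is")
  let ?v = "v(b := v i)"
  have "?v k = v k" if "k \<in> set is" for k using Cons.prems that by auto
  then have m: "map (\<lambda>i. length (?v i)) is = map (\<lambda>i. length (v i)) is" by simp
  have 1: "does (prepend tmp i b) v (22 * length (v i) + 3) ?v"
    using does_prepend[of i b tmp v] Cons.prems by auto
  have 2: "does (copies tmp is (Suc b)) ?v (22 * sum_list (map (\<lambda>i. length (v i)) is) + 4 * length is + 1)
    (\<lambda>j. if Suc b \<le> j \<and> j < Suc b + length is then ?v (is ! (j - Suc b)) else ?v j)"
    unfolding m[symmetric] by (rule Cons.IH) (use Cons.prems in auto)
  show ?case unfolding copies.simps
  proof (rule does_cong[OF does_Seq[OF 1 2]])
    have "is ! (j - Suc b) \<noteq> b" if "Suc b \<le> j" "j < Suc b + length is" for j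
      using Cons.prems nth_mem[of "j - Suc b" "is"] that by fastforce
    then show "(\<lambda>j. if Suc b \<le> j \<and> j < Suc b + length is then ?v (is ! (j - Suc b)) else ?v j) =
      (\<lambda>j. if b \<le> j \<and> j < b + length (i # is) then v ((i # is) ! (j - b)) else v j)"
      by (auto simp: fun_eq_iff nth_Cons' Suc_le_eq)
  qed auto
qed

section \<open>Calling a Turing machine\<close>

text \<open>The head may stand one cell outside the interval on either side, as it does after a move
  off the visited region. Writing a nonblank symbol there still leaves an interval.\<close>

definition dirty :: "(int \<Rightarrow> nat) \<Rightarrow> int \<Rightarrow> int \<Rightarrow> int \<Rightarrow> bool" where
  "dirty c h a b \<longleftrightarrow> (\<forall>j. c j \<noteq> 0 \<longleftrightarrow> a \<le> j \<and> j < b) \<and> a \<le> b \<and> a - 1 \<le> h \<and> h \<le> b"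

text \<open>
  The second tape simulates the first one up to a shift. As the simulation never writes a blank,
  the visited part of the tape is an interval without blanks, so that it can be found and erased.
\<close>

definition simulates :: "tm \<Rightarrow> int \<Rightarrow> tape \<Rightarrow> tape \<Rightarrow> bool" where
  "simulates M n T T' \<longleftrightarrow> (\<exists>d a b. snd T' = snd T + d \<and>
     (\<forall>j. unmark M (fst T' (j + d)) = fst T j) \<and> dirty (fst T') (snd T') a b \<and> b - a \<le> n)"

lemma simulates_mono: "simulates M n T T' \<Longrightarrow> n \<le> n' \<Longrightarrow> simulates M n' T T'"
  unfolding simulates_def by force

lemma simulates_read: "simulates M n T T' \<Longrightarrow> unmark M (read_tape T') = read_tape T"
  by (cases T; cases T') (auto simp: simulates_def)

text \<open>The cell under the head becomes nonblank whatever \<open>M\<close> writes, as a blank is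
  replaced by its mark. It joins the interval, which grows by at most one cell, and the head then
  moves by at most one.\<close>

lemma simulates_act:
  assumes "simulates M n T T'" "x < num_symbols M"
  shows "simulates M (n + 1) (act (x, m) T) (act (mark M x, m) T')"
proof -
  obtain c h where T: "T = (c, h)" by fastforce
  obtain c' h' where T': "T' = (c', h')" by fastforce
  obtain d a b where d: "h' = h + d" "\<And>j. unmark M (c' (j + d)) = c j" "dirty c' h' a b" "b - a \<le> n"
    using assms(1) unfolding simulates_def T T' by auto
  have m: "mark M x \<noteq> 0" "unmark M (mark M x) = x" using assms(2) by (auto simp: mark_def unmark_def)
  have o: "- 1 \<le> offset m" "offset m \<le> 1" by (cases m; simp)+
  define a' b' where "a' = (if h' = a - 1 then a - 1 else a)" and
    "b' = (if h' = b then b + 1 else b)"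
  have "dirty (c'(h' := mark M x)) (h' + offset m) a' b' \<and> b' - a' \<le> n + 1"
  proof -
    have nz: "c' j \<noteq> 0 \<longleftrightarrow> a \<le> j \<and> j < b" for j using d(3) by (simp add: dirty_def)
    have ab: "a \<le> b" "a - 1 \<le> h'" "h' \<le> b" using d(3) by (simp_all add: dirty_def)
    have ab': "a' \<le> a" "b \<le> b'" "a' \<le> h'" "h' < b'" "b' - a' \<le> n + 1"
      "a' = a \<or> a' = h' \<and> a = h' + 1" "b' = b \<or> b = h' \<and> b' = h' + 1"
      using ab d(4) by (auto simp: a'_def b'_def split: if_splits)
    have "(c'(h' := mark M x)) j \<noteq> 0 \<longleftrightarrow> a' \<le> j \<and> j < b'" for j
    proof (cases "j = h'")
      case False
      then show ?thesis using nz[of j] ab'(1-4,6,7) by auto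
    qed (use m(1) ab' in simp)
    then show ?thesis unfolding dirty_def using ab' o by (intro conjI allI) (blast, linarith+)
  qed
  moreover have "unmark M ((c'(h' := mark M x)) (j + d)) = (c(h := x)) j" for j
    using d(1,2) m(2) by auto
  ultimately show ?thesis
    unfolding simulates_def T T'
    by (intro exI[of _ d] exI[of _ a'] exI[of _ b']) (auto simp: d(1))
qed

lemma contents_of_eq_0: "contents_of w j = 0 \<longleftrightarrow> \<not> (0 \<le> j \<and> j < int (length w))"
  by (simp add: contents_of_def)

lemma simulates_initial:
  assumes "3 \<le> num_symbols M"
  shows "simulates M (int (length w)) (contents_of w, 0) (tape_of w h)"
proof -
  have "unmark M (contents_of w j) = contents_of w j" for j
    using assms by (auto simp: unmark_def contents_of_def)
  then show ?thesis unfolding simulates_def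
    by (intro exI[of _ h] exI[of _ h] exI[of _ "h + int (length w)"])
       (simp add: tape_of_def dirty_def contents_of_eq_0, linarith)
qed

lemma run_Suc: "run M ws (Suc t) = step M (run M ws t)"
  by (simp add: run_def)

definition nth_input :: "bits list \<Rightarrow> nat \<Rightarrow> bits" where
  "nth_input ws i = (if i < length ws then ws ! i else [])"

text \<open>Restricted to times before halting, because in a halting state \<open>Sim\<close> writes
  its verdict and leaves the stack.\<close>

lemma Sim_steps:
  assumes wf: "wf_tm M" and s: "\<And>i. i < num_tapes M \<Longrightarrow> \<exists>h. s (b + i) = tape_of (nth_input ws i) h"
    and nh: "\<And>t'. t' < t \<Longrightarrow> \<not> halting M (fst (run M ws t'))"
  shows "\<exists>s'. (\<forall>K. (cstep ^^ t) (Sim M b fl (start_state M) # K, s) = (Sim M b fl (fst (run M ws t)) # K, s')) \<and>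
    fst (run M ws t) < num_states M \<and> length (snd (run M ws t)) = num_tapes M \<and>
    (\<forall>i<num_tapes M. simulates M (int (length (nth_input ws i) + t)) (snd (run M ws t) ! i) (s' (b + i))) \<and>
    (\<forall>j. j < b \<or> b + num_tapes M \<le> j \<longrightarrow> s' j = s j)"
  using nh
proof (induction t)
  case 0
  have "simulates M (int (length (nth_input ws i))) (contents_of (nth_input ws i), 0) (s (b + i))"
    if "i < num_tapes M" for i
    using s[OF that] simulates_initial[of M "nth_input ws i"] wf by (auto simp: wf_tm_def)
  moreover have "run M ws 0 = (start_state M, map (\<lambda>i. (contents_of (nth_input ws i), 0)) [0..<num_tapes M])"
    by (simp add: run_def initial_def nth_input_def)
  moreover have "start_state M < num_states M" using wf by (simp add: wf_tm_def)
  ultimately show ?case by simp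
next
  case (Suc t)
  obtain q ts where r: "run M ws t = (q, ts)" by fastforce
  let ?k = "num_tapes M"
  from Suc obtain s1 where s1: "\<And>K. (cstep ^^ t) (Sim M b fl (start_state M) # K, s) = (Sim M b fl q # K, s1)"
    "q < num_states M" "length ts = ?k"
    "\<And>i. i < ?k \<Longrightarrow> simulates M (int (length (nth_input ws i) + t)) (ts ! i) (s1 (b + i))"
    "\<And>j. j < b \<or> b + ?k \<le> j \<Longrightarrow> s1 j = s j"
    unfolding r by force
  have nh: "\<not> halting M q" using Suc.prems[of t] r by simp
  have rd: "map read_tape ts = map (\<lambda>i. unmark M (read_tape (s1 (b + i)))) [0..<?k]"
    by (rule nth_equalityI) (use s1(3) simulates_read[OF s1(4)] in auto)
  obtain q' as where t: "transition M q (map (\<lambda>i. unmark M (read_tape (s1 (b + i)))) [0..<?k]) = (q', as)"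
    by fastforce
  note w = wf_tm_unmark[OF wf s1(2) nh t]
  have r': "run M ws (Suc t) = (q', map2 act as ts)"
    unfolding run_Suc r using nh t by (simp add: step_def rd)
  let ?s = "\<lambda>j. if b \<le> j \<and> j < b + ?k then act (mark M (fst (as ! (j - b))), snd (as ! (j - b))) (s1 j) else s1 j"
  have "(cstep ^^ Suc t) (Sim M b fl (start_state M) # K, s) = (Sim M b fl q' # K, ?s)" for K
    using s1(1) cstep_Sim[OF nh t] by simp
  moreover have "simulates M (int (length (nth_input ws i) + Suc t)) (map2 act as ts ! i) (?s (b + i))"
    if "i < ?k" for i
    using simulates_act[OF s1(4)[OF that] w(3), of i "snd (as ! i)"] that w(2) s1(3) by (simp add: ac_simps)
  ultimately show ?case
    unfolding r' using w s1(3,5) by (intro exI[of _ ?s]) auto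
qed

lemma exec_Sim:
  assumes wf: "wf_tm M" and s: "\<And>i. i < num_tapes M \<Longrightarrow> \<exists>h. s (b + i) = tape_of (nth_input ws i) h"
    and h: "halting M (fst (run M ws p))"
    and fl: "fl < b"
  shows "\<exists>t s'. t \<le> p + 1 \<and> exec (Sim M b fl (start_state M)) s t s' \<and>
    s' fl = act (if fst (run M ws p) = accept_state M then 2 else 1, Stay) (s fl) \<and>
    (\<forall>i<num_tapes M. simulates M (int (length (nth_input ws i) + p)) (snd (run M ws p) ! i) (s' (b + i))) \<and>
    (\<forall>j. j < b \<or> b + num_tapes M \<le> j \<longrightarrow> j \<noteq> fl \<longrightarrow> s' j = s j)"
proof -
  \<comment> \<open>The clock \<open>p\<close> may exceed the halting time. \<open>Sim\<close> stops
    at the first halting configuration, which is also the configuration at time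
    \<open>p\<close>.\<close>
  define t where "t = (LEAST t. halting M (fst (run M ws t)))"
  have t: "halting M (fst (run M ws t))" "t \<le> p" "\<And>t'. t' < t \<Longrightarrow> \<not> halting M (fst (run M ws t'))"
    using h unfolding t_def by (auto intro: LeastI Least_le dest: not_less_Least)
  have r: "run M ws p = run M ws t" using run_halted[OF t(1,2)] .
  from Sim_steps[OF wf s t(3), where fl = fl]
  obtain s1 where s1:
    "\<And>K. (cstep ^^ t) (Sim M b fl (start_state M) # K, s) = (Sim M b fl (fst (run M ws t)) # K, s1)"
    "\<forall>i<num_tapes M. simulates M (int (length (nth_input ws i) + t)) (snd (run M ws t) ! i) (s1 (b + i))"
    "\<forall>j. j < b \<or> b + num_tapes M \<le> j \<longrightarrow> s1 j = s j" by blast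
  let ?s = "s1(fl := act (if fst (run M ws t) = accept_state M then 2 else 1, Stay) (s1 fl))"
  have "exec (Sim M b fl (start_state M)) s (Suc t) ?s"
    using s1(1) t(1) by (simp add: exec_def)
  then show ?thesis
    unfolding r using s1 t(2) fl
    by (intro exI[of _ "Suc t"] exI[of _ ?s]) (auto intro: simulates_mono)
qed

section \<open>Reading off and erasing the tapes of a called machine\<close>

definition bit :: "nat \<Rightarrow> bits" where
  "bit x = (if x = 1 then [False] else if x = 2 then [True] else [])"

definition gather :: "(int \<Rightarrow> nat) \<Rightarrow> int \<Rightarrow> nat \<Rightarrow> bits" where
  "gather c a n = concat (map (\<lambda>i. bit (c (a + int i))) [0..<n])"

lemma length_bit: "length (bit x) \<le> 1"
  by (simp add: bit_def)

lemma gather_Suc: "gather c a (Suc n) = gather c a n @ bit (c (a + int n))"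
  by (simp add: gather_def)

lemma length_gather: "length (gather c a n) \<le> n"
proof (induction n)
  case (Suc n)
  then show ?case using length_bit[of "c (a + int n)"] by (simp add: gather_Suc)
qed (simp add: gather_def)

lemma gather_cong: "(\<And>i. i < n \<Longrightarrow> bit (c (a + int i)) = bit (c' (a + int i))) \<Longrightarrow> gather c a n = gather c' a n"
  by (auto simp: gather_def intro!: arg_cong[where f = concat])

lemma gather_add: "gather c a (m + n) = gather c a m @ gather c (a + int m) n"
  by (induction n) (simp_all add: gather_Suc gather_def ac_simps)

lemma gather_Nil: "(\<And>i. i < n \<Longrightarrow> bit (c (a + int i)) = []) \<Longrightarrow> gather c a n = []"
  by (simp add: gather_def)

lemma gather_contents: "gather (contents_of w) 0 (length w) = w"
proof -
  have "map (\<lambda>i. bit (contents_of w (int i))) [0..<length w] = map (\<lambda>x. [x]) w"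
    by (rule nth_equalityI) (auto simp: bit_def contents_of_def)
  then show ?thesis by (simp add: gather_def)
qed

text \<open>The interval may extend beyond the word, since marks and fillers are nonblank. The cells
  of \<open>w\<close> are nonblank and therefore lie inside it, and the cells before and after them
  contribute no bits.\<close>

lemma gather_eq:
  assumes c: "\<And>j. bit (c (j + d)) = bit (contents_of w j)"
    and nz: "\<And>j. c j \<noteq> 0 \<Longrightarrow> a \<le> j \<and> j < a + int n"
  shows "gather c a n = w"
proof (cases "w = []")
  case True
  have "bit (c (a + int i)) = []" for i using c[of "a + int i - d"] True by (simp add: bit_def)
  then show ?thesis using True gather_Nil[of n c a] by simp
next
  case False
  have *: "a \<le> j + d \<and> j + d < a + int n" if "0 \<le> j" "j < int (length w)" for j
  proof -
    have "bit (contents_of w j) \<noteq> []" using that by (simp add: bit_def contents_of_def)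
    then have "c (j + d) \<noteq> 0" unfolding c[of j, symmetric] by (metis bit_def zero_neq_one zero_neq_numeral)
    then show ?thesis by (rule nz)
  qed
  from *[of 0] False have 1: "a \<le> d" by simp
  from *[of "int (length w) - 1"] False have 2: "d + int (length w) \<le> a + int n"
    by (cases w) auto
  define m where "m = nat (d - a)"
  define k where "k = n - m - length w"
  have n: "n = m + (length w + k)" using 1 2 by (auto simp: m_def k_def)
  have d: "a + int m = d" using 1 by (simp add: m_def)
  have "gather c a m = []"
    using c[of "a + int i - d" for i] d by (intro gather_Nil) (simp add: contents_of_def bit_def)
  moreover have "gather c (d + int (length w)) k = []"
    using c[of "int (length w) + int i" for i]
    by (intro gather_Nil) (simp add: contents_of_def bit_def ac_simps)
  moreover have "gather c d (length w) = w"
  proof -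
    have "gather c d (length w) = gather (contents_of w) 0 (length w)"
      using c by (auto simp: gather_def add.commute[of d] intro!: arg_cong[where f = concat])
    then show ?thesis by (simp add: gather_contents)
  qed
  ultimately show ?thesis by (simp add: n gather_add d)
qed

text \<open>Going from right to left pushes the last bit first, so the register receives the word in
  its original order.\<close>

definition sweep :: "nat \<Rightarrow> nat \<Rightarrow> com" where
  "sweep r i = While i (\<lambda>x. x \<noteq> 0)
     (Seq (Cond i (\<lambda>x. x = 2) (push r True) (Cond i (\<lambda>x. x = 1) (push r False) skip))
          (Act i (Some 0) Move_Left))"

definition go_right :: "nat \<Rightarrow> com" where
  "go_right i = While i (\<lambda>x. x \<noteq> 0) (Act i None Move_Right)"

text \<open>The head may have stopped on a blank next to the dirty interval. The filler 3, which is
  nonblank but encodes no bit, joins this cell to the interval, so that going right finds its end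
  and the sweep erases all of it.\<close>

definition clean :: "nat \<Rightarrow> nat \<Rightarrow> com" where
  "clean r i = Seq (Cond i (\<lambda>x. x = 0) (Act i (Some 3) Stay) skip)
     (Seq (go_right i) (Seq (Act i None Move_Left) (sweep r i)))"

lemma ok_clean [simp]: "ok (clean r i)"
  by (simp add: clean_def sweep_def go_right_def)

lemma exec_go_right:
  assumes "s i = (c, h)" "\<And>j. h \<le> j \<Longrightarrow> j < h + int n \<Longrightarrow> c j \<noteq> 0" "c (h + int n) = 0"
  shows "exec (go_right i) s (2 * n + 1) (s(i := (c, h + int n)))"
  using assms
proof (induction n arbitrary: h s)
  case 0
  then have "s(i := (c, h + int 0)) = s" by auto
  then show ?case using 0 exec_While_False[of "\<lambda>x. x \<noteq> 0" s i] by (simp add: go_right_def)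
next
  case (Suc n)
  have 1: "exec (Act i None Move_Right) s 1 (s(i := (c, h + 1)))"
    using exec_Act[of i None Move_Right s] Suc.prems(1) by (simp add: fun_upd_idem)
  have 2: "exec (go_right i) (s(i := (c, h + 1))) (2 * n + 1) ((s(i := (c, h + 1)))(i := (c, h + 1 + int n)))"
    by (rule Suc.IH) (use Suc.prems in \<open>auto simp: ac_simps\<close>)
  have "read_tape (s i) \<noteq> 0" using Suc.prems by simp
  from exec_While_True[where P = "\<lambda>x. x \<noteq> 0", OF this 1 2[unfolded go_right_def]] show ?case
    by (simp add: go_right_def ac_simps del: fun_upd_apply)
qed

lemma exec_push_bit:
  assumes "s r = tape_of w h"
  shows "\<exists>t h'. exec (Cond i (\<lambda>x. x = 2) (push r True) (Cond i (\<lambda>x. x = 1) (push r False) skip)) s t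
      (s(r := tape_of (bit (read_tape (s i)) @ w) h')) \<and> t \<le> 5"
proof -
  consider "read_tape (s i) = 2" | "read_tape (s i) = 1" | "read_tape (s i) \<noteq> 2" "read_tape (s i) \<noteq> 1" by blast
  then show ?thesis
  proof cases
    case 1
    have "exec (Cond i (\<lambda>x. x = 2) (push r True) (Cond i (\<lambda>x. x = 1) (push r False) skip)) s (1 + 3)
        (s(r := tape_of (True # w) (h - 1)))"
      by (rule exec_Cond) (use 1 exec_push[of s r, OF assms] in simp)
    then show ?thesis using 1 by (intro exI[of _ "1 + 3"] exI[of _ "h - 1"]) (simp add: bit_def)
  next
    case 2
    have "exec (Cond i (\<lambda>x. x = 1) (push r False) skip) s (1 + 3) (s(r := tape_of (False # w) (h - 1)))"
      by (rule exec_Cond) (use 2 exec_push[of s r, OF assms] in simp)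
    then have "exec (Cond i (\<lambda>x. x = 2) (push r True) (Cond i (\<lambda>x. x = 1) (push r False) skip)) s
        (1 + (1 + 3)) (s(r := tape_of (False # w) (h - 1)))"
      by (intro exec_Cond) (use 2 in simp)
    then show ?thesis using 2 by (intro exI[of _ "1 + (1 + 3)"] exI[of _ "h - 1"]) (simp add: bit_def)
  next
    case 3
    have "exec (Cond i (\<lambda>x. x = 1) (push r False) skip) s (1 + 1) s"
      by (rule exec_Cond) (use 3 exec_skip in simp)
    then have "exec (Cond i (\<lambda>x. x = 2) (push r True) (Cond i (\<lambda>x. x = 1) (push r False) skip)) s (1 + (1 + 1)) s"
      by (intro exec_Cond) (use 3 in simp)
    moreover have "s(r := tape_of w h) = s" using assms by auto
    ultimately show ?thesis using 3 by (intro exI[of _ "1 + (1 + 1)"] exI[of _ h]) (simp add: bit_def)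
  qed
qed

lemma exec_sweep:
  assumes "s i = (c, a + int n - 1)" "s r = tape_of w h" "i \<noteq> r"
    and "\<And>j. j < n \<Longrightarrow> c (a + int j) \<noteq> 0" "c (a - 1) = 0"
  shows "\<exists>t h'. exec (sweep r i) s t
    (s(i := (\<lambda>j. if a \<le> j \<and> j < a + int n then 0 else c j, a - 1),
       r := tape_of (gather c a n @ w) h')) \<and> t \<le> 8 * n + 1"
  using assms
proof (induction n arbitrary: s c w h)
  case 0
  have "s(i := (\<lambda>j. if a \<le> j \<and> j < a + int 0 then 0 else c j, a - 1), r := tape_of (gather c a 0 @ w) h) = s"
    using 0 by (auto simp: gather_def fun_eq_iff)
  moreover have "exec (sweep r i) s 1 s"
    unfolding sweep_def by (rule exec_While_False) (use 0 in simp)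
  ultimately show ?case by (intro exI[of _ "1::nat"] exI[of _ h]) (simp del: fun_upd_apply)
next
  case (Suc n)
  let ?x = "c (a + int n)"
  let ?c = "c(a + int n := 0)"
  have x: "read_tape (s i) = ?x" using Suc.prems(1) by simp
  from exec_push_bit[of s r, OF Suc.prems(2), of i] obtain t h1 where
    1: "exec (Cond i (\<lambda>x. x = 2) (push r True) (Cond i (\<lambda>x. x = 1) (push r False) skip)) s t
      (s(r := tape_of (bit ?x @ w) h1))" and t: "t \<le> 5" unfolding x by blast
  let ?s = "(s(r := tape_of (bit ?x @ w) h1))(i := (?c, a + int n - 1))"
  have 2: "exec (Act i (Some 0) Move_Left) (s(r := tape_of (bit ?x @ w) h1)) 1 ?s"
    using exec_Act[of i "Some 0" Move_Left "s(r := tape_of (bit ?x @ w) h1)"] Suc.prems(1,3)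
    by simp
  have "\<exists>t h'. exec (sweep r i) ?s t
    (?s(i := (\<lambda>j. if a \<le> j \<and> j < a + int n then 0 else ?c j, a - 1),
       r := tape_of (gather ?c a n @ bit ?x @ w) h')) \<and> t \<le> 8 * n + 1"
    by (rule Suc.IH[where h = h1]) (use Suc.prems in auto)
  then obtain t' h' where 3: "exec (sweep r i) ?s t'
    (?s(i := (\<lambda>j. if a \<le> j \<and> j < a + int n then 0 else ?c j, a - 1),
       r := tape_of (gather ?c a n @ bit ?x @ w) h'))" and t': "t' \<le> 8 * n + 1" by blast
  have g: "gather ?c a n @ bit ?x = gather c a (Suc n)"
    using gather_cong[of n ?c a c] by (simp add: gather_Suc)
  have eq: "?s(i := (\<lambda>j. if a \<le> j \<and> j < a + int n then 0 else ?c j, a - 1),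
       r := tape_of (gather ?c a n @ bit ?x @ w) h') =
     s(i := (\<lambda>j. if a \<le> j \<and> j < a + int (Suc n) then 0 else c j, a - 1),
       r := tape_of (gather c a (Suc n) @ w) h')"
    unfolding g[symmetric] by (rule ext) (auto simp: fun_eq_iff)
  have "read_tape (s i) \<noteq> 0" using Suc.prems(4)[of n] x by simp
  from exec_While_True[where P = "\<lambda>x. x \<noteq> 0", OF this exec_Seq[OF 1 2] 3[unfolded sweep_def]]
  have "exec (sweep r i) s (1 + (1 + t + 1) + t') (s(i := (\<lambda>j. if a \<le> j \<and> j < a + int (Suc n) then 0 else c j, a - 1),
       r := tape_of (gather c a (Suc n) @ w) h'))"
    unfolding eq sweep_def by simp
  moreover have "1 + (1 + t + 1) + t' \<le> 8 * Suc n + 1" using t t' by simp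
  ultimately show ?case by blast
qed

lemma tape_of_Nil: "tape_of [] h = (\<lambda>_. 0, h)"
  by (simp add: tape_of_def)

lemma exec_clean:
  assumes si: "s i = (c, h)" and sr: "s r = tape_of [] h0" and ir: "i \<noteq> r"
    and dirty: "dirty c h a b" and n: "b - a \<le> int n"
  shows "\<exists>t g h1 h2. exec (clean r i) s t (s(i := tape_of [] h1, r := tape_of g h2)) \<and>
    t \<le> 12 * n + 30 \<and> length g \<le> n + 1 \<and>
    (\<forall>w d. (\<forall>j. bit (c (j + d)) = bit (contents_of w j)) \<longrightarrow> g = w)"
proof -
  have nz: "c j \<noteq> 0 \<longleftrightarrow> a \<le> j \<and> j < b" for j using dirty by (simp add: dirty_def)
  have ab: "a \<le> b" "a - 1 \<le> h" "h \<le> b" using dirty by (simp_all add: dirty_def)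
  define c1 where "c1 = (if c h = 0 then c(h := 3) else c)"
  define a1 where "a1 = min a h"
  define b1 where "b1 = max b (h + 1)"
  have nz1: "c1 j \<noteq> 0 \<longleftrightarrow> a1 \<le> j \<and> j < b1" for j
  proof (cases "j = h")
    case False
    then have "c1 j = c j" by (simp add: c1_def)
    then show ?thesis using nz[of j] ab False by (auto simp: a1_def b1_def)
  qed (auto simp: c1_def a1_def b1_def)
  have ab1: "a1 \<le> h" "h < b1" "b1 - a1 \<le> int n + 1"
    using ab n nz[of h] by (auto simp: a1_def b1_def)
  have bit1: "bit (c1 j) = bit (c j)" for j by (auto simp: c1_def bit_def)
  let ?s1 = "s(i := (c1, h))"
  have "exec (if read_tape (s i) = 0 then Act i (Some 3) Stay else skip) s 1 ?s1"
    using exec_Act[of i "Some 3" Stay s] exec_skip[of s] si by (auto simp: c1_def fun_upd_idem)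
  then have 1: "exec (Cond i (\<lambda>x. x = 0) (Act i (Some 3) Stay) skip) s (1 + 1) ?s1"
    by (intro exec_Cond)
  define m where "m = nat (b1 - h)"
  have m: "h + int m = b1" using ab1 by (simp add: m_def)
  have 2: "exec (go_right i) ?s1 (2 * m + 1) (s(i := (c1, b1)))"
  proof -
    have "c1 j \<noteq> 0" if "h \<le> j" "j < h + int m" for j using nz1[of j] that ab1(1) m by simp
    moreover have "c1 (h + int m) = 0" using nz1[of b1] m by simp
    ultimately show ?thesis using exec_go_right[of ?s1 i c1 h m] m by simp
  qed
  have 3: "exec (Act i None Move_Left) (s(i := (c1, b1))) 1 (s(i := (c1, b1 - 1)))"
    using exec_Act[of i None Move_Left "s(i := (c1, b1))"] by (simp add: fun_upd_idem)
  define l where "l = nat (b1 - a1)"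
  have l: "a1 + int l = b1" "l \<le> n + 1" "m \<le> l" using ab1 by (auto simp: l_def m_def)
  have "\<exists>t h'. exec (sweep r i) (s(i := (c1, b1 - 1))) t
    ((s(i := (c1, b1 - 1)))(i := (\<lambda>j. if a1 \<le> j \<and> j < a1 + int l then 0 else c1 j, a1 - 1),
       r := tape_of (gather c1 a1 l @ []) h')) \<and> t \<le> 8 * l + 1"
  proof (rule exec_sweep[where h = h0])
    show "(s(i := (c1, b1 - 1))) i = (c1, a1 + int l - 1)" using l by simp
    show "(s(i := (c1, b1 - 1))) r = tape_of [] h0" using sr ir by simp
    show "c1 (a1 + int j) \<noteq> 0" if "j < l" for j using nz1[of "a1 + int j"] that l(1) by simp
    show "c1 (a1 - 1) = 0" using nz1[of "a1 - 1"] by simp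
  qed (rule ir)
  moreover have "(\<lambda>j. if a1 \<le> j \<and> j < a1 + int l then 0 else c1 j) = (\<lambda>_. 0)"
    using nz1 l(1) by (simp add: fun_eq_iff) blast
  ultimately obtain t h' where
    4: "exec (sweep r i) (s(i := (c1, b1 - 1))) t (s(i := tape_of [] (a1 - 1), r := tape_of (gather c1 a1 l) h'))"
    and t: "t \<le> 8 * l + 1" by (auto simp: tape_of_Nil)
  have "gather c1 a1 l = w" if "\<forall>j. bit (c (j + d)) = bit (contents_of w j)" for w d
    by (rule gather_eq[of c1 d]) (use that bit1 nz1 l in auto)
  then have 5: "\<forall>w d. (\<forall>j. bit (c (j + d)) = bit (contents_of w j)) \<longrightarrow> gather c1 a1 l = w" by blast
  have 6: "length (gather c1 a1 l) \<le> n + 1" using length_gather[of c1 a1 l] l(2) by simp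
  have 7: "1 + (1 + 1) + (1 + (2 * m + 1) + (1 + 1 + t)) \<le> 12 * n + 30" using t l by simp
  have "exec (clean r i) s (1 + (1 + 1) + (1 + (2 * m + 1) + (1 + 1 + t)))
      (s(i := tape_of [] (a1 - 1), r := tape_of (gather c1 a1 l) h'))"
    unfolding clean_def by (rule exec_Seq[OF 1 exec_Seq[OF 2 exec_Seq[OF 3 4]]])
  with 5 6 7 show ?thesis by blast
qed

text \<open>Symbols replaced by a blank are at least \<open>num_symbols M\<close>, hence at least 3,
  and encode no bit, just like the blank.\<close>

lemma bit_unmark: "3 \<le> num_symbols M \<Longrightarrow> bit (unmark M x) = bit x"
  by (auto simp: unmark_def bit_def)

text \<open>The register is emptied before each tape is cleaned, so in the end it holds the bits of
  the last tape only, which is the output tape.\<close>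

fun clean_all :: "nat \<Rightarrow> nat \<Rightarrow> nat \<Rightarrow> com" where
  "clean_all r b 0 = skip"
| "clean_all r b (Suc n) = Seq (clean_all r b n) (Seq (clear r) (clean r (b + n)))"

lemma ok_clean_all [simp]: "ok (clean_all r b n)"
  by (induction n) auto

lemma exec_clean_all:
  assumes M: "3 \<le> num_symbols M" and r: "r < b"
    and sim: "\<And>i. i < n \<Longrightarrow> simulates M (int m) (ts ! i) (s (b + i))" and sr: "s r = tape_of w h"
  shows "\<exists>t s' g h. exec (clean_all r b n) s t s' \<and> t \<le> 1 + n * (14 * m + 2 * length w + 40) \<and>
    (\<forall>i<n. \<exists>h. s' (b + i) = tape_of [] h) \<and> s' r = tape_of g h \<and> length g \<le> length w + m + 1 \<and>
    (\<forall>j. j \<noteq> r \<longrightarrow> j < b \<or> b + n \<le> j \<longrightarrow> s' j = s j) \<and>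
    (\<forall>u. 0 < n \<longrightarrow> fst (ts ! (n - 1)) = contents_of u \<longrightarrow> g = u)"
  using sim
proof (induction n)
  case 0
  show ?case
    using exec_skip[of s] sr by (intro exI[of _ "1::nat"] exI[of _ s] exI[of _ w] exI[of _ h]) auto
next
  case (Suc n)
  then obtain t1 s1 g1 hr where 1: "exec (clean_all r b n) s t1 s1"
    "t1 \<le> 1 + n * (14 * m + 2 * length w + 40)"
    "\<forall>i<n. \<exists>h. s1 (b + i) = tape_of [] h" "s1 r = tape_of g1 hr" "length g1 \<le> length w + m + 1"
    "\<forall>j. j \<noteq> r \<longrightarrow> j < b \<or> b + n \<le> j \<longrightarrow> s1 j = s j" by (metis less_Suc_eq)
  obtain h2 where 2: "exec (clear r) s1 (2 * length g1 + 1) (s1(r := tape_of [] h2))"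
    using exec_clear[of s1 r, OF 1(4)] by blast
  let ?s = "s1(r := tape_of [] h2)"
  have "?s (b + n) = s (b + n)" using 1(6) r by simp
  then obtain d a e where d: "\<forall>j. unmark M (fst (?s (b + n)) (j + d)) = fst (ts ! n) j"
    "dirty (fst (?s (b + n))) (snd (?s (b + n))) a e" "e - a \<le> int m"
    using Suc.prems[of n] unfolding simulates_def by auto
  obtain t3 g3 h3 h4 where 3: "exec (clean r (b + n)) ?s t3 (?s(b + n := tape_of [] h3, r := tape_of g3 h4))"
    "t3 \<le> 12 * m + 30" "length g3 \<le> m + 1"
    "\<forall>w d. (\<forall>j. bit (fst (?s (b + n)) (j + d)) = bit (contents_of w j)) \<longrightarrow> g3 = w"
    using exec_clean[of ?s "b + n" "fst (?s (b + n))" "snd (?s (b + n))" r h2 a e m] d r by auto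
  let ?t = "1 + t1 + (1 + (2 * length g1 + 1) + t3)"
  let ?s3 = "?s(b + n := tape_of [] h3, r := tape_of g3 h4)"
  have A: "exec (clean_all r b (Suc n)) s ?t ?s3"
    unfolding clean_all.simps by (rule exec_Seq[OF 1(1) exec_Seq[OF 2 3(1)]])
  have B: "?t \<le> 1 + Suc n * (14 * m + 2 * length w + 40)"
    using 1(2,5) 3(2) by simp
  have C: "\<forall>i<Suc n. \<exists>h. ?s3 (b + i) = tape_of [] h"
    using 1(3) r by (auto simp: less_Suc_eq)
  have D: "?s3 r = tape_of g3 h4" by simp
  have E: "\<forall>j. j \<noteq> r \<longrightarrow> j < b \<or> b + Suc n \<le> j \<longrightarrow> ?s3 j = s j" using 1(6) by auto
  have F: "\<forall>u. 0 < Suc n \<longrightarrow> fst (ts ! (Suc n - 1)) = contents_of u \<longrightarrow> g3 = u"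
    using 3(4) d(1) bit_unmark[OF M] by (metis diff_Suc_1)
  have G: "length g3 \<le> length w + m + 1" using 3(3) by simp
  show ?case using A B C D E F G by blast
qed

text \<open>Tape \<open>tmp\<close> is scratch space, and \<open>M\<close> works on the tapes above
  it. The arguments are copied there, so \<open>r\<close> may be one of them. The final conditional
  empties \<open>r\<close> if \<open>M\<close> rejects or serves as a mere decider, since its last
  tape is arbitrary then.\<close>

definition call :: "tm \<Rightarrow> bool \<Rightarrow> nat \<Rightarrow> nat list \<Rightarrow> nat \<Rightarrow> nat \<Rightarrow> com" where
  "call M keep tmp is r fl =
     Seq (copies tmp is (Suc tmp)) (Seq (clear fl) (Seq (Sim M (Suc tmp) fl (start_state M))
       (Seq (clean_all r (Suc tmp) (num_tapes M))
          (Cond fl (\<lambda>x. keep \<and> x = 2) skip (clear r)))))"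

lemma ok_call [simp]: "wf_tm M \<Longrightarrow> ok (call M keep tmp is r fl)"
  by (simp add: call_def wf_tm_def)

lemma regsD: "regs v s \<Longrightarrow> \<exists>h. s i = tape_of (v i) h"
  by (simp add: regs_def)

lemma length_nth_input: "length (nth_input ws i) \<le> total_length ws"
  by (auto simp: nth_input_def total_length_def intro!: member_le_sum_list)

lemma act_tape_of_Nil: "act (if B then 2 else 1, Stay) (tape_of [] h) = tape_of [B] h"
  by (auto simp: tape_of_def contents_of_Cons fun_eq_iff)

text \<open>The head moves right by at most one cell per step, which bounds the positions where
  \<open>M\<close> can have written. This will bound the length of outputs.\<close>

lemma run_bounds:
  assumes "wf_tm M"
  shows "fst (run M ws t) < num_states M \<and> length (snd (run M ws t)) = num_tapes M \<and>
    (\<forall>T\<in>set (snd (run M ws t)). snd T \<le> int t \<and>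
       (\<forall>j. fst T j < num_symbols M \<and> (fst T j \<noteq> 0 \<longrightarrow> j < int (total_length ws + t))))"
proof (induction t)
  case 0
  have "run M ws 0 = (start_state M, map (\<lambda>i. (contents_of (nth_input ws i), 0)) [0..<num_tapes M])"
    by (simp add: run_def initial_def nth_input_def)
  moreover have "contents_of (nth_input ws i) j < num_symbols M" for i j
    using assms by (auto simp: contents_of_def wf_tm_def)
  moreover have "j < int (total_length ws)" if "contents_of (nth_input ws i) j \<noteq> 0" for i j
    using that length_nth_input[of ws i] by (simp add: contents_of_eq_0)
  ultimately show ?case using assms by (auto simp: wf_tm_def)
next
  case (Suc t)
  obtain q ts where r: "run M ws t = (q, ts)" by fastforce
  note IH = Suc.IH[unfolded r fst_conv snd_conv]
  show ?case
  proof (cases "halting M q")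
    case True
    then have "run M ws (Suc t) = (q, ts)" by (simp add: run_Suc r step_def)
    then show ?thesis using IH by fastforce
  next
    case False
    have rd: "map read_tape ts = map (\<lambda>i. unmark M (read_tape (ts ! i))) [0..<num_tapes M]"
    proof (rule nth_equalityI)
      fix i assume "i < length (map read_tape ts)"
      then have "fst (ts ! i) (snd (ts ! i)) < num_symbols M" "i < num_tapes M" using IH by auto
      then show "map read_tape ts ! i = map (\<lambda>i. unmark M (read_tape (ts ! i))) [0..<num_tapes M] ! i"
        using IH by (cases "ts ! i") (simp add: unmark_def)
    qed (use IH in simp)
    obtain q' as where t: "transition M q (map (\<lambda>i. unmark M (read_tape (ts ! i))) [0..<num_tapes M]) = (q', as)"
      by fastforce
    have q: "q < num_states M" using IH by simp
    note w = wf_tm_unmark[OF assms q False t]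
    have r': "run M ws (Suc t) = (q', map2 act as ts)"
      unfolding run_Suc r using False t by (simp add: step_def rd)
    have "snd T \<le> int (Suc t) \<and>
        (\<forall>j. fst T j < num_symbols M \<and> (fst T j \<noteq> 0 \<longrightarrow> j < int (total_length ws + Suc t)))"
      if T: "T \<in> set (map2 act as ts)" for T
    proof -
      obtain i where i: "i < num_tapes M" "T = act (as ! i) (ts ! i)"
        using T w(2) IH by (auto simp: in_set_conv_nth)
      obtain c h where ch: "ts ! i = (c, h)" by fastforce
      obtain x m where xm: "as ! i = (x, m)" by fastforce
      have x: "x < num_symbols M" using w(3)[of i] w(2) i(1) xm by simp
      have c: "h \<le> int t" "c j < num_symbols M" "c j \<noteq> 0 \<Longrightarrow> j < int (total_length ws + t)" for j
        using IH i(1) ch nth_mem[of i ts] by (metis fst_conv snd_conv)+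
      have "offset m \<le> 1" by (cases m) auto
      moreover have "j < int (total_length ws + Suc t)" if "(c(h := x)) j \<noteq> 0" for j
        using c(1) c(3)[of j] that by (cases "j = h") auto
      ultimately show ?thesis using c(1,2) x by (auto simp: i(2) ch xm)
    qed
    then show ?thesis unfolding r' using w IH by simp
  qed
qed

lemma does_call:
  assumes wf: "wf_tm M" and "length is \<le> num_tapes M" and le: "\<forall>i\<in>set is. i < tmp" "r < tmp" "fl < tmp" "r \<noteq> fl"
    and v: "\<forall>i\<ge>tmp. v i = []"
    and ws: "ws = map v is" and h: "halting M (fst (run M ws p))"
    and acc: "acc \<longleftrightarrow> fst (run M ws p) = accept_state M"
    and u: "keep \<Longrightarrow> acc \<Longrightarrow> fst (last (snd (run M ws p))) = contents_of u"
  shows "does (call M keep tmp is r fl) v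
      (30 * (num_tapes M + 2) * (total_length ws + p + length (v r) + length (v fl) + 2))
      (v(r := if keep \<and> acc then u else [], fl := [acc]))"
  unfolding does_def
proof (intro allI impI)
  fix s assume s: "regs v s"
  let ?b = "Suc tmp" and ?k = "num_tapes M" and ?L = "total_length ws"
  have k: "0 < ?k" "3 \<le> num_symbols M" using wf by (auto simp: wf_tm_def)
  let ?v1 = "\<lambda>j. if ?b \<le> j \<and> j < ?b + length is then v (is ! (j - ?b)) else v j"
  have "total_length ws = sum_list (map (\<lambda>i. length (v i)) is)"
    by (simp add: ws total_length_def comp_def)
  then have "does (copies tmp is ?b) v (22 * ?L + 4 * length is + 1) ?v1"
    using does_copies[of tmp ?b "is" v] le v by simp
  then obtain t1 s1 where 1: "exec (copies tmp is ?b) s t1 s1" "t1 \<le> 22 * ?L + 4 * length is + 1" "regs ?v1 s1"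
    using s unfolding does_def by blast
  have "does (clear fl) ?v1 (2 * length (v fl) + 1) (?v1(fl := []))"
    using does_clear[of fl ?v1] le by simp
  then obtain t2 s2 where 2: "exec (clear fl) s1 t2 s2" "t2 \<le> 2 * length (v fl) + 1" "regs (?v1(fl := [])) s2"
    using 1(3) unfolding does_def by blast
  have flb: "fl < ?b" and rb: "r < ?b" using le by auto
  have "\<exists>h. s2 (?b + i) = tape_of (nth_input ws i) h" if "i < ?k" for i
  proof -
    have "(?v1(fl := [])) (?b + i) = nth_input ws i"
      using le v by (simp add: nth_input_def ws)
    then show ?thesis using regsD[OF 2(3), of "?b + i"] by (simp only:)
  qed
  from exec_Sim[OF wf this h flb] obtain t3 s3 where 3: "t3 \<le> p + 1"
    "exec (Sim M ?b fl (start_state M)) s2 t3 s3"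
    "s3 fl = act (if fst (run M ws p) = accept_state M then 2 else 1, Stay) (s2 fl)"
    "\<forall>i<?k. simulates M (int (length (nth_input ws i) + p)) (snd (run M ws p) ! i) (s3 (?b + i))"
    "\<forall>j. j < ?b \<or> ?b + ?k \<le> j \<longrightarrow> j \<noteq> fl \<longrightarrow> s3 j = s2 j" by blast
  note s2_s3 = 3(5)
  obtain hf where "s2 fl = tape_of [] hf" using regsD[OF 2(3), of fl] by auto
  then have fl3: "s3 fl = tape_of [acc] hf" using 3(3) by (simp add: acc act_tape_of_Nil)
  obtain hr where "s2 r = tape_of (v r) hr" using regsD[OF 2(3), of r] le by auto
  then have sr: "s3 r = tape_of (v r) hr" using 3(5) le by simp
  have "simulates M (int (?L + p)) (snd (run M ws p) ! i) (s3 (?b + i))" if "i < ?k" for i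
    using 3(4) that length_nth_input[of ws i] by (auto intro: simulates_mono)
  from exec_clean_all[OF k(2) rb this sr] obtain t4 s4 g h4 where
    4: "exec (clean_all r ?b ?k) s3 t4 s4" "t4 \<le> 1 + ?k * (14 * (?L + p) + 2 * length (v r) + 40)"
    "\<forall>i<?k. \<exists>h. s4 (?b + i) = tape_of [] h" "s4 r = tape_of g h4" "length g \<le> length (v r) + (?L + p) + 1"
    "\<forall>j. j \<noteq> r \<longrightarrow> j < ?b \<or> ?b + ?k \<le> j \<longrightarrow> s4 j = s3 j"
    "\<forall>u. 0 < ?k \<longrightarrow> fst (snd (run M ws p) ! (?k - 1)) = contents_of u \<longrightarrow> g = u"
    by blast
  have fl4: "s4 fl = tape_of [acc] hf" using 4(6) le fl3 by simp
  have regs4: "regs (v(r := g, fl := [acc])) s4"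
    unfolding regs_def
  proof
    fix i
    consider "i = r" | "i = fl" | "i \<noteq> r" "i \<noteq> fl" "?b \<le> i" "i < ?b + ?k" | "i \<noteq> r" "i \<noteq> fl" "i < ?b \<or> ?b + ?k \<le> i"
      by linarith
    then show "\<exists>h. s4 i = tape_of ((v(r := g, fl := [acc])) i) h"
    proof cases
      case 1 then show ?thesis using 4(4) le by auto
    next
      case 2 then show ?thesis using fl4 by auto
    next
      case 3
      then have "\<exists>h. s4 (?b + (i - ?b)) = tape_of [] h" using 4(3)[rule_format, of "i - ?b"] by simp
      then show ?thesis using 3 v by simp
    next
      case 4
      then have "s4 i = s3 i" "s3 i = s2 i"
        using s2_s3 \<open>\<forall>j. j \<noteq> r \<longrightarrow> j < ?b \<or> ?b + ?k \<le> j \<longrightarrow> s4 j = s3 j\<close> by blast+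
      then have "s4 i = s2 i" by simp
      moreover have "(?v1(fl := [])) i = v i" using 4 assms(2) by auto
      ultimately show ?thesis using regsD[OF 2(3), of i] 4 by auto
    qed
  qed
  have l: "length (snd (run M ws p)) = ?k" using run_bounds[OF wf] by blast
  have "\<exists>s5 t5. exec (Cond fl (\<lambda>x. keep \<and> x = 2) skip (clear r)) s4 t5 s5 \<and>
     t5 \<le> 2 * (length (v r) + (?L + p) + 1) + 2 \<and>
     regs (v(r := if keep \<and> acc then u else [], fl := [acc])) s5"
  proof (cases "keep \<and> acc")
    case True
    have "last (snd (run M ws p)) = snd (run M ws p) ! (?k - 1)"
      using l k by (metis last_conv_nth length_greater_0_conv)
    then have "g = u" using 4(7) u True k by simp
    moreover have "exec (Cond fl (\<lambda>x. keep \<and> x = 2) skip (clear r)) s4 (1 + 1) s4"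
      by (rule exec_Cond) (use True fl4 exec_skip in simp)
    ultimately show ?thesis using regs4 True by (intro exI[of _ s4] exI[of _ "1 + 1"]) simp
  next
    case False
    have "\<exists>h'. exec (clear r) s4 (2 * length g + 1) (s4(r := tape_of [] h'))"
      using exec_clear[of s4 r, OF 4(4)] .
    then obtain h' where "exec (clear r) s4 (2 * length g + 1) (s4(r := tape_of [] h'))" by blast
    then have "exec (Cond fl (\<lambda>x. keep \<and> x = 2) skip (clear r)) s4 (1 + (2 * length g + 1)) (s4(r := tape_of [] h'))"
      by (intro exec_Cond) (use False fl4 in auto)
    moreover have "regs (v(r := [], fl := [acc])) (s4(r := tape_of [] h'))"
      using regs_upd[OF regs4, of r "[]" h'] le(4) by (simp add: fun_upd_twist)
    ultimately show ?thesis using 4(5) False by (intro exI conjI) (assumption | force)+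
  qed
  then obtain t5 s5 where 5: "exec (Cond fl (\<lambda>x. keep \<and> x = 2) skip (clear r)) s4 t5 s5"
    "t5 \<le> 2 * (length (v r) + (?L + p) + 1) + 2"
    "regs (v(r := if keep \<and> acc then u else [], fl := [acc])) s5" by blast
  let ?t = "1 + t1 + (1 + t2 + (1 + t3 + (1 + t4 + t5)))"
  have A: "exec (call M keep tmp is r fl) s ?t s5"
    unfolding call_def by (rule exec_Seq[OF 1(1) exec_Seq[OF 2(1) exec_Seq[OF 3(2) exec_Seq[OF 4(1) 5(1)]]]])
  \<comment> \<open>The multiple of \<open>?k\<close> pays for the cleaning and for the overhead per
    copied argument; the 2 in the factor \<open>?k + 2\<close> pays for everything else.\<close>
  have "?k * (14 * (?L + p) + 2 * length (v r) + 40) + ?k * 4 \<le> ?k * (30 * (?L + p + length (v r) + length (v fl) + 2))"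
    unfolding add_mult_distrib2[symmetric] by (rule mult_left_mono) auto
  moreover have "30 * (?k + 2) * (?L + p + length (v r) + length (v fl) + 2) =
      ?k * (30 * (?L + p + length (v r) + length (v fl) + 2)) + 60 * (?L + p + length (v r) + length (v fl) + 2)"
    by (simp add: algebra_simps)
  moreover have "4 * length is \<le> ?k * 4" using assms(2) by simp
  moreover have "1 + t1 + (1 + t2 + (1 + t3 + (1 + t4 + t5))) \<le> R"
    if "A + Z \<le> B" "R = B + 60 * (L + p + lr + lf + 2)" "l \<le> Z" "t1 \<le> 22 * L + l + 1" "t2 \<le> 2 * lf + 1"
      "t3 \<le> p + 1" "t4 \<le> 1 + A" "t5 \<le> 2 * (lr + (L + p) + 1) + 2"
    for A B R Z l L lr lf t1 t2 t3 t4 t5 :: nat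
  proof -
    have "1 + t1 + (1 + t2 + (1 + t3 + (1 + t4 + t5))) \<le> A + Z + 60 * (L + p + lr + lf + 2)"
      using that(3-) by simp
    then show ?thesis using that(1,2) by simp
  qed
  ultimately have "?t \<le> 30 * (?k + 2) * (?L + p + length (v r) + length (v fl) + 2)"
    using 1(2) 2(2) 3(1) 4(2) 5(2) by blast
  then show "\<exists>t s'. exec (call M keep tmp is r fl) s t s' \<and>
     t \<le> 30 * (?k + 2) * (?L + p + length (v r) + length (v fl) + 2) \<and>
     regs (v(r := if keep \<and> acc then u else [], fl := [acc])) s'"
    using A 5(3) by blast
qed

section \<open>Closure properties of polynomial time\<close>

lemma poly_mono_nat: "x \<le> y \<Longrightarrow> poly (p :: nat poly) x \<le> poly p y"
  by (induction p) (auto intro!: add_mono mult_mono)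

text \<open>The last bit of the output is a nonblank cell at position \<open>length w - 1\<close>,
  and nonblank cells lie below input length plus running time. Compositions stay polynomial because
  of this bound.\<close>

lemma ptime_computable_length:
  assumes "ptime_computable n f"
  shows "\<exists>p :: nat poly. \<forall>ws w. length ws = n \<longrightarrow> f ws = Some w \<longrightarrow> length w \<le> poly p (total_length ws)"
proof -
  obtain M p where M: "wf_tm M" "n \<le> num_tapes M"
    "\<And>ws. length ws = n \<Longrightarrow> (let (q, ts) = run M ws (poly p (total_length ws)) in
              case f ws of
                None \<Rightarrow> q = reject_state M
              | Some w \<Rightarrow> q = accept_state M \<and> fst (last ts) = contents_of w)"
    using assms unfolding ptime_computable_def by blast
  have "length w \<le> poly ([:0, 1:] + p) (total_length ws)" if ws: "length ws = n" "f ws = Some w" for ws w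
  proof (cases "w = []")
    case False
    let ?t = "poly p (total_length ws)"
    obtain q ts where r: "run M ws ?t = (q, ts)" by fastforce
    have c: "fst (last ts) = contents_of w" using M(3)[OF ws(1)] ws(2) r by simp
    have b: "length ts = num_tapes M" "\<forall>T\<in>set ts. \<forall>j. fst T j \<noteq> 0 \<longrightarrow> j < int (total_length ws + ?t)"
      using run_bounds[OF M(1), of ws ?t] r by auto
    have "ts \<noteq> []" using b(1) M(1) by (auto simp: wf_tm_def)
    then have "last ts \<in> set ts" by simp
    moreover have "contents_of w (int (length w) - 1) \<noteq> 0"
      using False by (cases w) (simp_all add: contents_of_eq_0)
    ultimately have "int (length w) - 1 < int (total_length ws + ?t)" using b(2) c by metis
    then show ?thesis by simp
  qed simp
  then show ?thesis by blast
qed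

text \<open>An output has to start at the absolute position 0, but the position of a register is
  unknown. So the word is written from left to right on a tape whose head is still at 0.\<close>

definition emit :: "nat \<Rightarrow> nat \<Rightarrow> com" where
  "emit r k = While r (\<lambda>x. x \<noteq> 0)
     (Seq (Cond r (\<lambda>x. x = 2) (Act k (Some 2) Move_Right) (Act k (Some 1) Move_Right)) (pop r))"

lemma ok_emit [simp]: "ok (emit r k)"
  by (simp add: emit_def)

lemma contents_of_snoc: "(contents_of u)(int (length u) := (if b then 2 else 1)) = contents_of (u @ [b])"
  by (auto simp: contents_of_def fun_eq_iff nth_append)

lemma exec_emit:
  assumes "s r = tape_of w h" "s k = (contents_of u, int (length u))" "r \<noteq> k"
  shows "\<exists>t s'. exec (emit r k) s t s' \<and> t \<le> 5 * length w + 1 \<and> fst (s' k) = contents_of (u @ w) \<and>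
    (\<forall>i. i \<noteq> r \<longrightarrow> i \<noteq> k \<longrightarrow> s' i = s i)"
  using assms
proof (induction w arbitrary: s h u)
  case Nil
  then have "exec (emit r k) s 1 s"
    unfolding emit_def by (intro exec_While_False) simp
  then show ?case using Nil by (intro exI[of _ "1::nat"] exI[of _ s]) simp
next
  case (Cons b w)
  let ?s = "s(k := (contents_of (u @ [b]), int (length (u @ [b]))))"
  have "exec (Act k (Some (if b then 2 else 1)) Move_Right) s 1 ?s"
    using exec_Act[of k "Some (if b then 2 else 1)" Move_Right s] Cons.prems(2) contents_of_snoc[of u b]
    by (simp add: add.commute split del: if_split)
  then have 1: "exec (Cond r (\<lambda>x. x = 2) (Act k (Some 2) Move_Right) (Act k (Some 1) Move_Right)) s (1 + 1) ?s"
    using Cons.prems(1) by (intro exec_Cond) (auto split: if_splits)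
  have "?s r = tape_of (b # w) h" using Cons.prems by simp
  note 2 = exec_pop[of ?s r, OF this]
  let ?s2 = "?s(r := tape_of w (h + 1))"
  have "\<exists>t s'. exec (emit r k) ?s2 t s' \<and> t \<le> 5 * length w + 1 \<and> fst (s' k) = contents_of ((u @ [b]) @ w) \<and>
    (\<forall>i. i \<noteq> r \<longrightarrow> i \<noteq> k \<longrightarrow> s' i = ?s2 i)"
    by (rule Cons.IH) (use Cons.prems in auto)
  then obtain t s' where 3: "exec (emit r k) ?s2 t s'" "t \<le> 5 * length w + 1"
    "fst (s' k) = contents_of (u @ b # w)" "\<forall>i. i \<noteq> r \<longrightarrow> i \<noteq> k \<longrightarrow> s' i = s i" by auto
  have "read_tape (s r) \<noteq> 0" using Cons.prems(1) by simp
  from exec_While_True[where P = "\<lambda>x. x \<noteq> 0", OF this exec_Seq[OF 1 2[simplified list.sel]] 3(1)[unfolded emit_def]]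
  have "exec (emit r k) s (1 + (1 + (1 + 1) + 1) + t) s'" unfolding emit_def .
  then show ?case using 3 by (intro exI[of _ "1 + (1 + (1 + 1) + 1) + t"] exI[of _ s']) simp
qed

text \<open>Each step makes at most one more cell of a tape nonblank. This bounds the register that
  \<open>emit\<close> has to write out, and thereby the time for it.\<close>

lemma exec_nonblank:
  assumes "exec c s t s'" "finite {j. fst (s i) j \<noteq> 0}"
  shows "card {j. fst (s' i) j \<noteq> 0} \<le> card {j. fst (s i) j \<noteq> 0} + t"
proof -
  have "(cstep ^^ t) (K, s) = (K', s') \<Longrightarrow>
      finite {j. fst (s' i) j \<noteq> 0} \<and> card {j. fst (s' i) j \<noteq> 0} \<le> card {j. fst (s i) j \<noteq> 0} + t" for t K K' s'
  proof (induction t arbitrary: K' s')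
    case (Suc t)
    obtain K1 s1 where 1: "(cstep ^^ t) (K, s) = (K1, s1)" by fastforce
    then have "cstep (K1, s1) = (K', s')" using Suc.prems by simp
    then obtain a where "s' i = act a (s1 i)" by (metis (no_types, lifting) cstep_def case_prod_conv prod.collapse snd_conv)
    then have sub: "{j. fst (s' i) j \<noteq> 0} \<subseteq> insert (snd (s1 i)) {j. fst (s1 i) j \<noteq> 0}"
      by (cases a; cases "s1 i") auto
    note IH = Suc.IH[OF 1]
    have "card {j. fst (s' i) j \<noteq> 0} \<le> card (insert (snd (s1 i)) {j. fst (s1 i) j \<noteq> 0})"
      by (rule card_mono) (use IH sub in auto)
    also have "\<dots> \<le> Suc (card {j. fst (s1 i) j \<noteq> 0})" by (rule card_insert_le_m1) auto
    finally show ?case using IH finite_subset[OF sub] by auto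
  qed (use assms(2) in auto)
  with assms(1) show ?thesis unfolding exec_def by metis
qed

lemma card_tape_of:
  "finite {j. fst (tape_of w h) j \<noteq> 0}" "card {j. fst (tape_of w h) j \<noteq> 0} = length w"
proof -
  have "{j. fst (tape_of w h) j \<noteq> 0} = {h..<h + int (length w)}"
    by (auto simp: tape_of_def contents_of_eq_0)
  then show "finite {j. fst (tape_of w h) j \<noteq> 0}" "card {j. fst (tape_of w h) j \<noteq> 0} = length w"
    by simp_all
qed

lemma ptime_computableI:
  assumes ok: "ok c" and neq: "r \<noteq> fl"
    and c: "\<And>ws. length ws = n \<Longrightarrow> \<exists>v'. does c (nth_input ws) (poly p (total_length ws)) v' \<and>
      (case f ws of None \<Rightarrow> top_symbol (v' fl) \<noteq> 2 | Some w \<Rightarrow> top_symbol (v' fl) = 2 \<and> v' r = w)"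
  shows "ptime_computable n f"
proof -
  \<comment> \<open>The first tape beyond the program, its two result registers and the inputs. It
    is untouched when the program ends, and as the last of \<open>Suc K\<close> tapes it is the
    output tape.\<close>
  define K where "K = max (tape_bound c) (max (Suc r) (max (Suc fl) n))"
  have K: "tape_bound c \<le> K" "r < K" "fl < K" "n \<le> K" by (auto simp: K_def)
  let ?c = "Seq c (Cond fl (\<lambda>x. x = 2) (emit r K) skip)"
  have "ok ?c" "tape_bound ?c \<le> Suc K" using ok K by (simp_all add: emit_def skip_def pop_def)
  then obtain M where M: "wf_tm M" "num_tapes M = Suc K"
    "\<And>ws t t' s'. exec ?c (input_tapes ws) t s' \<Longrightarrow> t < t' \<Longrightarrow>
       run M ws t' = (if read_tape (s' fl) = 2 then accept_state M else reject_state M, map s' [0..<Suc K])"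
    using compile[of ?c "Suc K" fl] K by (metis less_SucI)
  \<comment> \<open>For inputs of total length \<open>n\<close> the result has at most
    \<open>n + poly p n\<close> bits, and writing it out takes 5 steps per bit.\<close>
  define P where "P = [:10:] + smult 8 (p + [:0, 1:])"
  have "let (q, ts) = run M ws (poly P (total_length ws)) in
              case f ws of
                None \<Rightarrow> q = reject_state M
              | Some w \<Rightarrow> q = accept_state M \<and> fst (last ts) = contents_of w" if ws: "length ws = n" for ws
  proof -
    let ?L = "total_length ws"
    obtain v' where v': "does c (nth_input ws) (poly p ?L) v'"
      "case f ws of None \<Rightarrow> top_symbol (v' fl) \<noteq> 2 | Some w \<Rightarrow> top_symbol (v' fl) = 2 \<and> v' r = w"
      using c[OF ws] by blast
    have s0: "input_tapes ws i = tape_of (nth_input ws i) 0" for i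
      by (simp add: input_tapes_def tape_of_def nth_input_def)
    then have "regs (nth_input ws) (input_tapes ws)" unfolding regs_def by blast
    then obtain t s where s: "exec c (input_tapes ws) t s" "t \<le> poly p ?L" "regs v' s"
      using v'(1) unfolding does_def by blast
    have sK: "s K = (contents_of [], 0)"
      using exec_frame[OF s(1), of K] K ws by (simp add: input_tapes_def)
    obtain hr hf where hr: "s r = tape_of (v' r) hr" "s fl = tape_of (v' fl) hf"
      using regsD[OF s(3)] by metis
    have "length (v' r) \<le> length (nth_input ws r) + t"
      using exec_nonblank[OF s(1), of r] by (simp only: hr s0 card_tape_of)
    then have lr: "length (v' r) \<le> ?L + poly p ?L" using s(2) length_nth_input[of ws r] by linarith
    show ?thesis
    proof (cases "f ws")
      case None
      then have "exec (Cond fl (\<lambda>x. x = 2) (emit r K) skip) s (1 + 1) s"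
        using v'(2) hr exec_skip[of s] by (intro exec_Cond) simp
      from exec_Seq[OF s(1) this] have "exec ?c (input_tapes ws) (1 + t + (1 + 1)) s" .
      moreover have "1 + t + (1 + 1) < poly P ?L" using s(2) by (simp add: P_def)
      ultimately have "run M ws (poly P ?L) = (if read_tape (s fl) = 2 then accept_state M else reject_state M, map s [0..<Suc K])"
        by (rule M(3))
      then show ?thesis using v'(2) None hr by simp
    next
      case (Some w)
      obtain t2 s2 where s2: "exec (emit r K) s t2 s2" "t2 \<le> 5 * length w + 1" "fst (s2 K) = contents_of w"
        "\<forall>i. i \<noteq> r \<longrightarrow> i \<noteq> K \<longrightarrow> s2 i = s i"
        using exec_emit[of s r w hr K "[]"] hr sK v'(2) Some K by auto
      have "exec (Cond fl (\<lambda>x. x = 2) (emit r K) skip) s (1 + t2) s2"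
        using v'(2) hr Some s2(1) by (intro exec_Cond) simp
      from exec_Seq[OF s(1) this] have e: "exec ?c (input_tapes ws) (1 + t + (1 + t2)) s2" .
      have "1 + t + (1 + t2) < poly P ?L" using s(2) s2(2) lr v'(2) Some by (simp add: P_def)
      with e have "run M ws (poly P ?L) = (if read_tape (s2 fl) = 2 then accept_state M else reject_state M, map s2 [0..<Suc K])"
        by (rule M(3))
      moreover have "read_tape (s2 fl) = 2" using s2(4) hr(2) v'(2) Some neq K(3) by simp
      ultimately show ?thesis using Some s2(3) by simp
    qed
  qed
  then show ?thesis
    unfolding ptime_computable_def using M(1,2) K by (intro exI[of _ M] exI[of _ P]) auto
qed

text \<open>A subroutine that works for all choices of registers below a free region starting at
  \<open>tmp\<close>. The old contents of \<open>r\<close> and \<open>fl\<close> enter the time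
  bound because they have to be erased. An undefined value shows as an empty result with a false
  flag.\<close>

definition callable :: "nat \<Rightarrow> (bits list \<Rightarrow> bits option) \<Rightarrow> (nat \<Rightarrow> nat list \<Rightarrow> nat \<Rightarrow> nat \<Rightarrow> com) \<Rightarrow>
    nat poly \<Rightarrow> bool" where
  "callable n f C q \<longleftrightarrow> (\<forall>tmp is r fl. ok (C tmp is r fl)) \<and>
     (\<forall>tmp is r fl v. length is = n \<longrightarrow> (\<forall>i\<in>set is. i < tmp) \<longrightarrow> r < tmp \<longrightarrow> fl < tmp \<longrightarrow> r \<noteq> fl \<longrightarrow>
        (\<forall>i\<ge>tmp. v i = []) \<longrightarrow>
        does (C tmp is r fl) v (poly q (total_length (map v is) + length (v r) + length (v fl)))
          (v(r := (case f (map v is) of None \<Rightarrow> [] | Some w \<Rightarrow> w), fl := [f (map v is) \<noteq> None])))"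

lemma callable_ok [simp]: "callable n f C q \<Longrightarrow> ok (C tmp is r fl)"
  by (simp add: callable_def)

lemma callable_does:
  assumes "callable n f C q" "length is = n" "\<forall>i\<in>set is. i < tmp" "r < tmp" "fl < tmp" "r \<noteq> fl"
    "\<forall>i\<ge>tmp. v i = []"
    and "v' = v(r := (case f (map v is) of None \<Rightarrow> [] | Some w \<Rightarrow> w), fl := [f (map v is) \<noteq> None])"
    and "total_length (map v is) + length (v r) + length (v fl) \<le> m" "poly q m \<le> T"
  shows "does (C tmp is r fl) v T v'"
proof -
  have "does (C tmp is r fl) v (poly q (total_length (map v is) + length (v r) + length (v fl))) v'"
    using assms(1-8) unfolding callable_def by blast
  moreover have "poly q (total_length (map v is) + length (v r) + length (v fl)) \<le> T"
    using poly_mono_nat[OF assms(9), of q] assms(10) by linarith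
  ultimately show ?thesis by (rule does_mono)
qed

lemma callable_call:
  assumes M: "wf_tm M" "n \<le> num_tapes M"
    and run: "\<And>ws. length ws = n \<Longrightarrow> halting M (fst (run M ws (poly p (total_length ws)))) \<and>
       (fst (run M ws (poly p (total_length ws))) = accept_state M \<longleftrightarrow> f ws \<noteq> None) \<and>
       (\<forall>w. f ws = Some w \<longrightarrow> (if keep then fst (last (snd (run M ws (poly p (total_length ws))))) = contents_of w
          else w = []))"
  shows "\<exists>C q. callable n f C q"
proof -
  define q where "q = smult (30 * (num_tapes M + 2)) ([:2, 1:] + p)"
  have "does (call M keep tmp is r fl) v (poly q (total_length (map v is) + length (v r) + length (v fl)))
          (v(r := (case f (map v is) of None \<Rightarrow> [] | Some w \<Rightarrow> w), fl := [f (map v is) \<noteq> None]))"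
    if "length is = n" "\<forall>i\<in>set is. i < tmp" "r < tmp" "fl < tmp" "r \<noteq> fl" "\<forall>i\<ge>tmp. v i = []" for tmp "is" r fl v
  proof -
    let ?ws = "map v is"
    let ?p = "poly p (total_length ?ws)"
    have len: "length ?ws = n" using that by simp
    note r = run[OF len]
    have 1: "does (call M keep tmp is r fl) v
      (30 * (num_tapes M + 2) * (total_length ?ws + ?p + length (v r) + length (v fl) + 2))
      (v(r := if keep \<and> f ?ws \<noteq> None then the (f ?ws) else [], fl := [f ?ws \<noteq> None]))"
      by (rule does_call[OF M(1)]) (use that M r in auto)
    have 2: "(if keep \<and> f ?ws \<noteq> None then the (f ?ws) else []) = (case f ?ws of None \<Rightarrow> [] | Some w \<Rightarrow> w)"
      using r by (cases "f ?ws") auto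
    have "?p \<le> poly p (total_length ?ws + length (v r) + length (v fl))"
      by (rule poly_mono_nat) simp
    then have 3: "30 * (num_tapes M + 2) * (total_length ?ws + ?p + length (v r) + length (v fl) + 2)
        \<le> poly q (total_length ?ws + length (v r) + length (v fl))"
      unfolding q_def poly_smult by (intro mult_left_mono) auto
    show ?thesis using does_mono[OF 1[unfolded 2] 3] .
  qed
  then have "callable n f (call M keep) q"
    unfolding callable_def using M(1) by simp
  then show ?thesis by blast
qed

lemma callable_ptime_computable:
  assumes "ptime_computable n f"
  shows "\<exists>C q. callable n f C q"
proof -
  obtain M p where M: "wf_tm M" "n \<le> num_tapes M"
    "\<And>ws. length ws = n \<Longrightarrow> (let (q, ts) = run M ws (poly p (total_length ws)) in
              case f ws of
                None \<Rightarrow> q = reject_state M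
              | Some w \<Rightarrow> q = accept_state M \<and> fst (last ts) = contents_of w)"
    using assms unfolding ptime_computable_def by blast
  have ne: "accept_state M \<noteq> reject_state M" using M(1) by (simp add: wf_tm_def)
  show ?thesis
  proof (rule callable_call[where M = M and p = p and keep = True])
    fix ws :: "bits list" assume "length ws = n"
    from M(3)[OF this] ne
    show "halting M (fst (run M ws (poly p (total_length ws)))) \<and>
       (fst (run M ws (poly p (total_length ws))) = accept_state M \<longleftrightarrow> f ws \<noteq> None) \<and>
       (\<forall>w. f ws = Some w \<longrightarrow> (if True then fst (last (snd (run M ws (poly p (total_length ws))))) = contents_of w
          else w = []))"
      by (cases "f ws") (auto simp: split_def Let_def halting_def)
  qed (use M in auto)
qed

lemma callable_ptime_decidable:
  assumes "ptime_decidable n A"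
  shows "\<exists>C q. callable n (\<lambda>ws. if A ws then Some [] else None) C q"
proof -
  obtain M p where M: "wf_tm M" "n \<le> num_tapes M"
    "\<And>ws. length ws = n \<Longrightarrow> fst (run M ws (poly p (total_length ws))) =
             (if A ws then accept_state M else reject_state M)"
    using assms unfolding ptime_decidable_def by blast
  have ne: "accept_state M \<noteq> reject_state M" using M(1) by (simp add: wf_tm_def)
  show ?thesis
    by (rule callable_call[where M = M and p = p and keep = False])
       (use M ne in \<open>auto simp: halting_def\<close>)
qed

lemma map_nth_input [simp]: "length ws = n \<Longrightarrow> map (nth_input ws) [0..<n] = ws"
  by (rule nth_equalityI) (auto simp: nth_input_def)

lemma nth_input_Nil [simp]: "length ws \<le> i \<Longrightarrow> nth_input ws i = []"
  by (simp add: nth_input_def)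

lemma ptime_computable_cong:
  "(\<And>ws. length ws = n \<Longrightarrow> f ws = f' ws) \<Longrightarrow> ptime_computable n f \<longleftrightarrow> ptime_computable n f'"
  unfolding ptime_computable_def by simp

lemma callable_imp_ptime_computable:
  assumes "callable n f C q"
  shows "ptime_computable n f"
proof (rule ptime_computableI[where c = "C (n + 2) [0..<n] n (n + 1)" and p = q and fl = "n + 1" and r = n])
  fix ws :: "bits list" assume ws: "length ws = n"
  have "does (C (n + 2) [0..<n] n (n + 1)) (nth_input ws) (poly q (total_length ws))
      ((nth_input ws)(n := (case f ws of None \<Rightarrow> [] | Some w \<Rightarrow> w), n + 1 := [f ws \<noteq> None]))"
    by (rule callable_does[OF assms, where m = "total_length ws"]) (use ws in auto)
  then show "\<exists>v'. does (C (n + 2) [0..<n] n (n + 1)) (nth_input ws) (poly q (total_length ws)) v' \<and>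
      (case f ws of None \<Rightarrow> top_symbol (v' (n + 1)) \<noteq> 2 | Some w \<Rightarrow> top_symbol (v' (n + 1)) = 2 \<and> v' n = w)"
    by (intro exI[of _ "(nth_input ws)(n := (case f ws of None \<Rightarrow> [] | Some w \<Rightarrow> w), n + 1 := [f ws \<noteq> None])"])
       (simp split: option.split)
qed (use assms in auto)

text \<open>From left to right a detour is taken: a decider may leave anything on its last tape, and
  calling it as a subroutine discards this and puts the value \<open>[]\<close> in its
  place.\<close>

lemma ptime_decidable_iff:
  "ptime_decidable n A \<longleftrightarrow> ptime_computable n (\<lambda>ws. if A ws then Some [] else None)"
proof
  assume "ptime_decidable n A"
  then show "ptime_computable n (\<lambda>ws. if A ws then Some [] else None)"
    using callable_ptime_decidable callable_imp_ptime_computable by blast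
next
  assume "ptime_computable n (\<lambda>ws. if A ws then Some [] else None)"
  then obtain M p where M: "wf_tm M" "n \<le> num_tapes M"
    "\<And>ws. length ws = n \<Longrightarrow> (let (q, ts) = run M ws (poly p (total_length ws)) in
              case (if A ws then Some [] else None) of
                None \<Rightarrow> q = reject_state M
              | Some w \<Rightarrow> q = accept_state M \<and> fst (last ts) = contents_of w)"
    unfolding ptime_computable_def by blast
  have "fst (run M ws (poly p (total_length ws))) = (if A ws then accept_state M else reject_state M)"
    if "length ws = n" for ws
    using M(3)[OF that] by (simp add: split_def Let_def split: if_splits)
  then show "ptime_decidable n A" unfolding ptime_decidable_def using M(1,2) by blast
qed

text \<open>The value of \<open>g\<close> goes to register \<open>n\<close>, right behind the
  inputs, so that it is the last argument of \<open>f\<close>.\<close>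

lemma ptime_computable_let:
  assumes "ptime_computable n g" "ptime_computable (Suc n) f"
  shows "ptime_computable n (\<lambda>ws. case g ws of None \<Rightarrow> None | Some y \<Rightarrow> f (ws @ [y]))"
proof -
  obtain C q where C: "callable n g C q" using callable_ptime_computable[OF assms(1)] by blast
  obtain C' q' where C': "callable (Suc n) f C' q'" using callable_ptime_computable[OF assms(2)] by blast
  obtain l where l: "\<And>ws w. length ws = n \<Longrightarrow> g ws = Some w \<Longrightarrow> length w \<le> poly l (total_length ws)"
    using ptime_computable_length[OF assms(1)] by blast
  let ?c = "C (n + 3) [0..<n] n (n + 2)" and ?d = "C' (n + 3) [0..<Suc n] (n + 1) (n + 2)"
  define p where "p = [:3:] + q + pcompose q' ([:1, 1:] + l)"
  show ?thesis
  proof (rule ptime_computableI[where c = "Seq ?c (Cond (n + 2) (\<lambda>x. x = 2) ?d skip)" and p = p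
        and fl = "n + 2" and r = "n + 1"])
    fix ws :: "bits list" assume ws: "length ws = n"
    let ?L = "total_length ws"
    let ?v = "(nth_input ws)(n := (case g ws of None \<Rightarrow> [] | Some w \<Rightarrow> w), n + 2 := [g ws \<noteq> None])"
    have 1: "does ?c (nth_input ws) (poly q ?L) ?v"
      by (rule callable_does[OF C, where m = "?L"]) (use ws in auto)
    show "\<exists>v'. does (Seq ?c (Cond (n + 2) (\<lambda>x. x = 2) ?d skip)) (nth_input ws) (poly p ?L) v' \<and>
      (case (case g ws of None \<Rightarrow> None | Some y \<Rightarrow> f (ws @ [y])) of None \<Rightarrow> top_symbol (v' (n + 2)) \<noteq> 2
       | Some w \<Rightarrow> top_symbol (v' (n + 2)) = 2 \<and> v' (n + 1) = w)"
    proof (cases "g ws")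
      case None
      have "does (Cond (n + 2) (\<lambda>x. x = 2) ?d skip) ?v (1 + 1) ?v"
        by (rule does_Cond) (use None does_skip in simp)
      from does_mono[OF does_Seq[OF 1 this], of "poly p ?L"]
      have "does (Seq ?c (Cond (n + 2) (\<lambda>x. x = 2) ?d skip)) (nth_input ws) (poly p ?L) ?v"
        by (simp add: p_def)
      then show ?thesis by (intro exI[of _ ?v]) (simp add: None)
    next
      case (Some y)
      have m: "map ?v [0..<Suc n] = ws @ [y]"
        by (rule nth_equalityI) (use ws Some in \<open>auto simp: nth_append nth_input_def\<close>)
      let ?v' = "?v(n + 1 := (case f (ws @ [y]) of None \<Rightarrow> [] | Some w \<Rightarrow> w), n + 2 := [f (ws @ [y]) \<noteq> None])"
      have "total_length (map ?v [0..<Suc n]) = ?L + length y"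
        unfolding m by (simp add: total_length_def)
      moreover have "length y \<le> poly l ?L" using l[OF ws Some] .
      ultimately have 2: "does ?d ?v (poly q' (?L + poly l ?L + 1)) ?v'"
        by (intro callable_does[OF C', where m = "?L + poly l ?L + 1"]) (use ws m in auto)
      have "does (Cond (n + 2) (\<lambda>x. x = 2) ?d skip) ?v (1 + poly q' (?L + poly l ?L + 1)) ?v'"
        by (rule does_Cond) (use 2 Some in simp)
      from does_mono[OF does_Seq[OF 1 this], of "poly p ?L"]
      have "does (Seq ?c (Cond (n + 2) (\<lambda>x. x = 2) ?d skip)) (nth_input ws) (poly p ?L) ?v'"
        by (simp add: p_def poly_pcompose ac_simps)
      then show ?thesis by (intro exI[of _ ?v']) (simp add: Some split: option.split)
    qed
  qed (use C C' in auto)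
qed

lemma total_length_map_le:
  assumes "set is \<subseteq> {..<length ws}"
  shows "total_length (map ((!) ws) is) \<le> length is * total_length ws"
  using assms
proof (induction "is")
  case (Cons i "is")
  have "length (ws ! i) \<le> total_length ws"
    using Cons.prems by (auto simp: total_length_def intro!: member_le_sum_list)
  then show ?case using Cons by (simp add: total_length_def)
qed (simp add: total_length_def)

lemma ptime_computable_reindex:
  assumes "ptime_computable m f" "length is = m" "set is \<subseteq> {..<n}"
  shows "ptime_computable n (\<lambda>ws. f (map ((!) ws) is))"
proof -
  obtain C q where C: "callable m f C q" using callable_ptime_computable[OF assms(1)] by blast
  show ?thesis
  proof (rule ptime_computableI[where c = "C (n + 2) is n (n + 1)" and p = "pcompose q [:0, m:]"
        and fl = "n + 1" and r = n])
    fix ws :: "bits list" assume ws: "length ws = n"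
    have m: "map (nth_input ws) is = map ((!) ws) is"
      using assms(3) ws by (auto simp: nth_input_def)
    have tl: "total_length (map ((!) ws) is) \<le> m * total_length ws"
      using total_length_map_le[of "is" ws] assms(2,3) ws by simp
    let ?v = "(nth_input ws)(n := (case f (map ((!) ws) is) of None \<Rightarrow> [] | Some w \<Rightarrow> w),
         n + 1 := [f (map ((!) ws) is) \<noteq> None])"
    have "does (C (n + 2) is n (n + 1)) (nth_input ws) (poly (pcompose q [:0, m:]) (total_length ws)) ?v"
      by (rule callable_does[OF C, where m = "m * total_length ws"])
         (use ws assms tl in \<open>auto simp: m poly_pcompose ac_simps\<close>)
    then show "\<exists>v'. does (C (n + 2) is n (n + 1)) (nth_input ws)
         (poly (pcompose q [:0, m:]) (total_length ws)) v' \<and>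
      (case f (map ((!) ws) is) of None \<Rightarrow> top_symbol (v' (n + 1)) \<noteq> 2
        | Some w \<Rightarrow> top_symbol (v' (n + 1)) = 2 \<and> v' n = w)"
      by (intro exI[of _ ?v]) (simp split: option.split)
  qed (use C in auto)
qed

lemma ptime_computable_if:
  assumes "ptime_decidable n A" "ptime_computable n f" "ptime_computable n g"
  shows "ptime_computable n (\<lambda>ws. if A ws then f ws else g ws)"
proof -
  obtain C1 q1 where C1: "callable n (\<lambda>ws. if A ws then Some [] else None) C1 q1"
    using callable_ptime_decidable[OF assms(1)] by blast
  obtain C2 q2 where C2: "callable n f C2 q2" using callable_ptime_computable[OF assms(2)] by blast
  obtain C3 q3 where C3: "callable n g C3 q3" using callable_ptime_computable[OF assms(3)] by blast
  let ?c1 = "C1 (n + 2) [0..<n] n (n + 1)" and ?c2 = "C2 (n + 2) [0..<n] n (n + 1)"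
    and ?c3 = "C3 (n + 2) [0..<n] n (n + 1)"
  let ?c = "Seq ?c1 (Cond (n + 1) (\<lambda>x. x = 2) ?c2 ?c3)"
  define p where "p = [:2:] + q1 + pcompose q2 [:1, 1:] + pcompose q3 [:1, 1:]"
  show ?thesis
  proof (rule ptime_computableI[where c = ?c and p = p and fl = "n + 1" and r = n])
    fix ws :: "bits list" assume ws: "length ws = n"
    let ?L = "total_length ws" and ?r = "if A ws then f ws else g ws"
    let ?v = "(nth_input ws)(n + 1 := [A ws])"
    let ?v' = "(nth_input ws)(n := (case ?r of None \<Rightarrow> [] | Some w \<Rightarrow> w), n + 1 := [?r \<noteq> None])"
    have v0: "(nth_input ws)(n := []) = nth_input ws" using ws by auto
    have 1: "does ?c1 (nth_input ws) (poly q1 ?L) ?v"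
      by (rule callable_does[OF C1, where m = "?L"]) (use ws v0 in auto)
    have m: "map ?v [0..<n] = ws"
      by (rule nth_equalityI) (use ws in \<open>auto simp: nth_input_def\<close>)
    have v': "?v' = ?v(n := (case ?r of None \<Rightarrow> [] | Some w \<Rightarrow> w), n + 1 := [?r \<noteq> None])" by auto
    have "does (if top_symbol (?v (n + 1)) = 2 then ?c2 else ?c3) ?v (poly q2 (1 + ?L) + poly q3 (1 + ?L)) ?v'"
    proof (cases "A ws")
      case True
      have "does ?c2 ?v (poly q2 (1 + ?L) + poly q3 (1 + ?L)) ?v'"
        by (rule callable_does[OF C2, where m = "1 + ?L"]) (use ws m True in \<open>auto\<close>)
      then show ?thesis using True by simp
    next
      case False
      have "does ?c3 ?v (poly q2 (1 + ?L) + poly q3 (1 + ?L)) ?v'"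
        by (rule callable_does[OF C3, where m = "1 + ?L"]) (use ws m False in auto)
      then show ?thesis using False by simp
    qed
    note does_Seq[OF 1 does_Cond[where P = "\<lambda>x. x = 2", OF this]]
    then have "does ?c (nth_input ws) (poly p ?L) ?v'"
      by (rule does_mono) (simp add: p_def poly_pcompose)
    then show "\<exists>v'. does ?c (nth_input ws) (poly p ?L) v' \<and>
      (case ?r of None \<Rightarrow> top_symbol (v' (n + 1)) \<noteq> 2 | Some w \<Rightarrow> top_symbol (v' (n + 1)) = 2 \<and> v' n = w)"
      by (intro exI[of _ ?v']) (simp split: option.split)
  qed (use C1 C2 C3 in auto)
qed

lemma ptime_computable_comp1:
  assumes "ptime_computable 1 f" "ptime_computable n g"
  shows "ptime_computable n (\<lambda>ws. case g ws of None \<Rightarrow> None | Some y \<Rightarrow> f [y])"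
proof -
  have "ptime_computable (Suc n) (\<lambda>ws. f (map ((!) ws) [n]))"
    by (rule ptime_computable_reindex[OF assms(1)]) auto
  from ptime_computable_let[OF assms(2) this] show ?thesis
    by (subst (asm) ptime_computable_cong[where f' = "\<lambda>ws. case g ws of None \<Rightarrow> None | Some y \<Rightarrow> f [y]"])
       (auto simp: nth_append split: option.split)
qed

lemma ptime_computable_comp2:
  assumes "ptime_computable 2 f" "ptime_computable n g" "ptime_computable n h"
  shows "ptime_computable n
    (\<lambda>ws. case g ws of None \<Rightarrow> None | Some y \<Rightarrow> (case h ws of None \<Rightarrow> None | Some z \<Rightarrow> f [y, z]))"
proof -
  have 1: "ptime_computable (Suc (Suc n)) (\<lambda>ws. f (map ((!) ws) [n, Suc n]))"
    by (rule ptime_computable_reindex[OF assms(1)]) auto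
  have 2: "ptime_computable (Suc n) (\<lambda>ws. h (map ((!) ws) [0..<n]))"
    by (rule ptime_computable_reindex[OF assms(3)]) auto
  have m: "map ((!) (ws @ [y])) [0..<n] = ws" if "length ws = n" for ws :: "bits list" and y
    by (rule nth_equalityI) (use that in \<open>auto simp: nth_append\<close>)
  from ptime_computable_let[OF assms(2) ptime_computable_let[OF 2 1]] show ?thesis
    by (subst (asm) ptime_computable_cong[where f' = "\<lambda>ws. case g ws of None \<Rightarrow> None | Some y \<Rightarrow>
          (case h ws of None \<Rightarrow> None | Some z \<Rightarrow> f [y, z])"])
       (auto simp: nth_append m split: option.split)
qed

text \<open>Few rounds are not enough: a polynomial-time \<open>g\<close> may double the length each
  time. Hence all intermediate values are required to be polynomially short.\<close>

lemma ptime_computable_iterate: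
  fixes g F :: "bits \<Rightarrow> bits"
  assumes "ptime_decidable 1 (\<lambda>ws. S (ws ! 0))" "ptime_computable 1 (\<lambda>ws. Some (g (ws ! 0)))"
    and F: "\<And>w. \<exists>n \<le> poly P (length w). (\<forall>i<n. S ((g ^^ i) w)) \<and> \<not> S ((g ^^ n) w) \<and> F w = (g ^^ n) w \<and>
      (\<forall>i\<le>n. length ((g ^^ i) w) \<le> poly P (length w))"
  shows "ptime_computable 1 (\<lambda>ws. Some (F (ws ! 0)))"
proof -
  obtain C1 q1 where C1: "callable 1 (\<lambda>ws. if S (ws ! 0) then Some [] else None) C1 q1"
    using callable_ptime_decidable[OF assms(1)] by blast
  obtain C2 q2 where C2: "callable 1 (\<lambda>ws. Some (g (ws ! 0))) C2 q2"
    using callable_ptime_computable[OF assms(2)] by blast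
  define st where "st x b = (\<lambda>i::nat. if i = 0 then x else if i = 2 then [b] else [])" for x :: bits and b
  let ?c1 = "C1 3 [0] 1 2" and ?c2 = "C2 3 [0] 0 2"
  let ?loop = "While 2 (\<lambda>x. x = 2) (Seq ?c2 ?c1)"
  \<comment> \<open>The call of \<open>g\<close> overwrites its own argument, so argument, old
    result and flag add up to at most \<open>2 * B + 1\<close>.\<close>
  define T where "T B = poly q1 (2 * B + 1) + poly q2 (2 * B + 1)" for B
  have c1: "does ?c1 (st x b) (poly q1 (2 * B + 1)) (st x (S x))" if "length x \<le> B" for x b B
    by (rule callable_does[OF C1, where m = "2 * B + 1"])
       (use that in \<open>auto simp: st_def fun_eq_iff total_length_def\<close>)
  have c2: "does ?c2 (st x b) (poly q2 (2 * B + 1)) (st (g x) True)" if "length x \<le> B" for x b B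
    by (rule callable_does[OF C2, where m = "2 * B + 1"])
       (use that in \<open>auto simp: st_def fun_eq_iff total_length_def\<close>)
  have loop: "does ?loop (st x (S x)) (1 + n * (2 + T B)) (st ((g ^^ n) x) False)"
    if "\<forall>i<n. S ((g ^^ i) x)" "\<not> S ((g ^^ n) x)" "\<forall>i\<le>n. length ((g ^^ i) x) \<le> B" for n x B
    using that
  proof (induction n arbitrary: x)
    case 0
    then have "\<not> top_symbol (st x (S x) 2) = 2" by (simp add: st_def)
    from does_While_False[where P = "\<lambda>x. x = 2" and v = "st x (S x)" and i = 2, OF this] show ?case using 0 by simp
  next
    case (Suc n)
    have "S x" using Suc.prems(1)[rule_format, of 0] by simp
    have l: "length x \<le> B" "length (g x) \<le> B"
      using Suc.prems(3)[rule_format, of 0] Suc.prems(3)[rule_format, of 1] by simp_all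
    have IH: "does ?loop (st (g x) (S (g x))) (1 + n * (2 + T B)) (st ((g ^^ n) (g x)) False)"
    proof (rule Suc.IH)
      show "\<forall>i<n. S ((g ^^ i) (g x))"
        using Suc.prems(1) by (metis Suc_less_eq comp_apply funpow_Suc_right)
      show "\<not> S ((g ^^ n) (g x))" using Suc.prems(2) by (metis comp_apply funpow_Suc_right)
      show "\<forall>i\<le>n. length ((g ^^ i) (g x)) \<le> B"
        using Suc.prems(3) by (metis Suc_le_mono comp_apply funpow_Suc_right)
    qed
    have "top_symbol (st x (S x) 2) = 2" using \<open>S x\<close> by (simp add: st_def)
    from does_While_True[where P = "\<lambda>x. x = 2" and v = "st x (S x)" and i = 2, OF this does_Seq[OF c2[OF l(1)] c1[OF l(2)]] IH]
    show ?case by (rule does_cong) (simp_all add: T_def funpow_swap1)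
  qed
  \<comment> \<open>The loop ends with a false flag; since \<open>F\<close> is total, the flag has
    to be raised again.\<close>
  let ?c = "Seq ?c1 (Seq ?loop (set_flag 2))"
  define p where "p = [:10:] + pcompose q1 [:1, 2:] + P * ([:2:] + pcompose q1 ([:1:] + smult 2 P) + pcompose q2 ([:1:] + smult 2 P))"
  show ?thesis
  proof (rule ptime_computableI[where c = ?c and p = p and fl = 2 and r = 0])
    fix ws :: "bits list" assume "length ws = 1"
    then obtain w where ws: "ws = [w]" by (metis One_nat_def length_0_conv length_Suc_conv)
    have L: "total_length ws = length w" by (simp add: ws total_length_def)
    let ?L = "length w"
    obtain n where n: "n \<le> poly P ?L" "\<forall>i<n. S ((g ^^ i) w)" "\<not> S ((g ^^ n) w)" "F w = (g ^^ n) w"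
      "\<forall>i\<le>n. length ((g ^^ i) w) \<le> poly P ?L" using F[of w] by blast
    have v0: "nth_input ws = (\<lambda>i. if i = 0 then w else [])" by (auto simp: ws nth_input_def fun_eq_iff)
    have 1: "does ?c1 (nth_input ws) (poly q1 (2 * ?L + 1)) (st w (S w))"
      by (rule callable_does[OF C1, where m = "2 * ?L + 1"])
         (auto simp: v0 st_def fun_eq_iff total_length_def)
    have "n * (2 + T (poly P ?L)) \<le> poly P ?L * (2 + T (poly P ?L))"
      using n(1) by (rule mult_right_mono) simp
    then have 2: "does ?loop (st w (S w)) (1 + poly P ?L * (2 + T (poly P ?L))) (st (F w) False)"
      using does_mono[OF loop[OF n(2,3,5)]] unfolding n(4) by simp
    have 3: "does (set_flag 2) (st (F w) False) 7 (st (F w) True)"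
      by (rule does_cong[OF does_set_flag]) (auto simp: st_def)
    have e: "poly [:1, 2:] ?L = 2 * ?L + 1" by simp
    have pL: "poly p ?L = 10 + poly q1 (2 * ?L + 1) + poly P ?L * (2 + T (poly P ?L))"
      unfolding p_def poly_add poly_mult poly_pcompose e T_def by (simp add: ac_simps)
    from does_Seq[OF 1 does_Seq[OF 2 3]]
    have "does ?c (nth_input ws) (poly p (total_length ws)) (st (F w) True)"
      unfolding L by (rule does_mono) (simp add: pL)
    then show "\<exists>v'. does ?c (nth_input ws) (poly p (total_length ws)) v' \<and>
       (case Some (F (ws ! 0)) of None \<Rightarrow> top_symbol (v' 2) \<noteq> 2 | Some w \<Rightarrow> top_symbol (v' 2) = 2 \<and> v' 0 = w)"
      by (intro exI[of _ "st (F w) True"]) (simp add: st_def ws)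
  qed (use C1 C2 in auto)
qed

section \<open>Basic functions\<close>

lemma ptime_computable_simple:
  assumes "ok c" "r \<noteq> fl" "\<And>ws. length ws = n \<Longrightarrow> does c (nth_input ws) (poly p (total_length ws)) (v ws)"
    and "\<And>ws. length ws = n \<Longrightarrow> v ws fl = [] \<and> v ws r = f ws"
  shows "ptime_computable n (\<lambda>ws. Some (f ws))"
proof (rule ptime_computableI[where c = "Seq c (push fl True)" and p = "p + [:4:]" and fl = fl and r = r])
  fix ws :: "bits list" assume ws: "length ws = n"
  have "does (Seq c (push fl True)) (nth_input ws) (poly (p + [:4:]) (total_length ws)) ((v ws)(fl := [True]))"
    by (rule does_cong[OF does_Seq[OF assms(3)[OF ws] does_push]]) (use assms(4)[OF ws] in auto)
  then show "\<exists>v'. does (Seq c (push fl True)) (nth_input ws) (poly (p + [:4:]) (total_length ws)) v' \<and>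
      (case Some (f ws) of None \<Rightarrow> top_symbol (v' fl) \<noteq> 2 | Some w \<Rightarrow> top_symbol (v' fl) = 2 \<and> v' r = w)"
    using assms(2,4) ws by (intro exI[of _ "(v ws)(fl := [True])"]) simp
qed (use assms in auto)

lemma ptime_decidable_simple:
  assumes "ok c" "\<And>ws. length ws = n \<Longrightarrow> \<exists>v. does c (nth_input ws) (poly p (total_length ws)) v \<and>
      v fl = [] \<and> v r = [] \<and> (P (top_symbol (v i)) \<longleftrightarrow> A ws)" "r \<noteq> fl"
  shows "ptime_decidable n A"
  unfolding ptime_decidable_iff
proof (rule ptime_computableI[where c = "Seq c (Cond i P (push fl True) skip)" and p = "p + [:5:]" and fl = fl and r = r])
  fix ws :: "bits list" assume ws: "length ws = n"
  obtain v where v: "does c (nth_input ws) (poly p (total_length ws)) v" "v fl = []" "v r = []"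
    "P (top_symbol (v i)) \<longleftrightarrow> A ws" using assms(2)[OF ws] by blast
  have "does (if P (top_symbol (v i)) then push fl True else skip) v 3 (if A ws then v(fl := [True]) else v)"
    using does_push[of fl True v] does_mono[OF does_skip, of 3 v] v(2,4) by simp
  note does_Seq[OF v(1) does_Cond[where P = P and v = v and i = i, OF this]]
  then have "does (Seq c (Cond i P (push fl True) skip)) (nth_input ws) (poly (p + [:5:]) (total_length ws))
      (if A ws then v(fl := [True]) else v)"
    by (rule does_mono) simp
  then show "\<exists>v'. does (Seq c (Cond i P (push fl True) skip)) (nth_input ws) (poly (p + [:5:]) (total_length ws)) v' \<and>
      (case (if A ws then Some [] else None) of None \<Rightarrow> top_symbol (v' fl) \<noteq> 2
        | Some w \<Rightarrow> top_symbol (v' fl) = 2 \<and> v' r = w)"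
    using assms(3) v by (intro exI[of _ "if A ws then v(fl := [True]) else v"]) simp
qed (use assms in auto)

lemma ptime_computable_nth:
  assumes "i < n"
  shows "ptime_computable n (\<lambda>ws. Some (ws ! i))"
  by (rule ptime_computable_simple[where c = skip and r = i and fl = n and p = "[:1:]" and v = nth_input])
     (use assms does_skip in \<open>auto simp: nth_input_def\<close>)

lemma ptime_computable_None: "ptime_computable n (\<lambda>ws. None)"
proof (rule ptime_computableI[where c = skip and p = "[:1:]" and fl = n and r = "Suc n"])
  fix ws :: "bits list" assume "length ws = n"
  then show "\<exists>v'. does skip (nth_input ws) (poly [:1:] (total_length ws)) v' \<and>
      (case None of None \<Rightarrow> top_symbol (v' n) \<noteq> 2 | Some w \<Rightarrow> top_symbol (v' n) = 2 \<and> v' (Suc n) = w)"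
    using does_skip by (intro exI[of _ "nth_input ws"]) simp
qed auto

lemma ptime_computable_const: "ptime_computable n (\<lambda>ws. Some u)"
proof -
  let ?c = "foldr (\<lambda>b c. Seq c (push n b)) u skip"
  have ok: "ok ?c" by (induction u) auto
  have d: "does ?c v (4 * length u + 1) (v(n := u @ v n))" for v
  proof (induction u)
    case Nil
    then show ?case using does_skip by simp
  next
    case (Cons b u)
    from does_Seq[OF this does_push, of n b] show ?case by (auto elim!: does_cong)
  qed
  show ?thesis
  proof (rule ptime_computable_simple[where c = ?c and p = "[:4 * length u + 1:]" and fl = "Suc n" and r = n
        and v = "\<lambda>ws. (nth_input ws)(n := u)"])
    fix ws :: "bits list" assume ws: "length ws = n"
    show "does ?c (nth_input ws) (poly [:4 * length u + 1:] (total_length ws)) ((nth_input ws)(n := u))"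
      by (rule does_cong[OF d]) (use ws in auto)
  qed (use ok in auto)
qed

lemma ptime_computable_Cons: "ptime_computable 1 (\<lambda>ws. Some (b # ws ! 0))"
  by (rule ptime_computable_simple[where c = "push 0 b" and r = 0 and fl = 1 and p = "[:3:]"
        and v = "\<lambda>ws. (nth_input ws)(0 := b # nth_input ws 0)"])
     (auto simp: does_push nth_input_def intro: does_cong[OF does_push])

lemma ptime_computable_tl: "ptime_computable 1 (\<lambda>ws. Some (tl (ws ! 0)))"
  by (rule ptime_computable_simple[where c = "pop 0" and r = 0 and fl = 1 and p = "[:1:]"
        and v = "\<lambda>ws. (nth_input ws)(0 := tl (nth_input ws 0))"])
     (auto simp: does_pop nth_input_def intro: does_cong[OF does_pop])

lemma ptime_decidable_hd: "ptime_decidable 1 (\<lambda>ws. \<exists>w. ws ! 0 = True # w)"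
  by (rule ptime_decidable_simple[where c = skip and r = 1 and fl = 2 and i = 0 and p = "[:1:]" and P = "\<lambda>x. x = 2"])
     (use does_skip in \<open>auto simp: nth_input_def top_symbol_eq_2 intro!: exI[of _ "nth_input ws" for ws]\<close>)

lemma ptime_computable_append: "ptime_computable 2 (\<lambda>ws. Some (ws ! 0 @ ws ! 1))"
proof (rule ptime_computable_simple[where c = "Seq (prepend 4 1 2) (prepend 4 0 2)" and r = 2 and fl = 3 and p = "[:10, 22:]"
      and v = "\<lambda>ws. (nth_input ws)(2 := ws ! 0 @ ws ! 1)"])
  fix ws :: "bits list" assume "length ws = 2"
  then obtain x y where ws: "ws = [x, y]" by (auto simp: numeral_2_eq_2 length_Suc_conv)
  show "does (Seq (prepend 4 1 2) (prepend 4 0 2)) (nth_input ws) (poly [:10, 22:] (total_length ws))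
      ((nth_input ws)(2 := ws ! 0 @ ws ! 1))"
    by (rule does_cong[OF does_Seq[OF does_prepend does_prepend]])
       (auto simp: ws nth_input_def total_length_def fun_eq_iff)
qed (auto simp: nth_input_def)

section \<open>Unary multiplication and comparisons\<close>

lemma does_mult:
  assumes "v 4 = []"
  shows "does (While 0 (\<lambda>x. x \<noteq> 0) (Seq (pop 0) (prepend 4 1 2))) v (length (v 0) * (22 * length (v 1) + 7) + 1)
    (v(0 := [], 2 := concat (replicate (length (v 0)) (v 1)) @ v 2))"
  using assms
proof (induction "v 0" arbitrary: v)
  case Nil
  then have "v(0 := [], 2 := concat (replicate (length (v 0)) (v 1)) @ v 2) = v"
    by (auto simp: fun_eq_iff)
  moreover have "does (While 0 (\<lambda>x. x \<noteq> 0) (Seq (pop 0) (prepend 4 1 2))) v 1 v"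
    by (rule does_While_False) (simp add: Nil(1)[symmetric])
  ultimately show ?case by (simp add: Nil(1)[symmetric] del: fun_upd_apply)
next
  case (Cons b w)
  let ?v = "v(0 := w)"
  let ?v2 = "?v(2 := v 1 @ v 2)"
  have v0: "v 0 = b # w" using Cons.hyps(2) by simp
  have 1: "does (pop 0) v 1 ?v" using does_pop[of 0 v] v0 by simp
  have 2: "does (prepend 4 1 2) ?v (22 * length (v 1) + 3) ?v2"
    using does_prepend[of 1 2 4 ?v] Cons.prems by simp
  have 3: "does (While 0 (\<lambda>x. x \<noteq> 0) (Seq (pop 0) (prepend 4 1 2))) ?v2 (length (?v2 0) * (22 * length (?v2 1) + 7) + 1)
    (?v2(0 := [], 2 := concat (replicate (length (?v2 0)) (?v2 1)) @ ?v2 2))"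
    by (rule Cons.hyps(1)) (use Cons.prems in auto)
  have "concat (replicate n u) @ u = u @ concat (replicate n u)" for n and u :: bits
    by (induction n) auto
  then have eq: "?v2(0 := [], 2 := concat (replicate (length (?v2 0)) (?v2 1)) @ ?v2 2) =
      v(0 := [], 2 := concat (replicate (length (v 0)) (v 1)) @ v 2)"
    unfolding v0 by (simp add: fun_eq_iff)
  have "top_symbol (v 0) \<noteq> 0" by (simp add: v0)
  from does_While_True[where P = "\<lambda>x. x \<noteq> 0" and v = v and i = 0, OF this does_Seq[OF 1 2] 3]
  show ?case unfolding eq by (rule does_mono) (simp add: v0)
qed

lemma ptime_computable_mult:
  "ptime_computable 2 (\<lambda>ws. Some (concat (replicate (length (ws ! 0)) (ws ! 1))))"
proof (rule ptime_computable_simple[where c = "While 0 (\<lambda>x. x \<noteq> 0) (Seq (pop 0) (prepend 4 1 2))" and r = 2 and fl = 3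
      and p = "[:0, 1:] * [:7, 22:] + [:1:]"
      and v = "\<lambda>ws. (nth_input ws)(0 := [], 2 := concat (replicate (length (ws ! 0)) (ws ! 1)))"])
  fix ws :: "bits list" assume "length ws = 2"
  then obtain x y where ws: "ws = [x, y]" by (auto simp: numeral_2_eq_2 length_Suc_conv)
  have "length x * (22 * length y + 7) \<le> (length x + length y) * (22 * (length x + length y) + 7)"
    by (intro mult_mono) auto
  then show "does (While 0 (\<lambda>x. x \<noteq> 0) (Seq (pop 0) (prepend 4 1 2))) (nth_input ws)
      (poly ([:0, 1:] * [:7, 22:] + [:1:]) (total_length ws))
      ((nth_input ws)(0 := [], 2 := concat (replicate (length (ws ! 0)) (ws ! 1))))"
    by (intro does_cong[OF does_mult]) (auto simp: ws nth_input_def total_length_def fun_eq_iff algebra_simps)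
qed (auto simp: nth_input_def)

definition compare :: com where
  "compare = While 0 (\<lambda>x. x \<noteq> 0)
     (Cond 1 (\<lambda>x. x \<noteq> 0) (Seq (pop 0) (pop 1)) (Seq (clear 0) (push 2 True)))"

lemma does_compare:
  assumes "v 2 = []"
  shows "\<exists>w. does compare v (7 * length (v 0) + 10) (v(0 := [], 1 := w, 2 := if length (v 0) \<le> length (v 1) then [] else [True]))"
  using assms
proof (induction "v 0" arbitrary: v)
  case Nil
  have "v(0 := [], 1 := v 1, 2 := if length (v 0) \<le> length (v 1) then [] else [True]) = v"
    using Nil by (auto simp: fun_eq_iff)
  moreover have "does compare v 1 v"
    unfolding compare_def by (rule does_While_False) (simp add: Nil(1)[symmetric])
  ultimately show ?case using does_mono[of compare v 1 v] by (metis add_leD2 le_add2 one_le_numeral order_trans)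
next
  case (Cons b w)
  have v0: "v 0 = b # w" using Cons.hyps(2) by simp
  have ne: "top_symbol (v 0) \<noteq> 0" by (simp add: v0)
  show ?case
  proof (cases "v 1")
    case Nil
    let ?v = "v(0 := [], 2 := [True])"
    have "does (Seq (clear 0) (push 2 True)) v (1 + (2 * length (v 0) + 1) + 3) ?v"
      by (rule does_cong[OF does_Seq[OF does_clear does_push]]) (use Cons.prems in auto)
    then have 1: "does (Cond 1 (\<lambda>x. x \<noteq> 0) (Seq (pop 0) (pop 1)) (Seq (clear 0) (push 2 True))) v
        (1 + (1 + (2 * length (v 0) + 1) + 3)) ?v"
      by (intro does_Cond) (simp add: Nil del: One_nat_def)
    have 2: "does compare ?v 1 ?v" unfolding compare_def by (rule does_While_False) simp
    have "v(0 := [], 1 := v 1, 2 := if length (v 0) \<le> length (v 1) then [] else [True]) = ?v"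
      by (auto simp: fun_eq_iff Nil v0 simp del: One_nat_def)
    then show ?thesis
      using does_cong[OF does_While_True[where P = "\<lambda>x. x \<noteq> 0" and v = v and i = 0, OF ne 1 2[unfolded compare_def]], folded compare_def, OF _ order_refl]
      by (intro exI[of _ "v 1"]) (auto intro: does_mono)
  next
    case (Cons c u)
    let ?v = "v(0 := w, 1 := u)"
    have "does (Seq (pop 0) (pop 1)) v (1 + 1 + 1) ?v"
      by (rule does_cong[OF does_Seq[OF does_pop does_pop]]) (auto simp: v0 Cons simp del: One_nat_def)
    then have 1: "does (Cond 1 (\<lambda>x. x \<noteq> 0) (Seq (pop 0) (pop 1)) (Seq (clear 0) (push 2 True))) v
        (1 + (1 + 1 + 1)) ?v"
      by (intro does_Cond) (simp add: Cons del: One_nat_def)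
    have "\<exists>w. does compare ?v (7 * length (?v 0) + 10)
        (?v(0 := [], 1 := w, 2 := if length (?v 0) \<le> length (?v 1) then [] else [True]))"
      by (rule Cons.hyps(1)) (use Cons.prems in auto)
    then obtain w' where 2: "does compare ?v (7 * length (?v 0) + 10)
        (?v(0 := [], 1 := w', 2 := if length (?v 0) \<le> length (?v 1) then [] else [True]))" by blast
    have "?v(0 := [], 1 := w', 2 := if length (?v 0) \<le> length (?v 1) then [] else [True]) =
       v(0 := [], 1 := w', 2 := if length (v 0) \<le> length (v 1) then [] else [True])"
      by (auto simp: fun_eq_iff v0 Cons simp del: One_nat_def)
    then show ?thesis
      using does_cong[OF does_While_True[where P = "\<lambda>x. x \<noteq> 0" and v = v and i = 0, OF ne 1 2[unfolded compare_def]], folded compare_def]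
      by (intro exI[of _ w']) (simp add: v0)
  qed
qed

lemma ptime_decidable_length_le: "ptime_decidable 2 (\<lambda>ws. length (ws ! 0) \<le> length (ws ! 1))"
proof (rule ptime_decidable_simple[where c = compare and r = 0 and fl = 3 and i = 2 and p = "[:10, 7:]"
      and P = "\<lambda>x. x = 0"])
  fix ws :: "bits list" assume "length ws = 2"
  then obtain x y where ws: "ws = [x, y]" by (auto simp: numeral_2_eq_2 length_Suc_conv)
  obtain w where w: "does compare (nth_input ws) (7 * length (nth_input ws 0) + 10) ((nth_input ws)(0 := [], 1 := w,
      2 := if length (nth_input ws 0) \<le> length (nth_input ws 1) then [] else [True]))"
    using does_compare[of "nth_input ws"] by (auto simp: ws nth_input_def)
  have "does compare (nth_input ws) (poly [:10, 7:] (total_length ws)) ((nth_input ws)(0 := [], 1 := w,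
      2 := if length (nth_input ws 0) \<le> length (nth_input ws 1) then [] else [True]))"
    by (rule does_mono[OF w]) (simp add: ws nth_input_def total_length_def)
  then show "\<exists>v. does compare (nth_input ws) (poly [:10, 7:] (total_length ws)) v \<and>
      v 3 = [] \<and> v 0 = [] \<and> (top_symbol (v 2) = 0 \<longleftrightarrow> length (ws ! 0) \<le> length (ws ! 1))"
    by (rule exI[rotated, of _ "(nth_input ws)(0 := [], 1 := w,
      2 := if length (nth_input ws 0) \<le> length (nth_input ws 1) then [] else [True])", OF conjI])
       (simp add: ws nth_input_def)
qed (simp_all add: compare_def)

definition match :: com where
  "match = While 0 (\<lambda>x. x \<noteq> 0)
     (Cond 0 (\<lambda>x. x = 2) (Cond 1 (\<lambda>x. x = 2) (Seq (pop 0) (pop 1)) (Seq (clear 0) (set_flag 1)))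
                         (Cond 1 (\<lambda>x. x = 1) (Seq (pop 0) (pop 1)) (Seq (clear 0) (set_flag 1))))"

text \<open>Register 1 carries the verdict: a mismatch leaves a flag there, a word that is longer
  than register 0 leaves its remainder, and only equal words use it up.\<close>

lemma does_match:
  "\<exists>w. does match v (8 * length (v 0) + 2 * length (v 1) + 12) (v(0 := [], 1 := w)) \<and> (w = [] \<longleftrightarrow> v 0 = v 1)"
proof (induction "v 0" arbitrary: v)
  case Nil
  have "v(0 := [], 1 := v 1) = v" using Nil by (auto simp: fun_eq_iff)
  moreover have "does match v 1 v"
    unfolding match_def by (rule does_While_False) (simp add: Nil(1)[symmetric])
  then have "does match v (8 * length (v 0) + 2 * length (v 1) + 12) v" by (rule does_mono) simp
  ultimately show ?case by (intro exI[of _ "v 1"]) (auto simp: Nil[symmetric] simp del: fun_upd_apply)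
next
  case (Cons b w)
  have v0: "v 0 = b # w" using Cons.hyps(2) by simp
  have ne: "top_symbol (v 0) \<noteq> 0" by (simp add: v0)
  let ?c = "if b then Cond 1 (\<lambda>x. x = 2) (Seq (pop 0) (pop 1)) (Seq (clear 0) (set_flag 1))
    else Cond 1 (\<lambda>x. x = 1) (Seq (pop 0) (pop 1)) (Seq (clear 0) (set_flag 1))"
  show ?case
  proof (cases "\<exists>u. v 1 = b # u")
    case False
    let ?v = "v(0 := [], 1 := [True])"
    have f: "does (Seq (clear 0) (set_flag 1)) v (1 + (2 * length (v 0) + 1) + (2 * length (v 1) + 5)) ?v"
      by (rule does_cong[OF does_Seq[OF does_clear does_set_flag]]) auto
    have t: "top_symbol (v 1) \<noteq> (if b then 2 else 1)" using False by (cases "v 1") (auto split: if_splits)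
    have "does ?c v (1 + (1 + (2 * length (v 0) + 1) + (2 * length (v 1) + 5))) ?v"
    proof (cases b)
      case True
      then show ?thesis using f t by (simp only: if_True if_False) (rule does_Cond, simp del: One_nat_def)
    next
      case False
      then show ?thesis using f t by (simp only: if_True if_False) (rule does_Cond, simp del: One_nat_def)
    qed
    then have 1: "does (Cond 0 (\<lambda>x. x = 2) (Cond 1 (\<lambda>x. x = 2) (Seq (pop 0) (pop 1)) (Seq (clear 0) (set_flag 1)))
        (Cond 1 (\<lambda>x. x = 1) (Seq (pop 0) (pop 1)) (Seq (clear 0) (set_flag 1)))) v
        (1 + (1 + (1 + (2 * length (v 0) + 1) + (2 * length (v 1) + 5)))) ?v"
      by - (rule does_Cond, cases b; simp add: v0 del: One_nat_def)
    have 2: "does match ?v 1 ?v" unfolding match_def by (rule does_While_False) simp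
    have "v 0 \<noteq> v 1" using False v0 by metis
    with does_cong[OF does_While_True[where P = "\<lambda>x. x \<noteq> 0" and v = v and i = 0, OF ne 1 2[unfolded match_def]], folded match_def, OF refl]
    show ?thesis by (intro exI[of _ "[True]"]) simp
  next
    case True
    then obtain u where u: "v 1 = b # u" by blast
    let ?v = "v(0 := w, 1 := u)"
    have f: "does (Seq (pop 0) (pop 1)) v (1 + 1 + 1) ?v"
      by (rule does_cong[OF does_Seq[OF does_pop does_pop]]) (auto simp: v0 u simp del: One_nat_def)
    have t: "top_symbol (v 1) = (if b then 2 else 1)" by (simp add: u del: One_nat_def)
    have "does ?c v (1 + (1 + 1 + 1)) ?v"
    proof (cases b)
      case True
      then show ?thesis using f t by (simp only: if_True if_False) (rule does_Cond, simp del: One_nat_def)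
    next
      case False
      then show ?thesis using f t by (simp only: if_True if_False) (rule does_Cond, simp del: One_nat_def)
    qed
    then have 1: "does (Cond 0 (\<lambda>x. x = 2) (Cond 1 (\<lambda>x. x = 2) (Seq (pop 0) (pop 1)) (Seq (clear 0) (set_flag 1)))
        (Cond 1 (\<lambda>x. x = 1) (Seq (pop 0) (pop 1)) (Seq (clear 0) (set_flag 1)))) v
        (1 + (1 + (1 + 1 + 1))) ?v"
      by - (rule does_Cond, cases b; simp add: v0 del: One_nat_def)
    obtain w' where 2: "does match ?v (8 * length (?v 0) + 2 * length (?v 1) + 12) (?v(0 := [], 1 := w'))"
      "w' = [] \<longleftrightarrow> ?v 0 = ?v 1" using Cons.hyps(1)[of ?v] by auto
    have "?v(0 := [], 1 := w') = v(0 := [], 1 := w')" by (auto simp: fun_eq_iff)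
    with does_cong[OF does_While_True[where P = "\<lambda>x. x \<noteq> 0" and v = v and i = 0, OF ne 1 2(1)[unfolded match_def]], folded match_def]
    have "does match v (8 * length (v 0) + 2 * length (v 1) + 12) (v(0 := [], 1 := w'))"
      by (simp add: v0 u del: One_nat_def)
    then show ?thesis using 2(2) v0 u by (intro exI[of _ w']) simp
  qed
qed

lemma ptime_decidable_eq: "ptime_decidable 2 (\<lambda>ws. ws ! 0 = ws ! 1)"
proof (rule ptime_decidable_simple[where c = match and r = 0 and fl = 3 and i = 1 and p = "[:12, 10:]"
      and P = "\<lambda>x. x = 0"])
  fix ws :: "bits list" assume "length ws = 2"
  then obtain x y where ws: "ws = [x, y]" by (auto simp: numeral_2_eq_2 length_Suc_conv)
  obtain w where w: "does match (nth_input ws) (8 * length (nth_input ws 0) + 2 * length (nth_input ws 1) + 12)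
      ((nth_input ws)(0 := [], 1 := w))" "w = [] \<longleftrightarrow> nth_input ws 0 = nth_input ws 1"
    using does_match[of "nth_input ws"] by blast
  have "does match (nth_input ws) (poly [:12, 10:] (total_length ws)) ((nth_input ws)(0 := [], 1 := w))"
    by (rule does_mono[OF w(1)]) (simp add: ws nth_input_def total_length_def)
  then show "\<exists>v. does match (nth_input ws) (poly [:12, 10:] (total_length ws)) v \<and>
      v 3 = [] \<and> v 0 = [] \<and> (top_symbol (v 1) = 0 \<longleftrightarrow> ws ! 0 = ws ! 1)"
    using w(2) by (intro exI[of _ "(nth_input ws)(0 := [], 1 := w)"]) (simp add: ws nth_input_def)
qed (simp_all add: match_def)

section \<open>Combinations\<close>

lemma total_comp1:
  assumes "ptime_computable 1 (\<lambda>ws. Some (h (ws ! 0)))" "ptime_computable n (\<lambda>ws. Some (g ws))"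
  shows "ptime_computable n (\<lambda>ws. Some (h (g ws)))"
  using ptime_computable_comp1[OF assms] by simp

lemma total_comp2:
  assumes "ptime_computable 2 (\<lambda>ws. Some (h (ws ! 0) (ws ! 1)))"
    and "ptime_computable n (\<lambda>ws. Some (g ws))" "ptime_computable n (\<lambda>ws. Some (g' ws))"
  shows "ptime_computable n (\<lambda>ws. Some (h (g ws) (g' ws)))"
  using ptime_computable_comp2[OF assms] by simp

lemma decidable_comp1:
  assumes "ptime_decidable 1 (\<lambda>ws. A (ws ! 0))" "ptime_computable n (\<lambda>ws. Some (g ws))"
  shows "ptime_decidable n (\<lambda>ws. A (g ws))"
  using ptime_computable_comp1[OF assms(1)[unfolded ptime_decidable_iff] assms(2)]
  by (simp add: ptime_decidable_iff)

lemma decidable_comp2: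
  assumes "ptime_decidable 2 (\<lambda>ws. A (ws ! 0) (ws ! 1))"
    and "ptime_computable n (\<lambda>ws. Some (g ws))" "ptime_computable n (\<lambda>ws. Some (g' ws))"
  shows "ptime_decidable n (\<lambda>ws. A (g ws) (g' ws))"
  using ptime_computable_comp2[OF assms(1)[unfolded ptime_decidable_iff] assms(2,3)]
  by (simp add: ptime_decidable_iff)

lemma decidable_conj:
  assumes "ptime_decidable n A" "ptime_decidable n B"
  shows "ptime_decidable n (\<lambda>ws. A ws \<and> B ws)"
proof -
  have eq: "(\<lambda>ws. if A ws \<and> B ws then Some [] else None) =
      (\<lambda>ws. if A ws then if B ws then Some [] else None else None)" by auto
  show ?thesis unfolding ptime_decidable_iff eq
    using ptime_computable_if[OF assms(1) assms(2)[unfolded ptime_decidable_iff] ptime_computable_None]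
    by (simp add: ptime_decidable_iff)
qed

lemma decidable_not:
  assumes "ptime_decidable n A"
  shows "ptime_decidable n (\<lambda>ws. \<not> A ws)"
proof -
  have eq: "(\<lambda>ws. if \<not> A ws then Some [] else None) = (\<lambda>ws. if A ws then None else Some [])" by auto
  show ?thesis unfolding ptime_decidable_iff eq
    using ptime_computable_if[OF assms ptime_computable_None ptime_computable_const[of n "[]"]]
    by (simp add: ptime_decidable_iff)
qed

lemma total_if:
  assumes "ptime_decidable n A" "ptime_computable n (\<lambda>ws. Some (f ws))" "ptime_computable n (\<lambda>ws. Some (g ws))"
  shows "ptime_computable n (\<lambda>ws. Some (if A ws then f ws else g ws))"
  using ptime_computable_if[OF assms] by (simp add: if_distrib[of Some])

lemma decidable_eq:
  assumes "ptime_computable n (\<lambda>ws. Some (f ws))" "ptime_computable n (\<lambda>ws. Some (g ws))"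
  shows "ptime_decidable n (\<lambda>ws. f ws = g ws)"
  by (rule decidable_comp2[OF ptime_decidable_eq assms])

lemma decidable_let:
  assumes "ptime_computable n g" "ptime_decidable (Suc n) A"
  shows "ptime_decidable n (\<lambda>ws. \<exists>y. g ws = Some y \<and> A (ws @ [y]))"
proof -
  have eq: "(\<lambda>ws. if \<exists>y. g ws = Some y \<and> A (ws @ [y]) then Some [] else None) =
    (\<lambda>ws. case g ws of None \<Rightarrow> None | Some y \<Rightarrow> if A (ws @ [y]) then Some [] else None)"
    by (auto split: option.split)
  show ?thesis unfolding ptime_decidable_iff eq
    using ptime_computable_let[OF assms(1) assms(2)[unfolded ptime_decidable_iff]]
    by (simp add: ptime_decidable_iff)
qed

text \<open>Horner's scheme in unary: concatenation adds lengths and repeated copying multiplies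
  them. Such strings serve as yardsticks for polynomial length bounds.\<close>

lemma unary_poly:
  "\<exists>h. ptime_computable 1 (\<lambda>ws. Some (h (ws ! 0))) \<and> (\<forall>x. length (h x) = poly (p :: nat poly) (length x))"
proof (induction p)
  case 0
  show ?case using ptime_computable_const[of 1 "[]"] by (intro exI[of _ "\<lambda>_. []"]) simp
next
  case (pCons a p)
  then obtain h where h: "ptime_computable 1 (\<lambda>ws. Some (h (ws ! 0)))" "\<forall>x. length (h x) = poly p (length x)"
    by blast
  let ?h = "\<lambda>x. replicate a True @ concat (replicate (length x) (h x))"
  have id: "ptime_computable 1 (\<lambda>ws. Some (ws ! 0))" by (rule ptime_computable_nth) simp
  have "ptime_computable 1 (\<lambda>ws. Some (?h (ws ! 0)))"
    by (rule total_comp2[where h = "(@)", OF ptime_computable_append ptime_computable_const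
        total_comp2[where h = "\<lambda>x y. concat (replicate (length x) y)", OF ptime_computable_mult id h(1)]])
  moreover have "length (?h x) = poly (pCons a p) (length x)" for x
    using h(2) by (simp add: length_concat sum_list_replicate)
  ultimately show ?case by (intro exI[of _ ?h] conjI allI)
qed

lemma decidable_length_le_poly:
  assumes "ptime_computable n (\<lambda>ws. Some (f ws))" "ptime_computable n (\<lambda>ws. Some (g ws))"
  shows "ptime_decidable n (\<lambda>ws. length (f ws) \<le> poly p (length (g ws)))"
proof -
  obtain h where h: "ptime_computable 1 (\<lambda>ws. Some (h (ws ! 0)))" "\<forall>x. length (h x) = poly p (length x)"
    using unary_poly by blast
  from decidable_comp2[where A = "\<lambda>x y. length x \<le> length y", OF ptime_decidable_length_le assms(1) total_comp1[OF h(1) assms(2)]]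
  show ?thesis by (simp add: h(2))
qed

section \<open>Inverting one-way functions if P = NP\<close>

lemma ptime_decidable_cong:
  "(\<And>ws. length ws = n \<Longrightarrow> A ws = B ws) \<Longrightarrow> ptime_decidable n A \<longleftrightarrow> ptime_decidable n B"
  unfolding ptime_decidable_def by simp

locale pairing =
  fixes pair :: "bits \<times> bits \<Rightarrow> bits"
  assumes pairing: "standard_pairing pair"
begin

definition left :: "bits \<Rightarrow> bits" where "left w = fst (inv pair w)"
definition right :: "bits \<Rightarrow> bits" where "right w = snd (inv pair w)"

lemma bij_pair: "bij pair"
  using pairing by (simp add: standard_pairing_def)

lemma left_pair [simp]: "left (pair (x, y)) = x" and right_pair [simp]: "right (pair (x, y)) = y"
  by (simp_all add: left_def right_def bij_is_inj[OF bij_pair])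

lemma pair_left_right [simp]: "pair (left w, right w) = w"
  by (simp add: left_def right_def bij_is_surj[OF bij_pair] surj_f_inv_f)

lemma ptime_pair0: "ptime_computable 2 (\<lambda>ws. Some (pair (ws ! 0, ws ! 1)))"
  and ptime_left0: "ptime_computable 1 (\<lambda>ws. Some (left (ws ! 0)))"
  and ptime_right0: "ptime_computable 1 (\<lambda>ws. Some (right (ws ! 0)))"
  using pairing by (simp_all add: standard_pairing_def FP1_def FP2_def left_def right_def)

lemmas ptime_pair = total_comp2[where h = "\<lambda>x y. pair (x, y)", OF ptime_pair0]
lemmas ptime_left = total_comp1[OF ptime_left0]
lemmas ptime_right = total_comp1[OF ptime_right0]

lemma length_pair: "\<exists>P :: nat poly. \<forall>x y. length (pair (x, y)) \<le> poly P (length x + length y)"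
proof -
  obtain P :: "nat poly" where P: "\<And>ws w. length ws = 2 \<Longrightarrow> Some (pair (ws ! 0, ws ! 1)) = Some w \<Longrightarrow> length w \<le> poly P (total_length ws)"
    using ptime_computable_length[OF ptime_pair0] by blast
  have "length (pair (x, y)) \<le> poly P (length x + length y)" for x y
    using P[of "[x, y]"] by (simp add: total_length_def)
  then show ?thesis by blast
qed

lemma length_left_right:
  "\<exists>P :: nat poly. \<forall>w. length (left w) \<le> poly P (length w) \<and> length (right w) \<le> poly P (length w)"
proof -
  obtain P :: "nat poly" where P: "\<And>ws w. length ws = 1 \<Longrightarrow> Some (left (ws ! 0)) = Some w \<Longrightarrow> length w \<le> poly P (total_length ws)"
    using ptime_computable_length[OF ptime_left0] by blast
  obtain Q :: "nat poly" where Q: "\<And>ws w. length ws = 1 \<Longrightarrow> Some (right (ws ! 0)) = Some w \<Longrightarrow> length w \<le> poly Q (total_length ws)"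
    using ptime_computable_length[OF ptime_right0] by blast
  have "length (left w) \<le> poly (P + Q) (length w) \<and> length (right w) \<le> poly (P + Q) (length w)" for w
    using P[of "[w]"] Q[of "[w]"] by (simp add: total_length_def trans_le_add1 trans_le_add2)
  then show ?thesis by blast
qed

text \<open>Search reduces to decision because extendability of a prefix is itself an NP question.
  The bound \<open>q\<close> is used twice: it makes the completions short certificates, and it
  limits the number of rounds.\<close>

lemma prefix_search:
  assumes eq: "class_P = class_NP" and V: "ptime_decidable 2 (\<lambda>ws. V (ws ! 0) (ws ! 1))"
    and q: "\<And>z u. V z u \<Longrightarrow> length u \<le> poly q (length z)"
  shows "\<exists>f. FP1 f \<and> (\<forall>z u. V z u \<longrightarrow> (\<exists>u. f z = Some u)) \<and> (\<forall>z u. f z = Some u \<longrightarrow> V z u)"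
proof -
  obtain PP where PP: "\<And>x y. length (pair (x, y)) \<le> poly PP (length x + length y)"
    using length_pair by blast
  obtain Q where Q: "\<And>w. length (left w) \<le> poly Q (length w)" "\<And>w. length (right w) \<le> poly Q (length w)"
    using length_left_right by blast
  have nth: "ptime_computable 2 (\<lambda>ws. Some (ws ! 0))" "ptime_computable 2 (\<lambda>ws. Some (ws ! 1))"
    "ptime_computable 1 (\<lambda>ws. Some (ws ! 0))"
    by (simp_all add: ptime_computable_nth)
  note append = total_comp2[where h = "(@)", OF ptime_computable_append]
  note V' = decidable_comp2[OF V]
  define A where "A = {x. \<exists>u. V (left x) (right x @ u)}"
  have "A \<in> class_NP"
    unfolding class_NP_def mem_Collect_eq
  proof (intro exI conjI allI)
    show "ptime_decidable 2 (\<lambda>ws. V (left (ws ! 0)) (right (ws ! 0) @ ws ! 1))"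
      by (intro V' append ptime_left ptime_right nth)
    fix x
    have "length u \<le> poly (pcompose q Q) (length x)" if "V (left x) (right x @ u)" for u
    proof -
      have "length u \<le> poly q (length (left x))" using q[OF that] by simp
      also have "\<dots> \<le> poly q (poly Q (length x))" by (rule poly_mono_nat) (rule Q)
      finally show ?thesis by (simp add: poly_pcompose)
    qed
    then show "x \<in> A \<longleftrightarrow> (\<exists>u. length u \<le> poly (pcompose q Q) (length x) \<and> V (left x) (right x @ u))"
      unfolding A_def by blast
  qed
  then have A: "ptime_decidable 1 (\<lambda>ws. ws ! 0 \<in> A)"
    using eq by (auto simp: class_P_def)
  note A' = decidable_comp1[where A = "\<lambda>x. x \<in> A", OF A]
  \<comment> \<open>The search goes on while the prefix is extendable but not yet a solution. A
    string outside \<open>A\<close> stops it at once, so it also ends on instances without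
    solutions.\<close>
  define S where "S x \<longleftrightarrow> x \<in> A \<and> \<not> V (left x) (right x)" for x
  define g where "g x = pair (left x, right x @ (if pair (left x, right x @ [True]) \<in> A then [True] else [False]))" for x
  have ptS: "ptime_decidable 1 (\<lambda>ws. S (ws ! 0))"
    unfolding S_def by (intro decidable_conj decidable_not A V' ptime_left ptime_right nth)
  have ptg: "ptime_computable 1 (\<lambda>ws. Some (g (ws ! 0)))"
    unfolding g_def
    by (intro ptime_pair append total_if A' ptime_left ptime_right nth ptime_computable_const)
  \<comment> \<open>The instance stays fixed and the prefix gains one bit per round, so after
    \<open>poly q (length (left w)) + 1\<close> rounds it is too long to be extendable.\<close>
  have lr: "left ((g ^^ i) w) = left w \<and> length (right ((g ^^ i) w)) = length (right w) + i" for i w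
    by (induction i) (auto simp: g_def)
  define n where "n w = (LEAST i. \<not> S ((g ^^ i) w))" for w
  define F where "F w = (g ^^ n w) w" for w
  have n: "n w \<le> poly q (length (left w)) + 1" "\<not> S ((g ^^ n w) w)" "\<And>i. i < n w \<Longrightarrow> S ((g ^^ i) w)" for w
  proof -
    let ?N = "poly q (length (left w)) + 1"
    have "\<not> S ((g ^^ ?N) w)"
    proof
      assume "S ((g ^^ ?N) w)"
      then obtain u where "V (left w) (right ((g ^^ ?N) w) @ u)" using lr[of ?N w] by (auto simp: S_def A_def)
      from q[OF this] show False using lr[of ?N w] by simp
    qed
    note Least = Least_le[of "\<lambda>i. \<not> S ((g ^^ i) w)", OF this] LeastI[of "\<lambda>i. \<not> S ((g ^^ i) w)", OF this]
    show "n w \<le> ?N" "\<not> S ((g ^^ n w) w)" using Least unfolding n_def by blast+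
    show "\<And>i. i < n w \<Longrightarrow> S ((g ^^ i) w)" unfolding n_def by (blast dest: not_less_Least)
  qed
  \<comment> \<open>An intermediate value codes the instance and the initial prefix with one bit per
    round added; \<open>PP\<close> bounds the code, and the other summands bound the number of
    rounds.\<close>
  define P where "P = pcompose PP (Q + Q + pcompose q Q + 1) + pcompose q Q + 1"
  have ptF: "ptime_computable 1 (\<lambda>ws. Some (F (ws ! 0)))"
  proof (rule ptime_computable_iterate[OF ptS ptg, where P = P])
    fix w :: bits
    let ?l = "length w"
    have nw: "n w \<le> poly q (poly Q ?l) + 1"
      using n(1)[of w] poly_mono_nat[OF Q(1)[of w], of q] by linarith
    have "length ((g ^^ i) w) \<le> poly P ?l" if "i \<le> n w" for i
    proof -
      have "length ((g ^^ i) w) = length (pair (left ((g ^^ i) w), right ((g ^^ i) w)))" by simp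
      also have "\<dots> \<le> poly PP (length (left w) + (length (right w) + i))"
        using PP[of "left ((g ^^ i) w)" "right ((g ^^ i) w)"] lr[of i w] by simp
      also have "\<dots> \<le> poly PP (poly Q ?l + poly Q ?l + poly q (poly Q ?l) + 1)"
        by (rule poly_mono_nat) (use Q[of w] nw that in linarith)
      finally show ?thesis by (simp add: P_def poly_pcompose)
    qed
    moreover have "n w \<le> poly P ?l" using nw by (simp add: P_def poly_pcompose)
    ultimately show "\<exists>n\<le>poly P ?l. (\<forall>i<n. S ((g ^^ i) w)) \<and> \<not> S ((g ^^ n) w) \<and> F w = (g ^^ n) w \<and>
        (\<forall>i\<le>n. length ((g ^^ i) w) \<le> poly P ?l)"
      using n(2)[of w] n(3)[of _ w] by (intro exI[of _ "n w"]) (simp add: F_def)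
  qed
  \<comment> \<open>The result is verified again, because the search returns some string even if
    there is no solution.\<close>
  define f where "f z = (if V z (right (F (pair (z, [])))) then Some (right (F (pair (z, [])))) else None)" for z
  have ptr: "ptime_computable 1 (\<lambda>ws. Some (right (F (pair (ws ! 0, [])))))"
    by (intro ptime_right total_comp1[OF ptF] ptime_pair nth ptime_computable_const)
  have "FP1 f"
    unfolding FP1_def f_def by (intro ptime_computable_if V' ptr nth ptime_computable_None)
  moreover have "\<exists>u. f z = Some u" if "V z u" for z u
  proof -
    let ?w = "pair (z, [])"
    \<comment> \<open>A completion of an unfinished prefix is nonempty, and its first bit gives a
      longer extendable prefix. If appending \<open>True\<close> fails, this bit is
      \<open>False\<close>.\<close>
    have step: "g x \<in> A" if x: "S x" for x
    proof -
      from x obtain u where u: "V (left x) (right x @ u)" "\<not> V (left x) (right x)"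
        by (auto simp: S_def A_def)
      then obtain b u' where "u = b # u'" by (cases u) auto
      then show ?thesis using u(1) by (cases b) (auto simp: g_def A_def)
    qed
    have inA: "(g ^^ i) ?w \<in> A" if "i \<le> n ?w" for i
      using that
    proof (induction i)
      case 0
      then show ?case using \<open>V z u\<close> by (auto simp: A_def)
    next
      case (Suc i)
      then show ?case using step[OF n(3)[of i ?w]] by simp
    qed
    from inA[of "n ?w"] n(2)[of ?w] have "V z (right (F ?w))"
      using lr[of "n ?w" ?w] by (auto simp: S_def F_def)
    then show ?thesis by (simp add: f_def)
  qed
  moreover have "V z u" if "f z = Some u" for z u
    using that by (auto simp: f_def split: if_splits)
  ultimately show ?thesis by blast
qed

lemma ptime_computable_pair_inv:
  assumes "FP2 \<sigma>" "ptime_computable n (\<lambda>ws. Some (f ws))" "ptime_computable n (\<lambda>ws. Some (g ws))"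
  shows "ptime_computable n (\<lambda>ws. \<sigma> (f ws, g ws))"
  using ptime_computable_comp2[OF assms(1)[unfolded FP2_def] assms(2,3)] by simp

text \<open>Honesty provides, for each value, a preimage with a polynomially short code. Such codes
  are the solutions of a decidable relation, to which the search applies.\<close>

lemma invertible_if_P_eq_NP:
  assumes eq: "class_P = class_NP" and "FP2 \<sigma>" "honest \<sigma>"
  shows "\<not> noninvertible pair \<sigma>"
proof -
  obtain p where p: "\<forall>z \<in> ran \<sigma>. \<exists>x y. \<sigma> (x, y) = Some z \<and> length x + length y \<le> poly p (length z)"
    using assms(3) unfolding honest_def by blast
  obtain PP where PP: "\<And>x y. length (pair (x, y)) \<le> poly PP (length x + length y)"
    using length_pair by blast
  define V where "V z u \<longleftrightarrow> length u \<le> poly (pcompose PP p) (length z) \<and> \<sigma> (left u, right u) = Some z" for z u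
  have nth: "ptime_computable 2 (\<lambda>ws. Some (ws ! 0))" "ptime_computable 2 (\<lambda>ws. Some (ws ! 1))"
    by (simp_all add: ptime_computable_nth)
  have "ptime_computable 2 (\<lambda>ws. \<sigma> (left (ws ! 1), right (ws ! 1)))"
    by (intro ptime_computable_pair_inv assms(2) ptime_left ptime_right nth)
  moreover have "ptime_decidable (Suc 2) (\<lambda>ws. ws ! 2 = ws ! 0)"
    by (intro decidable_eq ptime_computable_nth) auto
  ultimately have "ptime_decidable 2 (\<lambda>ws. \<exists>y. \<sigma> (left (ws ! 1), right (ws ! 1)) = Some y \<and> (ws @ [y]) ! 2 = (ws @ [y]) ! 0)"
    by (rule decidable_let)
  then have "ptime_decidable 2 (\<lambda>ws. \<sigma> (left (ws ! 1), right (ws ! 1)) = Some (ws ! 0))"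
    by (subst (asm) ptime_decidable_cong[where B = "\<lambda>ws. \<sigma> (left (ws ! 1), right (ws ! 1)) = Some (ws ! 0)"])
       (auto simp: nth_append)
  then have "ptime_decidable 2 (\<lambda>ws. V (ws ! 0) (ws ! 1))"
    unfolding V_def by (intro decidable_conj decidable_length_le_poly nth)
  from prefix_search[OF eq this, of "pcompose PP p"] obtain f where
    f: "FP1 f" "\<And>z u. V z u \<Longrightarrow> \<exists>u. f z = Some u" "\<And>z u. f z = Some u \<Longrightarrow> V z u"
    by (auto simp: V_def)
  \<comment> \<open>An inverter has pairs as values; decoding the string that was found and encoding
    it again changes nothing.\<close>
  have "(\<lambda>z. map_option pair (map_option (inv pair) (f z))) = f"
    by (simp add: option.map_comp comp_def bij_is_surj[OF bij_pair] surj_f_inv_f option.map_ident)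
  moreover have "(\<sigma> \<circ>\<^sub>m (\<lambda>z. map_option (inv pair) (f z))) z = Some z" if z: "z \<in> ran \<sigma>" for z
  proof -
    obtain x y where xy: "\<sigma> (x, y) = Some z" "length x + length y \<le> poly p (length z)"
      using p z by blast
    have "length (pair (x, y)) \<le> poly PP (poly p (length z))"
      using PP[of x y] poly_mono_nat[OF xy(2), of PP] by linarith
    then have "V z (pair (x, y))" using xy by (simp add: V_def poly_pcompose)
    then obtain u where u: "f z = Some u" using f(2) by blast
    from f(3)[OF this] show ?thesis by (simp add: V_def u left_def right_def)
  qed
  ultimately show ?thesis
    unfolding noninvertible_def not_not using f(1) by (intro exI[of _ "\<lambda>z. map_option (inv pair) (f z)"]) simp
qed

end

section \<open>One-way functions if P is different from NP\<close>

lemma P_subset_NP: "class_P \<subseteq> class_NP"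
proof
  fix L assume "L \<in> class_P"
  then have L: "ptime_decidable 1 (\<lambda>ws. ws ! 0 \<in> L)" by (simp add: class_P_def)
  have "ptime_decidable 2 (\<lambda>ws. ws ! 0 \<in> L)"
    by (rule decidable_comp1[where A = "\<lambda>x. x \<in> L", OF L]) (simp add: ptime_computable_nth)
  then show "L \<in> class_NP"
    unfolding class_NP_def mem_Collect_eq by (intro exI[of _ "\<lambda>x u. x \<in> L"] exI[of _ 0]) auto
qed

section \<open>Products with finitely many exceptions\<close>

type_synonym table = "((bits \<times> bits) \<times> bits) list"

lemma ptime_computable_table:
  assumes "ptime_computable n (\<lambda>ws. Some (f ws))" "ptime_computable n (\<lambda>ws. Some (g ws))" "ptime_computable n d"
  shows "ptime_computable n (\<lambda>ws. case map_of (D :: table) (f ws, g ws) of None \<Rightarrow> d ws | Some w \<Rightarrow> Some w)"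
proof (induction D)
  case Nil
  then show ?case using assms(3) by simp
next
  case (Cons e D)
  obtain x y w where e: "e = ((x, y), w)" by (metis surj_pair)
  have "ptime_decidable n (\<lambda>ws. f ws = x \<and> g ws = y)"
    by (intro decidable_conj decidable_eq assms ptime_computable_const)
  from ptime_computable_if[OF this ptime_computable_const Cons, of w] show ?case
    by (rule ptime_computable_cong[THEN iffD1, rotated]) (auto simp: e)
qed

context pairing
begin

text \<open>
  The string \<open>True # pair (x, u)\<close> encodes an instance with a witness, and \<open>False # False # x\<close> encodes an
  instance.
\<close>

definition valid :: "(bits \<Rightarrow> bits \<Rightarrow> bool) \<Rightarrow> bits \<Rightarrow> bool" where
  "valid V a \<longleftrightarrow> (\<exists>w. a = True # w) \<and> V (left (tl a)) (right (tl a))"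

definition \<rho> :: "(bits \<Rightarrow> bits \<Rightarrow> bool) \<Rightarrow> table \<Rightarrow> bits option \<Rightarrow> (bits \<times> bits \<rightharpoonup> bits)" where
  "\<rho> V D d = (\<lambda>(a, b). if a = b \<and> valid V a then Some (False # False # left (tl a))
     else case map_of D (a, b) of None \<Rightarrow> d | Some w \<Rightarrow> Some w)"

text \<open>Three strings that are neither witness codes nor instance codes nor the default
  \<open>[]\<close>, as they start with \<open>False\<close> but do not continue with a second
  \<open>False\<close>.\<close>

definition P0 :: bits where "P0 = [False]"
definition Q0 :: bits where "Q0 = [False, True]"
definition R0 :: bits where "R0 = [False, True, True]"

text \<open>The arguments are the wanted commutativity and associativity. Commutativity alone fails
  because \<open>P0\<close> times \<open>Q0\<close> is \<open>R0\<close> but \<open>Q0\<close> times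
  \<open>P0\<close> is the default; every product with \<open>R0\<close> is the default, so
  associativity survives. It alone fails by two squares: the triple \<open>P0\<close>,
  \<open>P0\<close>, \<open>Q0\<close> gives \<open>P0\<close> if bracketed to the left and the
  default otherwise. Both fail if \<open>P0\<close> times \<open>Q0\<close> is \<open>P0\<close>, by
  the triple \<open>P0\<close>, \<open>Q0\<close>, \<open>Q0\<close>.\<close>

fun table :: "bool \<Rightarrow> bool \<Rightarrow> table" where
  "table True True = []"
| "table False True = [((P0, Q0), R0)]"
| "table True False = [((P0, P0), Q0), ((Q0, Q0), P0)]"
| "table False False = [((P0, Q0), P0)]"

text \<open>The same tables solved for the second factor: a key consists of first factor and
  product.\<close>

fun quotients :: "bool \<Rightarrow> bool \<Rightarrow> table" where
  "quotients True True = []"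
| "quotients False True = [((P0, R0), Q0)]"
| "quotients True False = [((P0, Q0), P0), ((Q0, P0), Q0)]"
| "quotients False False = [((P0, P0), Q0)]"

definition default :: "bool \<Rightarrow> bits option" where
  "default t = (if t then Some [] else None)"

lemmas const_defs = P0_def Q0_def R0_def default_def

lemma \<rho>_simp: "\<rho> V D d (a, b) = (if a = b \<and> valid V a then Some (False # False # left (tl a))
     else case map_of D (a, b) of None \<Rightarrow> d | Some w \<Rightarrow> Some w)"
  by (simp add: \<rho>_def)

lemma \<rho>_valid: "valid V a \<Longrightarrow> \<rho> V D d (a, a) = Some (False # False # left (tl a))"
  by (simp add: \<rho>_simp)

lemma not_valid [simp]: "\<not> valid V []" "\<not> valid V (False # w)"
  by (auto simp: valid_def)

section \<open>Totality, commutativity, associativity and division\<close>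

lemma total_\<rho>: "total_function (\<rho> V (table c a) (default t)) \<longleftrightarrow> t"
proof (cases t)
  case True
  then show ?thesis by (auto simp: total_function_def \<rho>_simp default_def split: option.split)
next
  case False
  have "\<rho> V (table c a) (default t) ([], []) = None"
    using False by (cases c; cases a) (simp_all add: \<rho>_simp const_defs)
  then show ?thesis using False by (auto simp: total_function_def dom_def set_eq_iff)
qed

lemma commutative_\<rho>: "commutative (\<rho> V (table c a) (default t)) \<longleftrightarrow> c"
proof (cases c)
  case True
  then show ?thesis by (cases a) (auto simp: commutative_def \<rho>_simp const_defs)
next
  case False
  have "\<rho> V (table c a) (default t) (P0, Q0) \<noteq> \<rho> V (table c a) (default t) (Q0, P0)"
    using False by (cases a) (auto simp: \<rho>_simp const_defs)
  then show ?thesis using False by (metis commutative_def extension.simps(1))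
qed

lemma associative_\<rho>: "associative (\<rho> V (table c a) (default t)) \<longleftrightarrow> a"
proof (cases a)
  case False
  let ?e = "extension (\<rho> V (table c a) (default t))"
  have "?e (?e (Some P0) (Some (if c then P0 else Q0))) (Some Q0) = Some P0"
    "?e (Some P0) (?e (Some (if c then P0 else Q0)) (Some Q0)) \<noteq> Some P0"
    using False by (cases c; cases t; simp add: \<rho>_simp const_defs)+
  then show ?thesis using False unfolding associative_def by metis
next
  case True
  let ?\<rho> = "\<rho> V (table c a) (default t)"
  have out: "w = [] \<or> w = R0 \<or> (\<exists>x. w = False # False # x)" if "?\<rho> (x, y) = Some w" for x y w
    using that True by (cases c) (auto simp: \<rho>_simp default_def split: if_splits)
  \<comment> \<open>No product is a witness code or a factor in the table, so multiplying it once
    more gives the default. Both bracketings of a triple therefore agree.\<close>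
  have absorb: "?\<rho> (w, y) = default t" "?\<rho> (y, w) = default t" if "w = [] \<or> w = R0 \<or> (\<exists>x. w = False # False # x)" for w y
    using that True by (cases c; auto simp: \<rho>_simp const_defs)+
  have "extension ?\<rho> (?\<rho> (x, y)) (Some z) = (if ?\<rho> (x, y) = None then None else default t)" for x y z
    using absorb(1)[OF out] by (cases "?\<rho> (x, y)") simp_all
  moreover have "extension ?\<rho> (Some x) (?\<rho> (y, z)) = (if ?\<rho> (y, z) = None then None else default t)" for x y z
    using absorb(2)[OF out] by (cases "?\<rho> (y, z)") simp_all
  \<comment> \<open>If the product is total, the first case never occurs; otherwise the default is
    \<open>None\<close> itself.\<close>
  moreover have "(if ?\<rho> (x, y) = None then None else default t) = default t" for x y
    by (cases t) (auto simp: \<rho>_simp default_def split: option.split)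
  ultimately show ?thesis using True by (simp add: associative_def)
qed

text \<open>A product that is an instance code comes from a square, so the given factor is also the
  missing one. Table entries are looked up. Every other product is the default, which the second
  factor \<open>[]\<close> produces.\<close>

lemma invertible_\<rho>: "invertible_fst pair (\<rho> V (table c a) (default t))"
  unfolding invertible_fst_def
proof (intro exI[of _ "\<lambda>w. if \<exists>x. right w = False # False # x then Some (left w) else
     case map_of (quotients c a) (left w, right w) of None \<Rightarrow> Some [] | Some y \<Rightarrow> Some y"] conjI allI impI)
  have nth: "ptime_computable 1 (\<lambda>ws. Some (ws ! 0))" by (simp add: ptime_computable_nth)
  have eq: "(\<exists>x. w = False # False # x) \<longleftrightarrow> w = False # False # tl (tl w)" for w by auto
  show "FP1 (\<lambda>w. if \<exists>x. right w = False # False # x then Some (left w) else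
     case map_of (quotients c a) (left w, right w) of None \<Rightarrow> Some [] | Some y \<Rightarrow> Some y)"
    unfolding FP1_def eq
    by (intro ptime_computable_if ptime_computable_table decidable_eq ptime_left ptime_right nth
        ptime_computable_const total_comp1[OF ptime_computable_Cons] total_comp1[OF ptime_computable_tl])
next
  fix x y z assume z: "\<rho> V (table c a) (default t) (x, y) = Some z"
  show "\<exists>w. (if \<exists>u. right (pair (x, z)) = False # False # u then Some (left (pair (x, z))) else
     case map_of (quotients c a) (left (pair (x, z)), right (pair (x, z))) of None \<Rightarrow> Some [] | Some y \<Rightarrow> Some y) = Some w \<and>
     \<rho> V (table c a) (default t) (x, w) = Some z"
  proof (cases "x = y \<and> valid V x")
    case True
    then show ?thesis using z by (auto simp: \<rho>_simp)
  next
    case False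
    then show ?thesis using z by (cases c; cases a) (auto simp: \<rho>_simp const_defs split: if_splits)
  qed
qed

section \<open>Complexity of the product\<close>

lemma ptime_valid:
  assumes "ptime_decidable 2 (\<lambda>ws. V (ws ! 0) (ws ! 1))" "ptime_computable n (\<lambda>ws. Some (f ws))"
  shows "ptime_decidable n (\<lambda>ws. valid V (f ws))"
  unfolding valid_def
  by (intro decidable_conj decidable_comp2[OF assms(1)] decidable_comp1[where A = "\<lambda>x. \<exists>w. x = True # w", OF ptime_decidable_hd]
       ptime_left ptime_right total_comp1[OF ptime_computable_tl] assms(2))

lemma FP2_\<rho>:
  assumes "ptime_decidable 2 (\<lambda>ws. V (ws ! 0) (ws ! 1))"
  shows "FP2 (\<rho> V D (default t))"
proof -
  have nth: "ptime_computable 2 (\<lambda>ws. Some (ws ! 0))" "ptime_computable 2 (\<lambda>ws. Some (ws ! 1))"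
    by (simp_all add: ptime_computable_nth)
  have "ptime_computable 2 (\<lambda>ws. default t)"
    by (cases t) (simp_all add: default_def ptime_computable_None ptime_computable_const)
  then show ?thesis
    unfolding FP2_def \<rho>_simp
    by (intro ptime_computable_if ptime_computable_table decidable_conj decidable_eq ptime_valid assms nth
        total_comp1[OF ptime_computable_Cons] ptime_left total_comp1[OF ptime_computable_tl])
qed

text \<open>There are three kinds of values: an instance code is the square of the code of a short
  witness, the default is the square of \<open>[]\<close>, and the factors in the table have bounded
  length.\<close>

lemma honest_\<rho>:
  assumes V: "\<And>x u. V x u \<Longrightarrow> length u \<le> poly q (length x)"
  shows "honest (\<rho> V (table c a) (default t))"
proof -
  obtain PP where PP: "\<And>x y. length (pair (x, y)) \<le> poly PP (length x + length y)"
    using length_pair by blast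
  \<comment> \<open>The factor 2 counts the two equal factors of a square; 10 covers their leading
    bits and, generously, the factors in the table.\<close>
  define p where "p = [:10:] + smult 2 (pcompose PP ([:0, 1:] + q))"
  have "\<exists>x y. \<rho> V (table c a) (default t) (x, y) = Some z \<and> length x + length y \<le> poly p (length z)"
    if z: "z \<in> ran (\<rho> V (table c a) (default t))" for z
  proof -
    obtain x y where xy: "\<rho> V (table c a) (default t) (x, y) = Some z" using z by (auto simp: ran_def)
    show ?thesis
    proof (cases "x = y \<and> valid V x")
      case True
      then obtain w where w: "x = True # w" "V (left w) (right w)" by (auto simp: valid_def)
      have z: "z = False # False # left w"
        using xy True w(1) \<rho>_valid[of V x] by (metis list.sel(3) option.inject)
      have "length w = length (pair (left w, right w))" by simp
      also have "\<dots> \<le> poly PP (length (left w) + length (right w))" by (rule PP)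
      also have "\<dots> \<le> poly PP (length z + poly q (length z))"
        by (intro poly_mono_nat add_mono order_trans[OF V[OF w(2)]]) (simp_all add: z)
      finally have "length x + length y \<le> poly p (length z)"
        using True w(1) by (auto simp: p_def poly_pcompose)
      then show ?thesis using xy by blast
    next
      case False
      show ?thesis
      proof (cases "map_of (table c a) (x, y)")
        case None
        then have "\<rho> V (table c a) (default t) ([], []) = Some z"
          using xy False by (cases c; cases a) (auto simp: \<rho>_simp const_defs)
        then show ?thesis by (intro exI[of _ "[]"]) simp
      next
        case (Some w)
        then have "length x + length y \<le> 10"
          by (cases c; cases a) (auto simp: const_defs split: if_splits)
        then show ?thesis using xy by (intro exI[of _ x] exI[of _ y]) (simp add: p_def)
      qed
    qed
  qed
  then show ?thesis unfolding honest_def by blast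
qed

text \<open>Only squares of witness codes have instance codes as values, so an inverter applied to
  the code of \<open>x\<close> finds a witness for \<open>x\<close> if there is one. Its answer is
  checked, which guards against arbitrary answers outside the image; together this decides
  \<open>L\<close>.\<close>

lemma noninvertible_\<rho>:
  assumes V: "ptime_decidable 2 (\<lambda>ws. V (ws ! 0) (ws ! 1))" and L: "\<And>x. x \<in> L \<longleftrightarrow> (\<exists>u. V x u)" and "L \<notin> class_P"
  shows "noninvertible pair (\<rho> V (table c a) (default t))"
  unfolding noninvertible_def
proof
  assume "\<exists>f. FP1 (\<lambda>z. map_option pair (f z)) \<and> (\<forall>z\<in>ran (\<rho> V (table c a) (default t)).
      (\<rho> V (table c a) (default t) \<circ>\<^sub>m f) z = Some z)"
  then obtain f where f: "ptime_computable 1 (\<lambda>ws. map_option pair (f (ws ! 0)))"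
    "\<And>z. z \<in> ran (\<rho> V (table c a) (default t)) \<Longrightarrow> (\<rho> V (table c a) (default t) \<circ>\<^sub>m f) z = Some z"
    unfolding FP1_def by blast
  have nth: "ptime_computable (Suc 1) (\<lambda>ws. Some (ws ! 0))" "ptime_computable (Suc 1) (\<lambda>ws. Some (ws ! 1))"
    "ptime_computable 1 (\<lambda>ws. Some (ws ! 0))"
    by (rule ptime_computable_nth, simp)+
  let ?A = "\<lambda>x y. valid V (left y) \<and> left (tl (left y)) = x"
  let ?g = "\<lambda>x. map_option pair (f (False # False # x))"
  have "ptime_computable 1 (\<lambda>ws. ?g (ws ! 0))"
    using ptime_computable_comp1[OF f(1) total_comp1[OF ptime_computable_Cons total_comp1[OF ptime_computable_Cons nth(3)]]]
    by simp
  moreover have "ptime_decidable (Suc 1) (\<lambda>ws. ?A (ws ! 0) (ws ! 1))"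
    by (intro decidable_conj ptime_valid V decidable_eq ptime_left total_comp1[OF ptime_computable_tl] nth)
  ultimately have "ptime_decidable 1 (\<lambda>ws. \<exists>y. ?g (ws ! 0) = Some y \<and> ?A ((ws @ [y]) ! 0) ((ws @ [y]) ! 1))"
    by (rule decidable_let)
  moreover have "(\<exists>y. ?g x = Some y \<and> ?A x y) \<longleftrightarrow> x \<in> L" for x
  proof
    assume "\<exists>y. ?g x = Some y \<and> ?A x y"
    then show "x \<in> L" by (auto simp: valid_def L)
  next
    assume "x \<in> L"
    then obtain u where u: "V x u" using L by blast
    let ?z = "False # False # x"
    have "\<rho> V (table c a) (default t) (True # pair (x, u), True # pair (x, u)) = Some ?z"
      using u by (simp add: \<rho>_simp valid_def)
    then have "?z \<in> ran (\<rho> V (table c a) (default t))" by (auto simp: ran_def)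
    from f(2)[OF this] obtain y1 y2 where y: "f ?z = Some (y1, y2)" "\<rho> V (table c a) (default t) (y1, y2) = Some ?z"
      by (auto simp: map_comp_Some_iff)
    have "y1 = y2 \<and> valid V y1 \<and> left (tl y1) = x"
    proof (cases "y1 = y2 \<and> valid V y1")
      case True
      then show ?thesis using y(2) \<rho>_valid[of V y1] by (metis list.inject option.inject)
    next
      case False
      \<comment> \<open>Neither the default nor a value in the table starts with
        \<open>False # False\<close>, so this case is contradictory.\<close>
      then show ?thesis using y(2) by (cases c; cases a) (auto simp: \<rho>_simp const_defs split: if_splits)
    qed
    then show "\<exists>y. ?g x = Some y \<and> ?A x y" using y(1) by auto
  qed
  ultimately have "ptime_decidable 1 (\<lambda>ws. ws ! 0 \<in> L)"
    by (subst (asm) ptime_decidable_cong[where B = "\<lambda>ws. ws ! 0 \<in> L"]) (auto simp: nth_append)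
  then show False using \<open>L \<notin> class_P\<close> by (simp add: class_P_def)
qed

lemma OWF_if_P_neq_NP:
  assumes "class_P \<noteq> class_NP"
  shows "\<exists>\<sigma>. OWF pair N t c a \<sigma>"
proof -
  obtain L where L: "L \<in> class_NP" "L \<notin> class_P" using assms P_subset_NP by blast
  then obtain V p where V: "ptime_decidable 2 (\<lambda>ws. V (ws ! 0) (ws ! 1))"
    "\<And>x. x \<in> L \<longleftrightarrow> (\<exists>u. length u \<le> poly p (length x) \<and> V x u)"
    unfolding class_NP_def by auto
  \<comment> \<open>Building the length bound into the verifier makes every accepted witness short,
    as honesty demands.\<close>
  define V' where "V' x u \<longleftrightarrow> length u \<le> poly p (length x) \<and> V x u" for x u
  have "ptime_decidable 2 (\<lambda>ws. V' (ws ! 0) (ws ! 1))"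
    unfolding V'_def by (intro decidable_conj decidable_length_le_poly V(1)) (simp_all add: ptime_computable_nth)
  moreover have "x \<in> L \<longleftrightarrow> (\<exists>u. V' x u)" for x using V(2) by (simp add: V'_def)
  moreover have "length u \<le> poly p (length x)" if "V' x u" for x u using that by (simp add: V'_def)
  ultimately have "one_way pair (\<rho> V' (table c' a') (default t'))" for c' a' t'
    unfolding one_way_def using FP2_\<rho> honest_\<rho> noninvertible_\<rho> L(2) by blast
  moreover have "\<not> strong pair (\<rho> V' (table c' a') (default t'))" for c' a' t'
    using invertible_\<rho> by (simp add: strong_def strongly_noninvertible_def)
  \<comment> \<open>\<open>Star\<close> is treated like \<open>Y\<close>: a property is arranged to
    fail only if \<open>N\<close> is asked for.\<close>
  moreover have "meets r (r \<noteq> N)" for r by (cases r) auto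
  ultimately show ?thesis
    unfolding OWF_def
    by (intro exI[of _ "\<rho> V' (table (c \<noteq> N) (a \<noteq> N)) (default (t \<noteq> N))"])
       (simp add: total_\<rho> commutative_\<rho> associative_\<rho>)
qed

end

theorem theorem20:
  fixes pair :: "bits \<times> bits \<Rightarrow> bits"
    and t c a :: requirement
  assumes "standard_pairing pair"
  shows "(\<exists>\<sigma>. OWF pair N t c a \<sigma>) \<longleftrightarrow> class_P \<noteq> class_NP"
proof -
  interpret pairing pair by (rule pairing.intro) (rule assms)
  show ?thesis
    using OWF_if_P_neq_NP[of t c a] invertible_if_P_eq_NP by (auto simp: OWF_def one_way_def)
qed

end
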